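(* For every integer $n\geq 1$, the generation algorithm $\mathcal{A}(n)$ described in the context outputs exactly one representative of every isomorphism class of $C_4^q$-marked pregraphs with $n$ vertices.
   Context: **Pregraphs.** A pregraph is a finite multigraph which may also contain loops and semi-edges (a semi-edge is incident to a single vertex and contributes 1 to its degree; a loop contributes 2). Pregraphs are assumed to be connected unless stated otherwise. A pregraph is cubic if every vertex has degree 3. **$C_4^q$-factors.** A quotient of $C_4$ is a pregraph isomorphic to one of: $q_1$, the cycle on 4 vertices; $q_2$, two vertices joined by two parallel edges; $q_3$, two vertices joined by one edge, each vertex also incident to one semi-edge; $q_4$, one vertex incident to two semi-edges. A $C_4^q$-factor of a pregraph is a 2-factor (spanning subgraph in which every vertex has degree 2) each of whose components is a quotient of $C_4$. **Marked pregraphs.** A $C_4^q$-marked pregraph is a connected cubic pregraph in which all edges (including semi-edges) of a given $C_4^q$-factor are coloured with colour 0 and all other edges with colour 1. A partial $C_4^q$-marked pregraph is a not necessarily connected pregraph in which all edges of a given $C_4^q$-factor are coloured 0, all other edges are coloured 1, and every vertex has degree 2 or 3; its vertices of degree 2 are called deficient. The components of the colour 0 subgraph are called marked quotients. Isomorphisms and automorphisms of (partial) $C_4^q$-marked pregraphs preserve the colours. A partial $C_4^q$-marked pregraph $P'$ is an extension of $P$ if $P$ is a subgraph of $P'$ with the same edge colours and $P$ and $P'$ have the same number of vertices. **Block partition.** The block partition of a (partial) $C_4^q$-marked pregraph $P$ is the unique partition of $P$ into induced subgraphs (containing all semi-edges at their vertices and all edges of $P$ between their vertices), called blocks, of the following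 types: 1. subgraphs induced by maximal ladders containing only marked quotients of type $q_1$; here such a ladder is a subgraph isomorphic to the cartesian product of $K_2$ and a path on $2k$ vertices ($k\geq 1$) whose $(2i-1)$-th and $2i$-th rungs together span a marked quotient of type $q_1$ for each $i=1,\dots,k$ ("$q_1$ blocks"); 2. maximal connected subgraphs induced by marked quotients of type $q_2$ ("$q_2$ blocks"); 3. maximal connected subgraphs induced by marked quotients of type $q_3$ ("$q_3$ blocks"); 4. subgraphs induced by a single marked quotient of type $q_4$ ("$q_4$ blocks"). **Block lists.** A block on its own is a connected partial $C_4^q$-marked pregraph whose block partition consists of a single block; its number of missing connections is its number of deficient vertices. A list of blocks is a finite multiset $L$ of isomorphism types of blocks. It corresponds to the partial $C_4^q$-marked pregraph that is the disjoint union of the blocks in $L$. Let $\mathcal{B}_L$ be the set of partial $C_4^q$-marked pregraphs whose block partition is isomorphic to $L$. A list $L$ is acceptable if and only if - the sequence of the numbers of missing connections of the blocks in $L$ is the degree sequence of a loopless multigraph, - at most half of the missing connections of $L$ lie in $q_2$ blocks, - at most half of the missing connections of $L$ lie in $q_3$ blocks, - if some block of $L$ has no missing connections, then $L$ consists of only that block. **Valid connections.** A connection is a new edge of colour 1 between two distinct deficient vertices. When the block list is $L$, adding connections is valid if the resulting partial $C_4^q$-marked pregraph is still in $\mathcal{B}_L$ (no new block is created) and has no connected component that does not contain all the vertices and contains no deficient vertices. **The algorithm $\mathcal{A}(n)$.** 1. Generate (each exactly once) all acceptable lists of blocks such that the sum of the orders of the blocks is $n$. 2. For each such list $L$, construct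 the corresponding partial $C_4^q$-marked pregraph $P$, and recursively perform the following steps: (a) If $P$ has no deficient vertices: output $P$ and return. (b) Compute the automorphism group $\mathrm{Aut}(P)$ and the orbits of deficient vertices of $P$ under it. (c) If $\mathrm{Aut}(P)$ acts trivially on the set of deficient vertices of $P$, complete $P$ by adding the remaining connections in all possible valid ways (each distinct way once), and output every complete $C_4^q$-marked pregraph obtained. (d) Otherwise choose a smallest orbit $O$ of deficient vertices, and connect all vertices in $O$ to deficient vertices (in $O$ or not; every added edge is incident to a vertex of $O$) in all valid ways, keeping exactly one representative of each isomorphism class of resulting partial $C_4^q$-marked pregraphs; apply these steps recursively to each partial $C_4^q$-marked pregraph kept. *)

theory Defs
  imports "HOL-Library.Multiset" "HOL-Combinatorics.Permutations"
begin

section \<open>Pregraphs\<close>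

text \<open>Edges carry no identity: a pregraph has a multiset of edges, and an edge is the multiset of its
  ends, so \<open>{#u, v#}\<close> with \<open>u \<noteq> v\<close> is an ordinary edge, \<open>{#v, v#}\<close> a loop and
  \<open>{#v#}\<close> a semi-edge. Connectedness is stated separately wherever it is required.\<close>

record 'v pregraph =
  verts :: "'v set"
  edges :: "'v multiset multiset"

definition is_pregraph :: "'v pregraph \<Rightarrow> bool" where
  "is_pregraph G \<longleftrightarrow> finite (verts G) \<and>
     (\<forall>e \<in># edges G. size e \<in> {1, 2} \<and> set_mset e \<subseteq> verts G)"

definition degree :: "'v pregraph \<Rightarrow> 'v \<Rightarrow> nat" where
  "degree G v = (\<Sum>e \<in># edges G. count e v)"

definition cubic :: "'v pregraph \<Rightarrow> bool" where
  "cubic G \<longleftrightarrow> (\<forall>v \<in> verts G. degree G v = 3)"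

definition subgraph :: "'v pregraph \<Rightarrow> 'v pregraph \<Rightarrow> bool" where
  "subgraph H G \<longleftrightarrow> is_pregraph H \<and> verts H \<subseteq> verts G \<and> edges H \<subseteq># edges G"

definition induced :: "'v pregraph \<Rightarrow> 'v set \<Rightarrow> 'v pregraph" where
  "induced G S = \<lparr>verts = verts G \<inter> S, edges = {#e \<in># edges G. set_mset e \<subseteq> S#}\<rparr>"

definition adjacency :: "'v pregraph \<Rightarrow> ('v \<times> 'v) set" where
  "adjacency G = {(u, v). {#u, v#} \<in># edges G}"

definition connected_pregraph :: "'v pregraph \<Rightarrow> bool" where
  "connected_pregraph G \<longleftrightarrow>
     verts G \<noteq> {} \<and> (\<forall>u \<in> verts G. \<forall>v \<in> verts G. (u, v) \<in> (adjacency G)\<^sup>*)"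

definition components :: "'v pregraph \<Rightarrow> 'v pregraph set" where
  "components G = (\<lambda>v. induced G {w. (v, w) \<in> (adjacency G)\<^sup>*}) ` verts G"

definition iso_map :: "('v \<Rightarrow> 'w) \<Rightarrow> 'v pregraph \<Rightarrow> 'w pregraph \<Rightarrow> bool" where
  "iso_map f G H \<longleftrightarrow> bij_betw f (verts G) (verts H) \<and>
     edges H = image_mset (image_mset f) (edges G)"

section \<open>Quotients of the 4-cycle and factors\<close>

datatype c4_type = Q1 | Q2 | Q3 | Q4

fun c4_quotient :: "c4_type \<Rightarrow> nat pregraph" where
  "c4_quotient Q1 = \<lparr>verts = {0, 1, 2, 3}, edges = {#{#0, 1#}, {#1, 2#}, {#2, 3#}, {#3, 0#}#}\<rparr>"
| "c4_quotient Q2 = \<lparr>verts = {0, 1}, edges = {#{#0, 1#}, {#0, 1#}#}\<rparr>"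
| "c4_quotient Q3 = \<lparr>verts = {0, 1}, edges = {#{#0, 1#}, {#0#}, {#1#}#}\<rparr>"
| "c4_quotient Q4 = \<lparr>verts = {0}, edges = {#{#0#}, {#0#}#}\<rparr>"

definition has_type :: "'v pregraph \<Rightarrow> c4_type \<Rightarrow> bool" where
  "has_type G t \<longleftrightarrow> (\<exists>f. iso_map f (c4_quotient t) G)"

definition C4q_factor :: "'v pregraph \<Rightarrow> 'v pregraph \<Rightarrow> bool" where
  "C4q_factor F G \<longleftrightarrow> subgraph F G \<and> verts F = verts G \<and>
     (\<forall>v \<in> verts F. degree F v = 2) \<and> (\<forall>C \<in> components F. \<exists>t. has_type C t)"

section \<open>Marked pregraphs\<close>

record 'v coloured =
  cverts :: "'v set"
  edges0 :: "'v multiset multiset"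
  edges1 :: "'v multiset multiset"

definition underlying :: "'v coloured \<Rightarrow> 'v pregraph" where
  "underlying P = \<lparr>verts = cverts P, edges = edges0 P + edges1 P\<rparr>"

definition colour0 :: "'v coloured \<Rightarrow> 'v pregraph" where
  "colour0 P = \<lparr>verts = cverts P, edges = edges0 P\<rparr>"

definition marked :: "'v coloured \<Rightarrow> bool" where
  "marked P \<longleftrightarrow> is_pregraph (underlying P) \<and> connected_pregraph (underlying P) \<and>
     cubic (underlying P) \<and> C4q_factor (colour0 P) (underlying P)"

definition partial_marked :: "'v coloured \<Rightarrow> bool" where
  "partial_marked P \<longleftrightarrow> is_pregraph (underlying P) \<and>
     (\<forall>v \<in> cverts P. degree (underlying P) v \<in> {2, 3}) \<and>
     C4q_factor (colour0 P) (underlying P)"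

definition deficient :: "'v coloured \<Rightarrow> 'v set" where
  "deficient P = {v \<in> cverts P. degree (underlying P) v = 2}"

definition marked_quotients :: "'v coloured \<Rightarrow> 'v pregraph set" where
  "marked_quotients P = components (colour0 P)"

definition coloured_iso_map :: "('v \<Rightarrow> 'w) \<Rightarrow> 'v coloured \<Rightarrow> 'w coloured \<Rightarrow> bool" where
  "coloured_iso_map f P R \<longleftrightarrow> bij_betw f (cverts P) (cverts R) \<and>
     edges0 R = image_mset (image_mset f) (edges0 P) \<and>
     edges1 R = image_mset (image_mset f) (edges1 P)"

definition isomorphic :: "'v coloured \<Rightarrow> 'w coloured \<Rightarrow> bool" where
  "isomorphic P R \<longleftrightarrow> (\<exists>f. coloured_iso_map f P R)"

definition Aut :: "'v coloured \<Rightarrow> ('v \<Rightarrow> 'v) set" where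
  "Aut P = {f. f permutes cverts P \<and> coloured_iso_map f P P}"

definition induced_coloured :: "'v coloured \<Rightarrow> 'v set \<Rightarrow> 'v coloured" where
  "induced_coloured P S = \<lparr>cverts = cverts P \<inter> S,
     edges0 = {#e \<in># edges0 P. set_mset e \<subseteq> S#},
     edges1 = {#e \<in># edges1 P. set_mset e \<subseteq> S#}\<rparr>"

section \<open>The block partition\<close>

text \<open>The cartesian product of \<open>K\<^sub>2\<close> and the path on \<open>2 * k\<close> vertices; the rung with index
  \<open>j\<close> joins \<open>(False, j)\<close> and \<open>(True, j)\<close>, with indices starting from 0.\<close>

definition ladder_graph :: "nat \<Rightarrow> (bool \<times> nat) pregraph" where
  "ladder_graph k = \<lparr>verts = UNIV \<times> {..<2 * k},
     edges = mset_set ({{#(False, j), (True, j)#} | j. j < 2 * k} \<union>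
                       {{#(b, j), (b, Suc j)#} | b j. Suc j < 2 * k})\<rparr>"

definition q1_ladder :: "'v coloured \<Rightarrow> 'v pregraph \<Rightarrow> bool" where
  "q1_ladder P H \<longleftrightarrow> subgraph H (underlying P) \<and>
     (\<exists>k f. k \<ge> 1 \<and> iso_map f (ladder_graph k) H \<and>
        (\<forall>i < k. induced H (f ` (UNIV \<times> {2 * i, 2 * i + 1})) \<in> marked_quotients P \<and>
                 has_type (induced H (f ` (UNIV \<times> {2 * i, 2 * i + 1}))) Q1))"

definition maximal_q1_ladder :: "'v coloured \<Rightarrow> 'v pregraph \<Rightarrow> bool" where
  "maximal_q1_ladder P H \<longleftrightarrow> q1_ladder P H \<and>
     (\<forall>H'. q1_ladder P H' \<and> subgraph H H' \<longrightarrow> H' = H)"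

definition quotient_cluster :: "'v coloured \<Rightarrow> c4_type \<Rightarrow> 'v set \<Rightarrow> bool" where
  "quotient_cluster P t S \<longleftrightarrow>
     (\<exists>\<Q> \<subseteq> {Q \<in> marked_quotients P. has_type Q t}. S = (\<Union>Q \<in> \<Q>. verts Q)) \<and>
     connected_pregraph (induced (underlying P) S)"

definition maximal_cluster :: "'v coloured \<Rightarrow> c4_type \<Rightarrow> 'v set \<Rightarrow> bool" where
  "maximal_cluster P t S \<longleftrightarrow> quotient_cluster P t S \<and>
     (\<forall>S'. quotient_cluster P t S' \<and> S \<subseteq> S' \<longrightarrow> S' = S)"

text \<open>\<open>block_set P t S\<close>: the vertex set \<open>S\<close> induces a block of \<open>P\<close> of the type belonging to \<open>t\<close>.\<close>

fun block_set :: "'v coloured \<Rightarrow> c4_type \<Rightarrow> 'v set \<Rightarrow> bool" where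
  "block_set P Q1 S \<longleftrightarrow> (\<exists>H. maximal_q1_ladder P H \<and> S = verts H)"
| "block_set P Q2 S \<longleftrightarrow> maximal_cluster P Q2 S"
| "block_set P Q3 S \<longleftrightarrow> maximal_cluster P Q3 S"
| "block_set P Q4 S \<longleftrightarrow> (\<exists>Q \<in> marked_quotients P. has_type Q Q4 \<and> S = verts Q)"

definition block_partition :: "'v coloured \<Rightarrow> 'v set set" where
  "block_partition P = {S. \<exists>t. block_set P t S}"

section \<open>Block lists\<close>

definition block :: "'v coloured \<Rightarrow> bool" where
  "block B \<longleftrightarrow> partial_marked B \<and> connected_pregraph (underlying B) \<and>
     (\<exists>S. block_partition B = {S})"

text \<open>An isomorphism type is the class of all isomorphic pregraphs with natural numbers as
  vertices.\<close>

type_synonym iso_type = "nat coloured set"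

definition iso_class :: "'v coloured \<Rightarrow> iso_type" where
  "iso_class P = {R. isomorphic P R}"

type_synonym block_list = "iso_type multiset"

definition is_block_list :: "block_list \<Rightarrow> bool" where
  "is_block_list L \<longleftrightarrow> (\<forall>T \<in># L. \<exists>B :: nat coloured. block B \<and> T = iso_class B)"

text \<open>The following quantities do not depend on the choice of the representative.\<close>

definition representative :: "iso_type \<Rightarrow> nat coloured" where
  "representative T = (SOME B. B \<in> T)"

definition order_of :: "iso_type \<Rightarrow> nat" where
  "order_of T = card (cverts (representative T))"

definition missing :: "iso_type \<Rightarrow> nat" where
  "missing T = card (deficient (representative T))"

definition block_of_type :: "c4_type \<Rightarrow> iso_type \<Rightarrow> bool" where
  "block_of_type t T \<longleftrightarrow> block_set (representative T) t (cverts (representative T))"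

definition corresponds :: "nat coloured \<Rightarrow> block_list \<Rightarrow> bool" where
  "corresponds P L \<longleftrightarrow> (\<exists>Bs :: nat coloured list.
     (\<forall>B \<in> set Bs. block B) \<and> mset (map iso_class Bs) = L \<and>
     (\<forall>i < length Bs. \<forall>j < i. cverts (Bs ! i) \<inter> cverts (Bs ! j) = {}) \<and>
     P = \<lparr>cverts = (\<Union>B \<in> set Bs. cverts B),
          edges0 = (\<Sum>B \<leftarrow> Bs. edges0 B), edges1 = (\<Sum>B \<leftarrow> Bs. edges1 B)\<rparr>)"

definition block_list_of :: "'v coloured \<Rightarrow> block_list" where
  "block_list_of P = image_mset (\<lambda>S. iso_class (induced_coloured P S)) (mset_set (block_partition P))"

definition \<B> :: "block_list \<Rightarrow> 'v coloured set" where
  "\<B> L = {P. partial_marked P \<and> block_list_of P = L}"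

definition loopless_degree_sequence :: "nat multiset \<Rightarrow> bool" where
  "loopless_degree_sequence D \<longleftrightarrow> (\<exists>G :: nat pregraph. is_pregraph G \<and>
     (\<forall>e \<in># edges G. \<exists>u v. u \<noteq> v \<and> e = {#u, v#}) \<and>
     image_mset (degree G) (mset_set (verts G)) = D)"

definition acceptable :: "block_list \<Rightarrow> bool" where
  "acceptable L \<longleftrightarrow> is_block_list L \<and>
     loopless_degree_sequence (image_mset missing L) \<and>
     2 * (\<Sum>T \<in># {#T \<in># L. block_of_type Q2 T#}. missing T) \<le> (\<Sum>T \<in># L. missing T) \<and>
     2 * (\<Sum>T \<in># {#T \<in># L. block_of_type Q3 T#}. missing T) \<le> (\<Sum>T \<in># L. missing T) \<and>
     ((\<exists>T \<in># L. missing T = 0) \<longrightarrow> size L = 1)"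

definition acceptable_lists :: "nat \<Rightarrow> block_list set" where
  "acceptable_lists n = {L. acceptable L \<and> (\<Sum>T \<in># L. order_of T) = n}"

section \<open>Connections\<close>

text \<open>A set of connections can be added simultaneously if it is a matching of deficient vertices,
  since a vertex is no longer deficient once it has received a connection.\<close>

definition connections :: "'v coloured \<Rightarrow> 'v multiset set \<Rightarrow> bool" where
  "connections P M \<longleftrightarrow>
     (\<forall>c \<in> M. \<exists>u v. c = {#u, v#} \<and> u \<noteq> v \<and> u \<in> deficient P \<and> v \<in> deficient P) \<and>
     (\<forall>c \<in> M. \<forall>d \<in> M. c \<noteq> d \<longrightarrow> set_mset c \<inter> set_mset d = {})"

definition add_connections :: "'v coloured \<Rightarrow> 'v multiset set \<Rightarrow> 'v coloured" where
  "add_connections P M = P\<lparr>edges1 := edges1 P + mset_set M\<rparr>"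

definition valid :: "block_list \<Rightarrow> 'v coloured \<Rightarrow> 'v multiset set \<Rightarrow> bool" where
  "valid L P M \<longleftrightarrow> connections P M \<and> add_connections P M \<in> \<B> L \<and>
     \<not> (\<exists>C \<in> components (underlying (add_connections P M)).
          verts C \<noteq> cverts P \<and> verts C \<inter> deficient (add_connections P M) = {})"

section \<open>The algorithm\<close>

definition acts_trivially :: "'v coloured \<Rightarrow> bool" where
  "acts_trivially P \<longleftrightarrow> (\<forall>f \<in> Aut P. \<forall>v \<in> deficient P. f v = v)"

definition deficient_orbits :: "'v coloured \<Rightarrow> 'v set set" where
  "deficient_orbits P = (\<lambda>v. (\<lambda>f. f v) ` Aut P) ` deficient P"

definition smallest_orbit :: "'v coloured \<Rightarrow> 'v set \<Rightarrow> bool" where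
  "smallest_orbit P Ob \<longleftrightarrow> Ob \<in> deficient_orbits P \<and>
     (\<forall>Ob' \<in> deficient_orbits P. card Ob \<le> card Ob')"

definition completions :: "block_list \<Rightarrow> 'v coloured \<Rightarrow> 'v multiset set set" where
  "completions L P = {M. valid L P M \<and> deficient (add_connections P M) = {}}"

definition orbit_extensions :: "block_list \<Rightarrow> 'v coloured \<Rightarrow> 'v set \<Rightarrow> 'v coloured set" where
  "orbit_extensions L P Ob = {add_connections P M | M. valid L P M \<and>
     Ob \<subseteq> (\<Union>c \<in> M. set_mset c) \<and> (\<forall>c \<in> M. set_mset c \<inter> Ob \<noteq> {})}"

definition transversal :: "'v coloured set \<Rightarrow> 'v coloured set \<Rightarrow> bool" where
  "transversal K X \<longleftrightarrow> K \<subseteq> X \<and> (\<forall>P \<in> X. \<exists>!R. R \<in> K \<and> isomorphic P R)"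

text \<open>The algorithm leaves open which representatives and which smallest orbits are chosen.
  \<open>run L P out\<close> says that, for some admissible choices, processing \<open>P\<close> ends with the outputs
  \<open>out\<close>, counted with multiplicity.\<close>

inductive run :: "block_list \<Rightarrow> nat coloured \<Rightarrow> nat coloured multiset \<Rightarrow> bool"
  for L :: block_list where
  complete: "deficient P = {} \<Longrightarrow> run L P {#P#}"
| trivial: "deficient P \<noteq> {} \<Longrightarrow> acts_trivially P \<Longrightarrow>
    run L P (image_mset (add_connections P) (mset_set (completions L P)))"
| branch: "deficient P \<noteq> {} \<Longrightarrow> \<not> acts_trivially P \<Longrightarrow> smallest_orbit P Ob \<Longrightarrow>
    transversal K (orbit_extensions L P Ob) \<Longrightarrow> (\<forall>R \<in> K. run L R (out R)) \<Longrightarrow>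
    run L P (\<Sum>R \<in> K. out R)"

definition algorithm :: "nat \<Rightarrow> nat coloured multiset \<Rightarrow> bool" where
  "algorithm n out \<longleftrightarrow> (\<exists>P outs.
     (\<forall>L \<in> acceptable_lists n. corresponds (P L) L \<and> run L (P L) (outs L)) \<and>
     out = (\<Sum>L \<in> acceptable_lists n. outs L))"

text \<open>Whatever the choices, the recursion is never entered infinitely often: every initial pregraph
  lies in the well-founded part of the relation between a call and its possible recursive calls.\<close>

definition recursive_call :: "block_list \<Rightarrow> nat coloured \<Rightarrow> nat coloured \<Rightarrow> bool" where
  "recursive_call L R P \<longleftrightarrow> deficient P \<noteq> {} \<and> \<not> acts_trivially P \<and>
     (\<exists>Ob. smallest_orbit P Ob \<and> R \<in> orbit_extensions L P Ob)"

definition terminates :: "nat \<Rightarrow> bool" where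
  "terminates n \<longleftrightarrow> finite (acceptable_lists n) \<and>
     (\<forall>L \<in> acceptable_lists n. \<forall>P. corresponds P L \<longrightarrow> Wellfounded.accp (recursive_call L) P)"

end

theory Submission
  imports Defs
begin

text \<open>
What the algorithm has fixed at any moment can be read off from the finished pregraph. Call
  adding connections to \<open>P\<close> a completion if it yields a marked pregraph with the given block list,
  and call \<open>P\<close> rigid if every isomorphism between two completed pregraphs of \<open>P\<close> is an automorphism
  of \<open>P\<close> itself. Let \<open>P\<close> be rigid and let \<open>Ob\<close> be an orbit of its deficient vertices. An isomorphism
  between two completed pregraphs then maps \<open>Ob\<close> to itself, and so it maps the connections that
  meet \<open>Ob\<close> in the first one to those that meet \<open>Ob\<close> in the second one. Hence isomorphic results
  pass through isomorphic extensions along \<open>Ob\<close>, so that keeping one extension of every isomorphism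
  class neither loses nor repeats a class, and these extensions are rigid again
  (\<open>rigid_orbit_extension\<close>). If all deficient vertices are fixed by the automorphisms of \<open>P\<close>, the same
  argument shows that two different completions never give isomorphic results. By induction, a run
  from a rigid \<open>P\<close> outputs every completed pregraph exactly once up to isomorphism (\<open>run_exact\<close>).

  The disjoint union of the blocks of a list is rigid because it consists of the edges of the
  completed pregraph that lie inside a block, and the block partition is invariant under
  isomorphisms (\<open>core_of_completion\<close>, \<open>rigid_core\<close>). This needs that the blocks form a partition of
  the vertices. The crucial case is that two maximal ladders with a common vertex have the same
  vertices (\<open>maximal_ladders_meet\<close>): a vertex has at most one edge of colour 1, so a square is linked
  to a ladder only at its two ends or, if the ladder is a single square, at a side of it, and there
  the ladder could be prolonged.

  A run must also be able to reach every completed pregraph through valid steps. New connections can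
  only merge blocks. If the block list stays the same, then no two blocks have merged and no
  connection lies inside a block (\<open>extends_same_blocks\<close>), and this carries over to every pregraph in
  between (\<open>extends_middle\<close>). Therefore any part of a completion is a valid set of connections
  (\<open>valid_subset_completion\<close>).

  It remains to see that every marked pregraph is reached from an acceptable list. Contracting every
  block to a vertex gives a multigraph without loops whose degrees are the numbers of missing
  connections. No edge of it joins two \<open>q\<^sub>2\<close> blocks or two \<open>q\<^sub>3\<close> blocks, since these would be one block,
  and a block of degree 0 is everything by connectedness (\<open>acceptable_block_list\<close>). Outputs for
  different lists are not isomorphic since the block list is an isomorphism invariant
  (\<open>block_list_of_isomorphic\<close>).
\<close>

section \<open>Renaming the vertices of a pregraph\<close>

lemma image_mset_inv_into:
  assumes "inj_on f A" "set_mset x \<subseteq> A"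
  shows "image_mset (inv_into A f) (image_mset f x) = x"
proof -
  have "image_mset (inv_into A f \<circ> f) x = image_mset id x"
    using assms by (intro image_mset_cong) (auto simp: subset_iff)
  then show ?thesis by (simp add: multiset.map_comp)
qed

lemma image_mset_inj_on_eq:
  assumes "inj_on f A" "set_mset x \<subseteq> A" "set_mset y \<subseteq> A" "image_mset f x = image_mset f y"
  shows "x = y"
  using image_mset_inv_into[OF assms(1,2)] image_mset_inv_into[OF assms(1,3)] assms(4) by metis

lemma count_image_mset_inj_on:
  assumes "inj_on f A" "set_mset x \<subseteq> A" "v \<in> A"
  shows "count (image_mset f x) (f v) = count x v"
  using assms(2)
proof (induction x)
  case (add a x)
  then show ?case using assms(1,3) by (auto dest: inj_onD)
qed simp

lemma image_mset_eq_pair: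
  assumes "image_mset f e = {#x, y#}"
  shows "\<exists>u v. e = {#u, v#} \<and> f u = x \<and> f v = y"
proof -
  obtain N a where 1: "e = add_mset a N" "f a = x" "image_mset f N = {#y#}"
    using msed_map_invR[OF assms] by auto
  obtain M b where "N = add_mset b M" "f b = y" "image_mset f M = {#}"
    using msed_map_invR[OF 1(3)] by auto
  then show ?thesis using 1 by auto
qed

lemma filter_image_mset_inj_on:
  assumes "inj_on f A" "\<forall>e \<in># E. set_mset e \<subseteq> A" "S \<subseteq> A"
  shows "{#e \<in># image_mset (image_mset f) E. set_mset e \<subseteq> f ` S#} =
         image_mset (image_mset f) {#e \<in># E. set_mset e \<subseteq> S#}"
  using assms(2)
proof (induction E)
  case (add e E)
  have "f ` set_mset e \<subseteq> f ` S \<longleftrightarrow> set_mset e \<subseteq> S"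
  proof -
    have "f x \<in> f ` S \<longleftrightarrow> x \<in> S" if "x \<in># e" for x
      using inj_on_image_mem_iff[OF assms(1) _ assms(3), of x] that add.prems by auto
    then show ?thesis by (auto simp: image_subset_iff)
  qed
  then show ?case using add by auto
qed simp

text \<open>An isomorphism is the same as an injective renaming of the vertices (\<open>iso_map_iff\<close>,
  \<open>coloured_iso_map_iff\<close>), which makes its target a function of its source. Invariance under
  isomorphism is therefore stated for \<open>map_pregraph\<close> and \<open>map_coloured\<close>.\<close>

definition map_pregraph :: "('v \<Rightarrow> 'w) \<Rightarrow> 'v pregraph \<Rightarrow> 'w pregraph" where
  "map_pregraph f G = \<lparr>verts = f ` verts G, edges = image_mset (image_mset f) (edges G)\<rparr>"

definition map_coloured :: "('v \<Rightarrow> 'w) \<Rightarrow> 'v coloured \<Rightarrow> 'w coloured" where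
  "map_coloured f P = \<lparr>cverts = f ` cverts P, edges0 = image_mset (image_mset f) (edges0 P),
     edges1 = image_mset (image_mset f) (edges1 P)\<rparr>"

lemma map_pregraph_simps [simp]:
  "verts (map_pregraph f G) = f ` verts G"
  "edges (map_pregraph f G) = image_mset (image_mset f) (edges G)"
  by (simp_all add: map_pregraph_def)

lemma map_coloured_simps [simp]:
  "cverts (map_coloured f P) = f ` cverts P"
  "edges0 (map_coloured f P) = image_mset (image_mset f) (edges0 P)"
  "edges1 (map_coloured f P) = image_mset (image_mset f) (edges1 P)"
  by (simp_all add: map_coloured_def)

lemma underlying_simps [simp]:
  "verts (underlying P) = cverts P" "edges (underlying P) = edges0 P + edges1 P"
  "verts (colour0 P) = cverts P" "edges (colour0 P) = edges0 P"
  by (simp_all add: underlying_def colour0_def)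

lemma induced_simps [simp]:
  "verts (induced G S) = verts G \<inter> S" "edges (induced G S) = {#e \<in># edges G. set_mset e \<subseteq> S#}"
  "cverts (induced_coloured P S) = cverts P \<inter> S"
  "edges0 (induced_coloured P S) = {#e \<in># edges0 P. set_mset e \<subseteq> S#}"
  "edges1 (induced_coloured P S) = {#e \<in># edges1 P. set_mset e \<subseteq> S#}"
  by (simp_all add: induced_def induced_coloured_def)

lemma underlying_map: "underlying (map_coloured f P) = map_pregraph f (underlying P)"
  and colour0_map: "colour0 (map_coloured f P) = map_pregraph f (colour0 P)"
  and underlying_induced: "underlying (induced_coloured P S) = induced (underlying P) S"
  and colour0_induced: "colour0 (induced_coloured P S) = induced (colour0 P) S"
  by (simp_all add: underlying_def colour0_def map_pregraph_def induced_def)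

lemma iso_map_iff: "iso_map f G H \<longleftrightarrow> inj_on f (verts G) \<and> H = map_pregraph f G"
  by (auto simp: iso_map_def bij_betw_def map_pregraph_def)

lemma coloured_iso_map_iff:
  "coloured_iso_map f P R \<longleftrightarrow> inj_on f (cverts P) \<and> R = map_coloured f P"
  by (auto simp: coloured_iso_map_def bij_betw_def map_coloured_def)

lemma is_pregraphD:
  assumes "is_pregraph G"
  shows "finite (verts G)" "e \<in># edges G \<Longrightarrow> set_mset e \<subseteq> verts G"
    "e \<in># edges G \<Longrightarrow> size e = 1 \<or> size e = 2"
  using assms by (auto simp: is_pregraph_def)

lemma is_pregraph_colour0: "is_pregraph (underlying P) \<Longrightarrow> is_pregraph (colour0 P)"
  by (auto simp: is_pregraph_def)

lemma is_pregraph_induced: "is_pregraph G \<Longrightarrow> is_pregraph (induced G S)"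
  by (auto simp: is_pregraph_def)

lemma is_pregraph_map:
  assumes "is_pregraph G"
  shows "is_pregraph (map_pregraph f G)"
  using assms by (auto simp: is_pregraph_def)

lemma map_pregraph_comp: "map_pregraph g (map_pregraph f G) = map_pregraph (g \<circ> f) G"
  by (simp add: map_pregraph_def multiset.map_comp image_comp o_def)

lemma map_coloured_comp: "map_coloured g (map_coloured f P) = map_coloured (g \<circ> f) P"
  by (simp add: map_coloured_def multiset.map_comp image_comp o_def)

lemma image_image_mset_cong:
  assumes "\<forall>e \<in># E. set_mset e \<subseteq> A" "\<And>v. v \<in> A \<Longrightarrow> f v = g v"
  shows "image_mset (image_mset f) E = image_mset (image_mset g) E"
  using assms by (intro image_mset_cong) (auto intro!: image_mset_cong)

lemma map_pregraph_cong:
  assumes "is_pregraph G" "\<And>v. v \<in> verts G \<Longrightarrow> f v = g v"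
  shows "map_pregraph f G = map_pregraph g G"
  using image_image_mset_cong[of "edges G" "verts G" f g] assms is_pregraphD(2)[OF assms(1)]
  by (auto simp: map_pregraph_def)

lemma map_coloured_cong:
  assumes "is_pregraph (underlying P)" "\<And>v. v \<in> cverts P \<Longrightarrow> f v = g v"
  shows "map_coloured f P = map_coloured g P"
  using image_image_mset_cong[of "edges0 P" "cverts P" f g] image_image_mset_cong[of "edges1 P" "cverts P" f g]
    assms(2) is_pregraphD(2)[OF assms(1)]
  by (auto simp: map_coloured_def)

lemma map_pregraph_id: "map_pregraph (\<lambda>v. v) G = G"
  by (simp add: map_pregraph_def)

lemma map_coloured_id: "map_coloured (\<lambda>v. v) P = P"
  by (simp add: map_coloured_def)

lemma map_coloured_inv_into:
  assumes "is_pregraph (underlying P)" "inj_on f (cverts P)"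
  shows "map_coloured (inv_into (cverts P) f) (map_coloured f P) = P"
proof -
  have "map_coloured (inv_into (cverts P) f \<circ> f) P = map_coloured (\<lambda>v. v) P"
    using assms by (intro map_coloured_cong) auto
  then show ?thesis by (simp add: map_coloured_comp map_coloured_id)
qed

lemma isomorphic_map: "inj_on f (cverts P) \<Longrightarrow> isomorphic P (map_coloured f P)"
  by (auto simp: isomorphic_def coloured_iso_map_iff)

lemma isomorphic_refl: "isomorphic P P"
  using isomorphic_map[of "\<lambda>v. v" P] by (simp add: map_coloured_id)

lemma isomorphic_trans: "isomorphic P R \<Longrightarrow> isomorphic R T \<Longrightarrow> isomorphic P T"
  unfolding isomorphic_def coloured_iso_map_iff
  by (metis comp_inj_on map_coloured_comp map_coloured_simps(1))

lemma isomorphic_sym: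
  assumes "is_pregraph (underlying P)" "isomorphic P R"
  shows "isomorphic R P"
proof -
  obtain f where f: "inj_on f (cverts P)" "R = map_coloured f P"
    using assms(2) by (auto simp: isomorphic_def coloured_iso_map_iff)
  have "inj_on (inv_into (cverts P) f) (cverts R)"
    using f by (simp add: inj_on_inv_into)
  then show ?thesis
    using map_coloured_inv_into[OF assms(1) f(1)] f(2) by (metis isomorphic_map)
qed

lemma degree_map:
  assumes "is_pregraph G" "inj_on f (verts G)" "v \<in> verts G"
  shows "degree (map_pregraph f G) (f v) = degree G v"
proof -
  have "{#count (image_mset f e) (f v). e \<in># edges G#} = {#count e v. e \<in># edges G#}"
    using count_image_mset_inj_on[OF assms(2) is_pregraphD(2)[OF assms(1)] assms(3)]
    by (intro image_mset_cong) auto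
  then show ?thesis by (simp add: degree_def multiset.map_comp o_def)
qed

lemma adjacency_sym: "(u, v) \<in> adjacency G \<Longrightarrow> (v, u) \<in> adjacency G"
  by (simp add: adjacency_def add_mset_commute)

lemma adjacency_rtrancl_sym: "(u, v) \<in> (adjacency G)\<^sup>* \<Longrightarrow> (v, u) \<in> (adjacency G)\<^sup>*"
  by (meson adjacency_sym symD symI sym_rtrancl)

lemma adjacency_verts:
  "is_pregraph G \<Longrightarrow> (u, v) \<in> adjacency G \<Longrightarrow> u \<in> verts G \<and> v \<in> verts G"
  using is_pregraphD(2)[of G "{#u, v#}"] by (auto simp: adjacency_def)

lemma reach_verts:
  assumes "is_pregraph G" "(u, v) \<in> (adjacency G)\<^sup>*" "u \<in> verts G"
  shows "v \<in> verts G"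
  using assms(2,3) by (induction) (auto dest: adjacency_verts[OF assms(1)])

lemma adjacency_map:
  "(x, y) \<in> adjacency (map_pregraph f G) \<longleftrightarrow> (\<exists>u v. (u, v) \<in> adjacency G \<and> x = f u \<and> y = f v)"
  by (auto simp: adjacency_def image_iff dest!: image_mset_eq_pair[OF sym] intro: bexI[rotated])

lemma reach_map_mono:
  "(u, v) \<in> (adjacency G)\<^sup>* \<Longrightarrow> (f u, f v) \<in> (adjacency (map_pregraph f G))\<^sup>*"
proof (induction rule: rtrancl_induct)
  case (step y z)
  then have "(f y, f z) \<in> adjacency (map_pregraph f G)" by (auto simp: adjacency_map)
  with step(3) show ?case by (rule rtrancl_into_rtrancl)
qed simp

text \<open>A path in the renamed pregraph is lifted edge by edge: the ends of every edge are vertices, where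
  \<open>f\<close> is injective.\<close>

lemma reach_map_pull:
  assumes "is_pregraph G" "inj_on f (verts G)" "u \<in> verts G" "(f u, y) \<in> (adjacency (map_pregraph f G))\<^sup>*"
  shows "\<exists>v \<in> verts G. y = f v \<and> (u, v) \<in> (adjacency G)\<^sup>*"
  using assms(4)
proof (induction rule: rtrancl_induct)
  case base then show ?case using assms(3) by auto
next
  case (step y z)
  then obtain v where v: "v \<in> verts G" "y = f v" "(u, v) \<in> (adjacency G)\<^sup>*" by auto
  obtain a b where ab: "(a, b) \<in> adjacency G" "y = f a" "z = f b"
    using step(2) by (auto simp: adjacency_map)
  have "a = v" using ab v adjacency_verts[OF assms(1) ab(1)] assms(2) by (auto dest: inj_onD)
  then show ?case using ab v adjacency_verts[OF assms(1) ab(1)] by (auto intro: rtrancl_into_rtrancl)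
qed

lemma connected_map:
  assumes "connected_pregraph G"
  shows "connected_pregraph (map_pregraph f G)"
  using assms reach_map_mono[of _ _ G f] by (auto simp: connected_pregraph_def)

lemma induced_map:
  assumes "is_pregraph G" "inj_on f (verts G)" "S \<subseteq> verts G"
  shows "induced (map_pregraph f G) (f ` S) = map_pregraph f (induced G S)"
  using filter_image_mset_inj_on[OF assms(2) _ assms(3), of "edges G"] is_pregraphD(2)[OF assms(1)]
    inj_on_image_Int[OF assms(2) subset_refl assms(3)]
  by (auto simp: induced_def map_pregraph_def)

lemma induced_coloured_map:
  assumes "is_pregraph (underlying P)" "inj_on f (cverts P)" "S \<subseteq> cverts P"
  shows "induced_coloured (map_coloured f P) (f ` S) = map_coloured f (induced_coloured P S)"
proof -
  have "\<forall>e \<in># edges0 P. set_mset e \<subseteq> cverts P" "\<forall>e \<in># edges1 P. set_mset e \<subseteq> cverts P"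
    using is_pregraphD(2)[OF assms(1)] by auto
  then show ?thesis
    using filter_image_mset_inj_on[OF assms(2) _ assms(3)]
      inj_on_image_Int[OF assms(2) subset_refl assms(3)]
    by (auto simp: induced_coloured_def map_coloured_def)
qed

lemma components_map:
  assumes "is_pregraph G" "inj_on f (verts G)"
  shows "components (map_pregraph f G) = map_pregraph f ` components G"
proof -
  have "induced (map_pregraph f G) {w. (f v, w) \<in> (adjacency (map_pregraph f G))\<^sup>*} =
     map_pregraph f (induced G {w. (v, w) \<in> (adjacency G)\<^sup>*})" if v: "v \<in> verts G" for v
  proof -
    have "{w. (f v, w) \<in> (adjacency (map_pregraph f G))\<^sup>*} = f ` {w. (v, w) \<in> (adjacency G)\<^sup>*}"
      using reach_map_mono[of v _ G f] reach_map_pull[OF assms v] by auto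
    then show ?thesis
      using induced_map[OF assms, of "{w. (v, w) \<in> (adjacency G)\<^sup>*}"] reach_verts[OF assms(1) _ v] by auto
  qed
  then show ?thesis by (auto simp: components_def image_image)
qed

lemma component_subset:
  assumes "C \<in> components G"
  shows "verts C \<subseteq> verts G" "edges C \<subseteq># edges G"
  using assms by (auto simp: components_def)

lemma has_type_map:
  assumes "has_type G t" "inj_on f (verts G)"
  shows "has_type (map_pregraph f G) t"
  using assms unfolding has_type_def iso_map_iff
  by (metis comp_inj_on map_pregraph_comp map_pregraph_simps(1))

lemma subgraph_map:
  assumes "subgraph H G"
  shows "subgraph (map_pregraph f H) (map_pregraph f G)"
  using assms by (auto simp: subgraph_def is_pregraph_map image_mset_subseteq_mono)

lemma C4q_factor_map:
  assumes "C4q_factor F G" "inj_on f (verts G)"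
  shows "C4q_factor (map_pregraph f F) (map_pregraph f G)"
proof -
  have F: "is_pregraph F" "verts F = verts G" using assms by (auto simp: C4q_factor_def subgraph_def)
  have types: "\<exists>t. has_type (map_pregraph f C) t" if "C \<in> components F" for C
  proof -
    have "inj_on f (verts C)" using component_subset(1)[OF that] F(2) assms(2) by (auto intro: inj_on_subset)
    then show ?thesis using has_type_map assms(1) that unfolding C4q_factor_def by blast
  qed
  have deg: "degree (map_pregraph f F) (f v) = 2" if "v \<in> verts G" for v
    using degree_map[OF F(1), of f v] F(2) assms that by (simp add: C4q_factor_def)
  have comps: "components (map_pregraph f F) = map_pregraph f ` components F"
    using components_map[OF F(1)] F(2) assms(2) by simp
  have sub: "subgraph (map_pregraph f F) (map_pregraph f G)"
    using assms(1) by (simp add: C4q_factor_def subgraph_map)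
  show ?thesis
    unfolding C4q_factor_def comps using sub F(2) deg types by (intro conjI) auto
qed

lemma partial_markedD:
  assumes "partial_marked P"
  shows "is_pregraph (underlying P)" "is_pregraph (colour0 P)" "finite (cverts P)"
    "e \<in># edges0 P \<Longrightarrow> set_mset e \<subseteq> cverts P" "e \<in># edges1 P \<Longrightarrow> set_mset e \<subseteq> cverts P"
    "v \<in> cverts P \<Longrightarrow> degree (colour0 P) v = 2"
    "v \<in> cverts P \<Longrightarrow> degree (underlying P) v = 2 \<or> degree (underlying P) v = 3"
    "Q \<in> marked_quotients P \<Longrightarrow> \<exists>t. has_type Q t"
  using assms is_pregraphD[of "underlying P"]
  by (auto simp: partial_marked_def C4q_factor_def subgraph_def marked_quotients_def)

lemma marked_imp_partial: "marked P \<Longrightarrow> partial_marked P"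
  by (auto simp: marked_def partial_marked_def cubic_def)

lemma marked_iff: "marked P \<longleftrightarrow> partial_marked P \<and> connected_pregraph (underlying P) \<and> deficient P = {}"
  by (auto simp: marked_def partial_marked_def cubic_def deficient_def)

lemma partial_marked_map:
  assumes "partial_marked P" "inj_on f (cverts P)"
  shows "partial_marked (map_coloured f P)"
  using assms degree_map[of "underlying P" f] C4q_factor_map[of "colour0 P" "underlying P" f]
  by (auto simp: partial_marked_def underlying_map colour0_map is_pregraph_map)

lemma deficient_map:
  assumes "is_pregraph (underlying P)" "inj_on f (cverts P)"
  shows "deficient (map_coloured f P) = f ` deficient P"
  using degree_map[of "underlying P" f] assms by (auto simp: deficient_def underlying_map)

lemma marked_map:
  assumes "marked P" "inj_on f (cverts P)"
  shows "marked (map_coloured f P)"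
  using assms partial_marked_map[of P f] deficient_map[of P f] partial_markedD(1)[of P]
  by (auto simp: marked_iff underlying_map connected_map)

lemma marked_quotients_map:
  assumes "partial_marked P" "inj_on f (cverts P)"
  shows "marked_quotients (map_coloured f P) = map_pregraph f ` marked_quotients P"
  using components_map[of "colour0 P" f] partial_markedD(2)[OF assms(1)] assms(2)
  by (simp add: marked_quotients_def colour0_map)

section \<open>Unions of connected components\<close>

text \<open>Among the sets of vertices of \<open>G\<close>, these are the unions of vertex sets of components.\<close>

definition closed_under :: "'v pregraph \<Rightarrow> 'v set \<Rightarrow> bool" where
  "closed_under G S \<longleftrightarrow> (\<forall>u v. u \<in> S \<and> (u, v) \<in> adjacency G \<longrightarrow> v \<in> S)"

abbreviation reach :: "'v pregraph \<Rightarrow> 'v \<Rightarrow> 'v set" where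
  "reach G v \<equiv> {w. (v, w) \<in> (adjacency G)\<^sup>*}"

lemma adjacency_mono: "edges G \<subseteq># edges H \<Longrightarrow> adjacency G \<subseteq> adjacency H"
  by (auto simp: adjacency_def dest: mset_subset_eqD)

lemma adjacency_induced:
  "(u, v) \<in> adjacency (induced G S) \<longleftrightarrow> (u, v) \<in> adjacency G \<and> u \<in> S \<and> v \<in> S"
  by (auto simp: adjacency_def)

lemma closed_underD:
  assumes "closed_under G S" "(u, v) \<in> (adjacency G)\<^sup>*" "u \<in> S"
  shows "v \<in> S" "(u, v) \<in> (adjacency (induced G S))\<^sup>*"
proof -
  have "v \<in> S \<and> (u, v) \<in> (adjacency (induced G S))\<^sup>*"
    using assms(2)
  proof (induction rule: rtrancl_induct)
    case base then show ?case using assms(3) by auto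
  next
    case (step y z)
    then have "z \<in> S" using assms(1) by (auto simp: closed_under_def)
    with step have "(y, z) \<in> adjacency (induced G S)" by (auto simp: adjacency_induced)
    with step \<open>z \<in> S\<close> show ?case by (auto intro: rtrancl_into_rtrancl)
  qed
  then show "v \<in> S" "(u, v) \<in> (adjacency (induced G S))\<^sup>*" by auto
qed

lemma closed_under_reach: "closed_under G (reach G v)"
  by (auto simp: closed_under_def intro: rtrancl_into_rtrancl)

lemma closed_under_edge:
  assumes "is_pregraph G" "closed_under G S" "e \<in># edges G" "v \<in># e" "v \<in> S"
  shows "set_mset e \<subseteq> S"
proof -
  obtain N where N: "e = add_mset v N" using assms(4) by (metis multi_member_split)
  have "size N = 0 \<or> size N = 1" using is_pregraphD(3)[OF assms(1,3)] N by auto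
  then show ?thesis
  proof
    assume "size N = 1"
    then obtain w where "N = {#w#}" using size_1_singleton_mset by blast
    then have "(v, w) \<in> adjacency G" using N assms(3) by (simp add: adjacency_def)
    then show ?thesis using assms(2,5) N \<open>N = {#w#}\<close> by (auto simp: closed_under_def)
  qed (use N assms(5) in auto)
qed

lemma component_eq_reach:
  assumes "is_pregraph G" "C \<in> components G" "v \<in> verts C"
  shows "C = induced G (reach G v)" "verts C = reach G v" "v \<in> verts G"
proof -
  obtain u where u: "u \<in> verts G" "C = induced G (reach G u)" using assms(2) by (auto simp: components_def)
  then have "(u, v) \<in> (adjacency G)\<^sup>*" and v: "v \<in> verts G" using assms(3) by auto
  then have "reach G u = reach G v"
    by (auto intro: rtrancl_trans adjacency_rtrancl_sym)
  then show "C = induced G (reach G v)" "verts C = reach G v" "v \<in> verts G"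
    using u v reach_verts[OF assms(1) _ v] by auto
qed

lemma components_meet_eq:
  assumes "is_pregraph G" "C \<in> components G" "D \<in> components G" "v \<in> verts C" "v \<in> verts D"
  shows "C = D"
  using component_eq_reach(1)[OF assms(1,2,4)] component_eq_reach(1)[OF assms(1,3,5)] by simp

lemma component_ex: "v \<in> verts G \<Longrightarrow> \<exists>C \<in> components G. v \<in> verts C"
  by (auto simp: components_def)

lemma component_nonempty: "C \<in> components G \<Longrightarrow> verts C \<noteq> {}"
  by (auto simp: components_def)

lemma component_closed:
  assumes "is_pregraph G" "C \<in> components G"
  shows "closed_under G (verts C)"
proof -
  obtain v where "v \<in> verts C" using component_nonempty[OF assms(2)] by auto
  then have "verts C = reach G v" by (rule component_eq_reach(2)[OF assms])
  then show ?thesis by (simp only: closed_under_reach)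
qed

lemma component_eq_induced:
  assumes "is_pregraph G" "C \<in> components G"
  shows "C = induced G (verts C)"
proof -
  obtain v where "v \<in> verts C" using component_nonempty[OF assms(2)] by auto
  then show ?thesis using component_eq_reach(1,2)[OF assms] by metis
qed

lemma component_connected:
  assumes "is_pregraph G" "C \<in> components G"
  shows "connected_pregraph C"
proof -
  have "(u, v) \<in> (adjacency C)\<^sup>*" if "u \<in> verts C" "v \<in> verts C" for u v
    using component_eq_reach[OF assms that(1)] that(2)
      closed_underD(2)[OF closed_under_reach, of u v G u] by auto
  then show ?thesis using component_nonempty[OF assms(2)] by (auto simp: connected_pregraph_def)
qed

lemma closed_under_component:
  assumes "is_pregraph G" "closed_under G S" "C \<in> components G" "verts C \<inter> S \<noteq> {}"
  shows "verts C \<subseteq> S"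
proof -
  obtain v where v: "v \<in> verts C" "v \<in> S" using assms(4) by auto
  then show ?thesis
    using component_eq_reach(2)[OF assms(1,3) v(1)] closed_underD(1)[OF assms(2) _ v(2)] by auto
qed

text \<open>A path that starts in a closed set stays in it, so that it is also a path of the induced
  subgraph.\<close>

lemma components_induced_closed:
  assumes "is_pregraph G" "closed_under G S" "S \<subseteq> verts G"
  shows "components (induced G S) = {C \<in> components G. verts C \<subseteq> S}"
proof -
  have *: "induced (induced G S) (reach (induced G S) v) = induced G (reach G v) \<and> reach G v \<subseteq> S"
    if v: "v \<in> S" for v
  proof -
    have "reach (induced G S) v = reach G v"
      using closed_underD(2)[OF assms(2) _ v] rtrancl_mono[OF adjacency_mono[of "induced G S" G]] by auto
    moreover have "reach G v \<subseteq> S" using closed_underD(1)[OF assms(2) _ v] by auto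
    ultimately show ?thesis
      by (auto simp: induced_def filter_filter_mset intro!: filter_mset_cong)
  qed
  have "components (induced G S) = (\<lambda>v. induced G (reach G v)) ` S"
    using * assms(3) by (auto simp: components_def Int_absorb1 image_iff)
  also have "\<dots> = {C \<in> components G. verts C \<subseteq> S}"
  proof (intro equalityI subsetI)
    fix C assume "C \<in> (\<lambda>v. induced G (reach G v)) ` S"
    then obtain v where "v \<in> S" "C = induced G (reach G v)" by auto
    moreover have "reach G v \<subseteq> S" using * \<open>v \<in> S\<close> by blast
    moreover have "C \<in> components G"
      unfolding components_def \<open>C = induced G (reach G v)\<close> by (rule imageI) (use \<open>v \<in> S\<close> assms(3) in blast)
    ultimately show "C \<in> {C \<in> components G. verts C \<subseteq> S}" by auto
  next
    fix C assume "C \<in> {C \<in> components G. verts C \<subseteq> S}"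
    then show "C \<in> (\<lambda>v. induced G (reach G v)) ` S" by (auto simp: components_def)
  qed
  finally show ?thesis .
qed

lemma degree_induced_closed:
  assumes "is_pregraph G" "closed_under G S" "v \<in> S"
  shows "degree (induced G S) v = degree G v"
proof -
  have "(\<Sum>e \<in># E. count e v) = (\<Sum>e \<in># {#e \<in># E. set_mset e \<subseteq> S#}. count e v)"
    if "set_mset E \<subseteq> set_mset (edges G)" for E
    using that
  proof (induction E)
    case (add e E)
    have "count e v = 0" if "\<not> set_mset e \<subseteq> S"
      using closed_under_edge[OF assms(1,2), of e v] assms(3) that add.prems by (auto simp: count_eq_zero_iff)
    then show ?case using add by auto
  qed simp
  from this[of "edges G"] show ?thesis by (simp add: degree_def)
qed

lemma connected_Un:
  assumes S: "connected_pregraph (induced G S)" and T: "connected_pregraph (induced G T)"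
    and link: "s \<in> S \<inter> verts G" "t \<in> T \<inter> verts G" "s = t \<or> (s, t) \<in> adjacency G"
  shows "connected_pregraph (induced G (S \<union> T))"
proof -
  let ?R = "(adjacency (induced G (S \<union> T)))\<^sup>*"
  have mono: "(adjacency (induced G X))\<^sup>* \<subseteq> ?R" if "X \<subseteq> S \<union> T" for X
    using that by (intro rtrancl_mono) (auto simp: adjacency_induced)
  have st: "(s, t) \<in> ?R"
    using link(3)
  proof
    assume "(s, t) \<in> adjacency G"
    then show ?thesis using link(1,2) by (auto simp: adjacency_induced intro!: r_into_rtrancl)
  qed simp
  have s: "(s, v) \<in> ?R" if "v \<in> verts (induced G (S \<union> T))" for v
  proof (cases "v \<in> S")
    case True
    then have "(s, v) \<in> (adjacency (induced G S))\<^sup>*" using S link that by (auto simp: connected_pregraph_def)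
    then show ?thesis using mono[of S] by auto
  next
    case False
    then have "(t, v) \<in> (adjacency (induced G T))\<^sup>*" using T link that by (auto simp: connected_pregraph_def)
    then show ?thesis using mono[of T] st by (auto intro: rtrancl_trans)
  qed
  then have "(u, v) \<in> ?R" if "u \<in> verts (induced G (S \<union> T))" "v \<in> verts (induced G (S \<union> T))" for u v
    using that by (meson adjacency_rtrancl_sym rtrancl_trans)
  then show ?thesis using link by (auto simp: connected_pregraph_def)
qed

lemma connected_mono:
  assumes "connected_pregraph H" "verts H = verts G" "edges H \<subseteq># edges G"
  shows "connected_pregraph G"
  using assms rtrancl_mono[OF adjacency_mono[OF assms(3)]] by (auto simp: connected_pregraph_def)

section \<open>The type of a quotient\<close>

text \<open>Vertices and edges together distinguish the four quotients; neither number suffices alone.\<close>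

lemma has_type_measure:
  assumes "has_type G t"
  shows "card (verts G) + size (edges G) = (case t of Q1 \<Rightarrow> 8 | Q2 \<Rightarrow> 4 | Q3 \<Rightarrow> 5 | Q4 \<Rightarrow> 3)"
proof -
  obtain f where f: "inj_on f (verts (c4_quotient t))" "G = map_pregraph f (c4_quotient t)"
    using assms by (auto simp: has_type_def iso_map_iff)
  then show ?thesis using card_image[OF f(1)] by (cases t) auto
qed

lemma has_type_unique: "has_type G t \<Longrightarrow> has_type G t' \<Longrightarrow> t = t'"
  using has_type_measure[of G t] has_type_measure[of G t'] by (cases t; cases t') auto

definition square :: "'v \<Rightarrow> 'v \<Rightarrow> 'v \<Rightarrow> 'v \<Rightarrow> 'v pregraph" where
  "square a b c d = \<lparr>verts = {a, b, c, d}, edges = {#{#a, b#}, {#b, c#}, {#c, d#}, {#d, a#}#}\<rparr>"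

lemma square_simps [simp]:
  "verts (square a b c d) = {a, b, c, d}"
  "edges (square a b c d) = {#{#a, b#}, {#b, c#}, {#c, d#}, {#d, a#}#}"
  by (simp_all add: square_def)

lemma square_rotate: "square a b c d = square b c d a"
  by (auto simp: square_def add_mset_commute)

lemma square_flip: "square a b c d = square d c b a"
  by (auto simp: square_def add_mset_commute)

lemma map_square: "map_pregraph f (square a b c d) = square (f a) (f b) (f c) (f d)"
  by (simp add: map_pregraph_def square_def)

lemma has_type_Q1_iff: "has_type G Q1 \<longleftrightarrow> (\<exists>a b c d. distinct [a, b, c, d] \<and> G = square a b c d)"
proof
  assume "has_type G Q1"
  then obtain f where f: "inj_on f {0, 1, 2, 3}" "G = map_pregraph f (c4_quotient Q1)"
    by (auto simp: has_type_def iso_map_iff)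
  have "distinct [f 0, f 1, f 2, f 3]" using f(1) by (simp add: inj_on_def) 
  moreover have "G = square (f 0) (f 1) (f 2) (f 3)" by (simp add: f(2) map_pregraph_def square_def)
  ultimately show "\<exists>a b c d. distinct [a, b, c, d] \<and> G = square a b c d" by blast
next
  assume "\<exists>a b c d. distinct [a, b, c, d] \<and> G = square a b c d"
  then obtain a b c d where *: "distinct [a, b, c, d]" "G = square a b c d" by blast
  let ?f = "\<lambda>i::nat. [a, b, c, d] ! i"
  have "inj_on ?f {0, 1, 2, 3}" using *(1) by (auto simp: inj_on_def)
  moreover have "G = map_pregraph ?f (c4_quotient Q1)"
    by (simp add: * map_pregraph_def square_def numeral_2_eq_2 numeral_3_eq_3)
  moreover have "verts (c4_quotient Q1) = {0, 1, 2, 3}" by simp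
  ultimately show "has_type G Q1" unfolding has_type_def iso_map_iff by metis
qed

lemma pair_mset_eq_iff: "{#a, b#} = {#c, d#} \<longleftrightarrow> a = c \<and> b = d \<or> a = d \<and> b = c"
  by (auto simp: add_eq_conv_diff)

text \<open>Rotating and reflecting the square puts any of its edges in front, in either direction.\<close>

lemma square_with_edge:
  assumes "has_type G Q1" "{#u, w#} \<in># edges G"
  shows "\<exists>x y. G = square u w x y \<and> distinct [u, w, x, y]"
proof -
  obtain a b c d where dist: "distinct [a, b, c, d]" and G: "G = square a b c d"
    using assms(1) by (auto simp: has_type_Q1_iff)
  have sq: "G = square a b c d" "G = square b a d c" "G = square b c d a" "G = square c b a d" "G = square c d a b" "G = square d c b a" "G = square d a b c" "G = square a d c b"
    using G square_rotate square_flip by metis+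
  have D: ?thesis if "G = square p q r s" "u = p" "w = q" "distinct [p, q, r, s]" for p q r s
    using that by blast
  have "{#u, w#} = {#a, b#} \<or> {#u, w#} = {#b, c#} \<or> {#u, w#} = {#c, d#} \<or> {#u, w#} = {#d, a#}"
    using assms(2) G by auto
  then have "u = a \<and> w = b \<or> u = b \<and> w = a \<or> u = b \<and> w = c \<or> u = c \<and> w = b \<or>
    u = c \<and> w = d \<or> u = d \<and> w = c \<or> u = d \<and> w = a \<or> u = a \<and> w = d"
    unfolding pair_mset_eq_iff by blast
  then consider "u = a" "w = b" | "u = b" "w = a" | "u = b" "w = c" | "u = c" "w = b" | "u = c" "w = d" | "u = d" "w = c" | "u = d" "w = a" | "u = a" "w = d" by blast
  then show ?thesis
  proof cases
    case 1 then show ?thesis using dist by (intro D[OF sq(1)]) auto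
  next
    case 2 then show ?thesis using dist by (intro D[OF sq(2)]) auto
  next
    case 3 then show ?thesis using dist by (intro D[OF sq(3)]) auto
  next
    case 4 then show ?thesis using dist by (intro D[OF sq(4)]) auto
  next
    case 5 then show ?thesis using dist by (intro D[OF sq(5)]) auto
  next
    case 6 then show ?thesis using dist by (intro D[OF sq(6)]) auto
  next
    case 7 then show ?thesis using dist by (intro D[OF sq(7)]) auto
  next
    case 8 then show ?thesis using dist by (intro D[OF sq(8)]) auto
  qed
qed

section \<open>Clusters of marked quotients of one type\<close>

lemma marked_quotients_basics:
  assumes "partial_marked P"
  shows "v \<in> cverts P \<Longrightarrow> \<exists>Q \<in> marked_quotients P. v \<in> verts Q"
    "Q \<in> marked_quotients P \<Longrightarrow> verts Q \<subseteq> cverts P"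
    "Q \<in> marked_quotients P \<Longrightarrow> edges Q \<subseteq># edges0 P"
    "Q \<in> marked_quotients P \<Longrightarrow> verts Q \<noteq> {}"
    "Q \<in> marked_quotients P \<Longrightarrow> Q' \<in> marked_quotients P \<Longrightarrow> v \<in> verts Q \<Longrightarrow> v \<in> verts Q' \<Longrightarrow> Q = Q'"
    "Q \<in> marked_quotients P \<Longrightarrow> closed_under (colour0 P) (verts Q)"
    "Q \<in> marked_quotients P \<Longrightarrow> Q = induced (colour0 P) (verts Q)"
    "Q \<in> marked_quotients P \<Longrightarrow> connected_pregraph Q"
  using component_ex[of v "colour0 P"] component_subset[of Q "colour0 P"] component_nonempty[of Q "colour0 P"]
    components_meet_eq[OF partial_markedD(2)[OF assms]]
    component_closed[OF partial_markedD(2)[OF assms]]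
    component_eq_induced[OF partial_markedD(2)[OF assms]]
    component_connected[OF partial_markedD(2)[OF assms]]
  by (simp_all add: marked_quotients_def)

lemma connected_induced_quotient:
  assumes "partial_marked P" "Q \<in> marked_quotients P"
  shows "connected_pregraph (induced (underlying P) (verts Q))"
proof (rule connected_mono[of Q])
  show "connected_pregraph Q" using assms by (rule marked_quotients_basics)
  show "verts Q = verts (induced (underlying P) (verts Q))"
    using marked_quotients_basics(2)[OF assms] by auto
  have "edges Q = {#e \<in># edges0 P. set_mset e \<subseteq> verts Q#}"
    using marked_quotients_basics(7)[OF assms] by (metis induced_simps(2) underlying_simps(4))
  then show "edges Q \<subseteq># edges (induced (underlying P) (verts Q))" by simp
qed

text \<open>The unions of marked quotients of type \<open>t\<close>, described without naming a family of quotients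
  (\<open>typed_set_iff\<close>).\<close>

definition typed_set :: "'v coloured \<Rightarrow> c4_type \<Rightarrow> 'v set \<Rightarrow> bool" where
  "typed_set P t S \<longleftrightarrow> S \<subseteq> cverts P \<and> closed_under (colour0 P) S \<and>
     (\<forall>Q \<in> marked_quotients P. verts Q \<inter> S \<noteq> {} \<longrightarrow> has_type Q t)"

lemma typed_set_quotient:
  assumes "partial_marked P" "typed_set P t S" "Q \<in> marked_quotients P" "verts Q \<inter> S \<noteq> {}"
  shows "verts Q \<subseteq> S" "has_type Q t"
  using closed_under_component[OF partial_markedD(2)[OF assms(1)], of S Q] assms
  by (auto simp: typed_set_def marked_quotients_def)

lemma typed_set_iff:
  assumes P: "partial_marked P"
  shows "(\<exists>\<Q> \<subseteq> {Q \<in> marked_quotients P. has_type Q t}. S = (\<Union>Q \<in> \<Q>. verts Q)) \<longleftrightarrow> typed_set P t S"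
proof
  assume "\<exists>\<Q> \<subseteq> {Q \<in> marked_quotients P. has_type Q t}. S = (\<Union>Q \<in> \<Q>. verts Q)"
  then obtain \<Q> where \<Q>: "\<Q> \<subseteq> {Q \<in> marked_quotients P. has_type Q t}" "S = (\<Union>Q \<in> \<Q>. verts Q)" by blast
  have "closed_under (colour0 P) S"
    unfolding closed_under_def \<Q>(2)
  proof (intro allI impI, elim conjE)
    fix u v assume "u \<in> (\<Union>Q \<in> \<Q>. verts Q)" and uv: "(u, v) \<in> adjacency (colour0 P)"
    then obtain Q where Q: "Q \<in> \<Q>" "u \<in> verts Q" by auto
    then have "v \<in> verts Q"
      using marked_quotients_basics(6)[OF P, of Q] uv \<Q>(1) unfolding closed_under_def by blast
    with Q show "v \<in> (\<Union>Q \<in> \<Q>. verts Q)" by auto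
  qed
  moreover have "S \<subseteq> cverts P" using \<Q> marked_quotients_basics(2)[OF P] by fastforce
  moreover have "has_type Q t" if Q: "Q \<in> marked_quotients P" "verts Q \<inter> S \<noteq> {}" for Q
  proof -
    obtain v Q' where "v \<in> verts Q" "v \<in> verts Q'" "Q' \<in> \<Q>" using Q(2) \<Q>(2) by auto
    then have "Q = Q'" using marked_quotients_basics(5)[OF P Q(1)] \<Q>(1) by auto
    with \<open>Q' \<in> \<Q>\<close> \<Q>(1) show ?thesis by auto
  qed
  ultimately show "typed_set P t S" by (auto simp: typed_set_def)
next
  assume S: "typed_set P t S"
  let ?\<Q> = "{Q \<in> marked_quotients P. verts Q \<inter> S \<noteq> {}}"
  have "?\<Q> \<subseteq> {Q \<in> marked_quotients P. has_type Q t}" using S by (auto simp: typed_set_def)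
  moreover have "S = (\<Union>Q \<in> ?\<Q>. verts Q)"
  proof (intro equalityI subsetI)
    fix v assume "v \<in> S"
    moreover from this S have "v \<in> cverts P" by (auto simp: typed_set_def)
    then obtain Q where "Q \<in> marked_quotients P" "v \<in> verts Q"
      using marked_quotients_basics(1)[OF P] by blast
    ultimately show "v \<in> (\<Union>Q \<in> ?\<Q>. verts Q)" by auto
  next
    fix v assume "v \<in> (\<Union>Q \<in> ?\<Q>. verts Q)"
    then show "v \<in> S" using typed_set_quotient(1)[OF P S] by blast
  qed
  ultimately show "\<exists>\<Q> \<subseteq> {Q \<in> marked_quotients P. has_type Q t}. S = (\<Union>Q \<in> \<Q>. verts Q)" by blast
qed

lemma quotient_cluster_iff:
  "partial_marked P \<Longrightarrow> quotient_cluster P t S \<longleftrightarrow>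
     typed_set P t S \<and> connected_pregraph (induced (underlying P) S)"
  by (simp add: quotient_cluster_def typed_set_iff)

lemma quotient_clusterD:
  assumes "partial_marked P" "quotient_cluster P t S"
  shows "S \<subseteq> cverts P" "S \<noteq> {}" "closed_under (colour0 P) S"
  using assms by (auto simp: quotient_cluster_iff typed_set_def connected_pregraph_def)

lemma typed_set_single:
  assumes "partial_marked P" "Q \<in> marked_quotients P" "has_type Q t"
  shows "typed_set P t (verts Q)"
  unfolding typed_set_def
  using marked_quotients_basics(2)[OF assms(1,2)] marked_quotients_basics(6)[OF assms(1,2)]
    marked_quotients_basics(5)[OF assms(1,2)] assms(3) by blast

lemma quotient_cluster_single:
  assumes "partial_marked P" "Q \<in> marked_quotients P" "has_type Q t"
  shows "quotient_cluster P t (verts Q)"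
  using typed_set_single[OF assms] connected_induced_quotient[OF assms(1,2)] assms(1)
  by (simp add: quotient_cluster_iff)

lemma typed_set_Un: "typed_set P t S \<Longrightarrow> typed_set P t T \<Longrightarrow> typed_set P t (S \<union> T)"
  unfolding typed_set_def closed_under_def by blast

lemma quotient_cluster_Un:
  assumes "partial_marked P" "quotient_cluster P t S" "quotient_cluster P t T" "s \<in> S" "u \<in> T"
    "s = u \<or> (s, u) \<in> adjacency (underlying P)"
  shows "quotient_cluster P t (S \<union> T)"
  using assms connected_Un[of "underlying P" S T s u] quotient_clusterD(1)[OF assms(1)]
  by (auto simp: quotient_cluster_iff typed_set_Un)

lemma quotient_cluster_type_unique:
  assumes "partial_marked P" "quotient_cluster P t S" "quotient_cluster P t' S'" "v \<in> S" "v \<in> S'"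
  shows "t = t'"
proof -
  obtain Q where Q: "Q \<in> marked_quotients P" "v \<in> verts Q"
    using marked_quotients_basics(1)[OF assms(1)] quotient_clusterD(1)[OF assms(1,2)] assms(4) by blast
  then have "has_type Q t" "has_type Q t'"
    using assms by (auto simp: quotient_cluster_iff typed_set_def)
  then show ?thesis by (rule has_type_unique)
qed

text \<open>Two clusters of the same type that meet or are joined by an edge have a cluster as their union.\<close>

lemma maximal_cluster_meet:
  assumes "partial_marked P" "maximal_cluster P t S" "maximal_cluster P t T" "s \<in> S" "u \<in> T"
    "s = u \<or> (s, u) \<in> adjacency (underlying P)"
  shows "S = T"
  using quotient_cluster_Un[OF assms(1), of t S T s u] assms by (auto simp: maximal_cluster_def)

lemma maximal_cluster_ex:
  assumes "partial_marked P" "quotient_cluster P t S"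
  shows "\<exists>S'. maximal_cluster P t S' \<and> S \<subseteq> S'"
proof -
  let ?A = "\<lambda>S'. quotient_cluster P t S' \<and> S \<subseteq> S'"
  have fin: "finite T \<and> card T \<le> card (cverts P)" if "?A T" for T
    using quotient_clusterD(1)[OF assms(1)] that partial_markedD(3)[OF assms(1)] 
    by (auto intro: card_mono finite_subset)
  then obtain S' where S': "?A S'" "\<forall>T. ?A T \<longrightarrow> card T \<le> card S'"
    using ex_has_greatest_nat[of ?A S card "Suc (card (cverts P))"] assms(2) by (auto simp: less_Suc_eq_le)
  have "T = S'" if "quotient_cluster P t T" "S' \<subseteq> T" for T
    using that S' fin[of T] card_seteq[of T S'] by auto
  then show ?thesis using S'(1) by (auto simp: maximal_cluster_def)
qed

section \<open>Ladders\<close>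

definition ladder_edges :: "nat \<Rightarrow> (bool \<times> nat) multiset set" where
  "ladder_edges k = {{#(False, j), (True, j)#} | j. j < 2 * k} \<union>
                    {{#(b, j), (b, Suc j)#} | b j. Suc j < 2 * k}"

lemma ladder_edges_rung: "j < 2 * k \<Longrightarrow> {#(False, j), (True, j)#} \<in> ladder_edges k"
  unfolding ladder_edges_def by blast

lemma ladder_edges_side: "Suc j < 2 * k \<Longrightarrow> {#(b, j), (b, Suc j)#} \<in> ladder_edges k"
  unfolding ladder_edges_def by blast

lemma finite_ladder_edges: "finite (ladder_edges k)"
proof -
  have "ladder_edges k \<subseteq> (\<lambda>j. {#(False, j), (True, j)#}) ` {..<2 * k} \<union>
    (\<lambda>(b, j). {#(b, j), (b, Suc j)#}) ` (UNIV \<times> {..<2 * k})"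
    by (auto simp: ladder_edges_def image_iff)
  then show ?thesis by (rule finite_subset) auto
qed

lemma ladder_graph_simps [simp]:
  "verts (ladder_graph k) = UNIV \<times> {..<2 * k}"
  "edges (ladder_graph k) = mset_set (ladder_edges k)"
  by (simp_all add: ladder_graph_def ladder_edges_def)

lemma ladder_edges_verts: "e \<in> ladder_edges k \<Longrightarrow> set_mset e \<subseteq> UNIV \<times> {..<2 * k}"
  by (auto simp: ladder_edges_def)

lemma is_pregraph_ladder: "is_pregraph (ladder_graph k)"
  using ladder_edges_verts by (auto simp: is_pregraph_def finite_ladder_edges) (auto simp: ladder_edges_def)

lemma connected_ladder:
  assumes "k \<ge> 1"
  shows "connected_pregraph (ladder_graph k)"
proof -
  let ?A = "adjacency (ladder_graph k)"
  have rung: "((False, j), (True, j)) \<in> ?A" if "j < 2 * k" for j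
    using that by (simp add: adjacency_def finite_ladder_edges) (auto simp: ladder_edges_def)
  have step: "((False, j), (False, Suc j)) \<in> ?A" if "Suc j < 2 * k" for j
    using that by (simp add: adjacency_def finite_ladder_edges) (auto simp: ladder_edges_def)
  have base: "((False, 0), (False, j)) \<in> ?A\<^sup>*" if "j < 2 * k" for j
    using that
  proof (induction j)
    case (Suc j)
    then show ?case using step[of j] by (auto intro: rtrancl_into_rtrancl)
  qed simp
  have all: "((False, 0), v) \<in> ?A\<^sup>*" if "v \<in> verts (ladder_graph k)" for v
    using that base rung by (cases v; cases "fst v") (auto intro: rtrancl_into_rtrancl)
  have "(u, v) \<in> ?A\<^sup>*" if "u \<in> verts (ladder_graph k)" "v \<in> verts (ladder_graph k)" for u v
    using all[OF that(1)] all[OF that(2)] by (meson adjacency_rtrancl_sym rtrancl_trans)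
  moreover have "(False, 0) \<in> verts (ladder_graph k)" using assms by simp
  ultimately show ?thesis unfolding connected_pregraph_def by blast
qed

text \<open>An injective map of a finite set into itself is onto, which applies to the vertices and to the
  edges.\<close>

lemma ladder_automorphism:
  assumes "inj_on g (UNIV \<times> {..<2 * k})" "g ` (UNIV \<times> {..<2 * k}) \<subseteq> UNIV \<times> {..<2 * k}"
    "\<And>e. e \<in> ladder_edges k \<Longrightarrow> image_mset g e \<in> ladder_edges k"
  shows "map_pregraph g (ladder_graph k) = ladder_graph k"
proof -
  have inj: "inj_on (image_mset g) (ladder_edges k)"
    using image_mset_inj_on_eq[OF assms(1)] ladder_edges_verts by (metis inj_onI)
  have "image_mset g ` ladder_edges k = ladder_edges k"
    using assms(3) by (intro endo_inj_surj finite_ladder_edges inj) auto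
  moreover have "g ` (UNIV \<times> {..<2 * k}) = UNIV \<times> {..<2 * k}"
    by (intro endo_inj_surj assms) auto
  ultimately show ?thesis
    by (intro pregraph.equality) (simp_all add: image_mset_mset_set[OF inj])
qed

text \<open>The even indices start the squares: rung \<open>2 * i\<close> and rung \<open>2 * i + 1\<close> span the square with index
  \<open>i\<close>.\<close>

lemma ladder_square:
  assumes "i < k"
  shows "induced (ladder_graph k) (UNIV \<times> {2 * i, 2 * i + 1}) =
     square (False, 2 * i) (True, 2 * i) (True, 2 * i + 1) (False, 2 * i + 1)"
proof -
  let ?S = "UNIV \<times> {2 * i, 2 * i + 1} :: (bool \<times> nat) set"
  let ?F = "{{#(False, 2 * i), (True, 2 * i)#}, {#(True, 2 * i), (True, 2 * i + 1)#},
     {#(True, 2 * i + 1), (False, 2 * i + 1)#}, {#(False, 2 * i + 1), (False, 2 * i)#}}"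
  have "{e \<in> ladder_edges k. set_mset e \<subseteq> ?S} = ?F"
  proof (intro equalityI subsetI)
    fix e assume "e \<in> {e \<in> ladder_edges k. set_mset e \<subseteq> ?S}"
    then consider j where "j \<in> {2 * i, 2 * i + 1}" "e = {#(False, j), (True, j)#}"
      | b j where "j = 2 * i" "e = {#(b, j), (b, Suc j)#}"
      by (auto simp: ladder_edges_def)
    then show "e \<in> ?F"
    proof cases
      case 1 then show ?thesis by (auto simp: add_mset_commute)
    next
      case (2 b) then show ?thesis by (cases b) (auto simp: add_mset_commute)
    qed
  next
    fix e assume "e \<in> ?F"
    then show "e \<in> {e \<in> ladder_edges k. set_mset e \<subseteq> ?S}"
    proof (elim insertE emptyE)
      assume "e = {#(True, 2 * i + 1), (False, 2 * i + 1)#}"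
      then have "e = {#(False, 2 * i + 1), (True, 2 * i + 1)#}" by (simp add: add_mset_commute)
      then show ?thesis using assms by (auto simp: ladder_edges_def)
    next
      assume "e = {#(False, 2 * i + 1), (False, 2 * i)#}"
      then have "e = {#(False, 2 * i), (False, Suc (2 * i))#}" by (simp add: add_mset_commute)
      then show ?thesis using assms ladder_edges_side[of "2 * i" k False] by auto
    qed (use assms ladder_edges_rung[of "2 * i" k] ladder_edges_side[of "2 * i" k True] in auto)
  qed
  moreover have "mset_set ?F = {#{#(False, 2 * i), (True, 2 * i)#}, {#(True, 2 * i), (True, 2 * i + 1)#},
     {#(True, 2 * i + 1), (False, 2 * i + 1)#}, {#(False, 2 * i + 1), (False, 2 * i)#}#}"
    by (simp add: pair_mset_eq_iff)
  moreover have "(UNIV \<times> {..<2 * k}) \<inter> ?S = {(False, 2 * i), (True, 2 * i), (True, 2 * i + 1), (False, 2 * i + 1)}"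
    using assms by (auto simp: UNIV_bool)
  ultimately show ?thesis
    by (simp add: induced_def square_def filter_mset_mset_set finite_ladder_edges)
qed

definition rung_square :: "(bool \<times> nat \<Rightarrow> 'v) \<Rightarrow> nat \<Rightarrow> 'v pregraph" where
  "rung_square f i = square (f (False, 2 * i)) (f (True, 2 * i)) (f (True, 2 * i + 1)) (f (False, 2 * i + 1))"

text \<open>A ladder given by its parametrisation. The rungs and the sides of the squares are edges of marked
  quotients, so that only the links between consecutive squares have to be required; these have
  colour 1.\<close>

definition is_ladder :: "'v coloured \<Rightarrow> (bool \<times> nat \<Rightarrow> 'v) \<Rightarrow> nat \<Rightarrow> bool" where
  "is_ladder P f k \<longleftrightarrow> k \<ge> 1 \<and> inj_on f (UNIV \<times> {..<2 * k}) \<and>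
     (\<forall>i < k. rung_square f i \<in> marked_quotients P) \<and>
     (\<forall>i b. Suc i < k \<longrightarrow> {#f (b, 2 * i + 1), f (b, 2 * i + 2)#} \<in># edges1 P)"

lemma rung_square_verts: "verts (rung_square f i) = f ` (UNIV \<times> {2 * i, 2 * i + 1})"
  by (auto simp: rung_square_def UNIV_bool image_iff)

lemma ladder_verts: "f ` (UNIV \<times> {..<2 * k}) = (\<Union>i < k. verts (rung_square f i))"
proof -
  have "UNIV \<times> {..<2 * k} = (\<Union>i < k. UNIV \<times> {2 * i, 2 * i + 1} :: (bool \<times> nat) set)"
  proof (intro equalityI subsetI)
    fix x :: "bool \<times> nat" assume "x \<in> UNIV \<times> {..<2 * k}"
    then have "snd x div 2 < k" "snd x = 2 * (snd x div 2) \<or> snd x = 2 * (snd x div 2) + 1" by auto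
    then show "x \<in> (\<Union>i < k. UNIV \<times> {2 * i, 2 * i + 1})" by (cases x) auto
  qed auto
  then show ?thesis by (auto simp: rung_square_verts)
qed

lemma induced_ladder_image:
  assumes "inj_on f (UNIV \<times> {..<2 * k})" "i < k"
  shows "induced (map_pregraph f (ladder_graph k)) (f ` (UNIV \<times> {2 * i, 2 * i + 1})) = rung_square f i"
proof -
  have "induced (map_pregraph f (ladder_graph k)) (f ` (UNIV \<times> {2 * i, 2 * i + 1})) =
    map_pregraph f (induced (ladder_graph k) (UNIV \<times> {2 * i, 2 * i + 1}))"
    using assms by (intro induced_map is_pregraph_ladder) auto
  then show ?thesis by (simp only: ladder_square[OF assms(2)] map_square rung_square_def)
qed

lemma rung_square_has_type:
  assumes "inj_on f (UNIV \<times> {..<2 * k})" "i < k"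
  shows "has_type (rung_square f i) Q1"
proof -
  have "distinct [f (False, 2 * i), f (True, 2 * i), f (True, 2 * i + 1), f (False, 2 * i + 1)]"
    using assms by (auto dest: inj_onD)
  then show ?thesis unfolding has_type_Q1_iff rung_square_def by blast
qed

lemma subgraph_map_ladder:
  assumes "inj_on f (UNIV \<times> {..<2 * k})"
  shows "subgraph (map_pregraph f (ladder_graph k)) G \<longleftrightarrow>
     f ` (UNIV \<times> {..<2 * k}) \<subseteq> verts G \<and> (\<forall>e \<in> ladder_edges k. image_mset f e \<in># edges G)"
proof -
  have inj: "inj_on (image_mset f) (ladder_edges k)"
    using image_mset_inj_on_eq[OF assms] ladder_edges_verts by (metis inj_onI)
  have "mset_set A \<subseteq># M \<longleftrightarrow> A \<subseteq> set_mset M" if "finite A" for A and M :: "'a multiset multiset"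
    using that by (metis finite_set_mset finite_set_mset_mset_set msubset_mset_set_iff
        mset_set_set_mset_msubset set_mset_mono subset_mset.order_trans)
  then show ?thesis
    by (auto simp: subgraph_def is_pregraph_map is_pregraph_ladder image_mset_mset_set[OF inj]
        finite_ladder_edges)
qed

lemma ladder_edges_cases:
  assumes "e \<in> ladder_edges k"
  obtains (square) i where "i < k" "e \<in># edges (square (False, 2 * i) (True, 2 * i) (True, 2 * i + 1) (False, 2 * i + 1))"
  | (link) i b where "Suc i < k" "e = {#(b, 2 * i + 1), (b, 2 * i + 2)#}"
proof -
  consider j where "j < 2 * k" "e = {#(False, j), (True, j)#}"
    | b j where "Suc j < 2 * k" "e = {#(b, j), (b, Suc j)#}"
    using assms by (auto simp: ladder_edges_def)
  then show thesis
  proof cases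
    case (1 j)
    then have "j div 2 < k" "j = 2 * (j div 2) \<or> j = 2 * (j div 2) + 1" by auto
    then show thesis using 1(2) square[of "j div 2"] by (auto simp: add_mset_commute)
  next
    case (2 b j)
    show thesis
    proof (cases "even j")
      case True
      then have "j = 2 * (j div 2)" "j div 2 < k" using 2 by auto
      then show thesis using 2(2) square[of "j div 2"] by (cases b) (auto simp: add_mset_commute)
    next
      case False
      then have "j = 2 * (j div 2) + 1" "Suc (j div 2) < k" using 2 by presburger+
      then show thesis using 2(2) link[of "j div 2" b] by auto
    qed
  qed
qed

lemma edge_unique_in_quotient:
  assumes "partial_marked P" "Q \<in> marked_quotients P" "{#x, y#} \<in># edges0 P" "x \<in> verts Q"
  shows "y \<in> verts Q"
  using marked_quotients_basics(6)[OF assms(1,2)] assms(3,4)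
  by (auto simp: closed_under_def adjacency_def)

text \<open>A link between consecutive squares has colour 1 because an edge of colour 0 does not leave its
  quotient.\<close>

lemma q1_ladder_iff:
  assumes P: "partial_marked P"
  shows "q1_ladder P H \<longleftrightarrow> (\<exists>f k. is_ladder P f k \<and> H = map_pregraph f (ladder_graph k))"
proof
  assume "q1_ladder P H"
  then obtain k f where *: "k \<ge> 1" "inj_on f (UNIV \<times> {..<2 * k})" "H = map_pregraph f (ladder_graph k)"
    and sub: "subgraph H (underlying P)"
    and sq: "\<And>i. i < k \<Longrightarrow> induced H (f ` (UNIV \<times> {2 * i, 2 * i + 1})) \<in> marked_quotients P"
    by (auto simp: q1_ladder_def iso_map_iff)
  have sq': "rung_square f i \<in> marked_quotients P" if "i < k" for i
    using sq[OF that] induced_ladder_image[OF *(2) that] *(3) by simp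
  have "{#f (b, 2 * i + 1), f (b, 2 * i + 2)#} \<in># edges1 P" if i: "Suc i < k" for i b
  proof (rule ccontr)
    assume no: "{#f (b, 2 * i + 1), f (b, 2 * i + 2)#} \<notin># edges1 P"
    have "{#(b, 2 * i + 1), (b, Suc (2 * i + 1))#} \<in> ladder_edges k"
      unfolding ladder_edges_def using i by (intro UnI2 CollectI exI conjI) (rule refl, simp)
    then have "image_mset f {#(b, 2 * i + 1), (b, Suc (2 * i + 1))#} \<in># edges (underlying P)"
      using sub *(3) subgraph_map_ladder[OF *(2)] by blast
    then have "{#f (b, 2 * i + 1), f (b, 2 * i + 2)#} \<in># edges0 P" using no by auto
    then have "f (b, 2 * i + 2) \<in> verts (rung_square f i)"
      using edge_unique_in_quotient[OF P sq'[of i]] i by (cases b) (auto simp: rung_square_def)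
    then obtain c j where "j \<in> {2 * i, 2 * i + 1}" "f (b, 2 * i + 2) = f (c, j)"
      by (auto simp: rung_square_verts)
    then show False using inj_onD[OF *(2), of "(b, 2 * i + 2)" "(c, j)"] i by auto
  qed
  then show "\<exists>f k. is_ladder P f k \<and> H = map_pregraph f (ladder_graph k)"
    using * sq' by (auto simp: is_ladder_def)
next
  assume "\<exists>f k. is_ladder P f k \<and> H = map_pregraph f (ladder_graph k)"
  then obtain f k where f: "is_ladder P f k" and H: "H = map_pregraph f (ladder_graph k)" by blast
  then have inj: "inj_on f (UNIV \<times> {..<2 * k})" and k: "k \<ge> 1"
    and sq: "\<And>i. i < k \<Longrightarrow> rung_square f i \<in> marked_quotients P" by (auto simp: is_ladder_def)
  have "image_mset f e \<in># edges (underlying P)" if "e \<in> ladder_edges k" for e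
    using that
  proof (cases rule: ladder_edges_cases)
    case (square i)
    then have "image_mset f e \<in># edges (rung_square f i)"
      by (auto simp: rung_square_def)
    then show ?thesis using marked_quotients_basics(3)[OF P sq[OF square(1)]] by (auto dest: mset_subset_eqD)
  next
    case (link i b)
    then show ?thesis using f by (auto simp: is_ladder_def)
  qed
  moreover have "f ` (UNIV \<times> {..<2 * k}) \<subseteq> cverts P"
    using marked_quotients_basics(2)[OF P sq] by (auto simp: ladder_verts)
  ultimately have "subgraph H (underlying P)" unfolding H subgraph_map_ladder[OF inj] by simp
  then show "q1_ladder P H"
    unfolding q1_ladder_def iso_map_iff
    using k inj H sq induced_ladder_image[OF inj] rung_square_has_type[OF inj]
    by (intro conjI exI[of _ k] exI[of _ f]) auto
qed

text \<open>Two of the at most three edge ends at a vertex belong to the factor.\<close>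

lemma colour1_neighbour_unique:
  assumes P: "partial_marked P" and e: "{#x, y#} \<in># edges1 P" "{#x, z#} \<in># edges1 P"
  shows "y = z"
proof (rule ccontr)
  assume "y \<noteq> z"
  have x: "x \<in> cverts P" using partial_markedD(5)[OF P e(1)] by auto
  obtain E where E: "edges1 P = add_mset {#x, y#} E" using multi_member_split[OF e(1)] by blast
  have "{#x, z#} \<in># E" using e(2) \<open>y \<noteq> z\<close> by (auto simp: E pair_mset_eq_iff)
  then obtain F where "E = add_mset {#x, z#} F" by (metis multi_member_split)
  then have "(\<Sum>e \<in># edges1 P. count e x) \<ge> 2" by (simp add: E)
  moreover have "(\<Sum>e \<in># edges0 P. count e x) = 2"
    using partial_markedD(6)[OF P x] by (simp add: degree_def)
  moreover have "(\<Sum>e \<in># edges0 P. count e x) + (\<Sum>e \<in># edges1 P. count e x) \<le> 3"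
    using partial_markedD(7)[OF P x] by (simp add: degree_def) linarith
  ultimately show False by linarith
qed

text \<open>A ladder can be read from either end, so that only its last rung has to be considered when it is
  prolonged.\<close>

lemma is_ladder_reverse:
  assumes "is_ladder P f k"
  defines "r \<equiv> \<lambda>(b :: bool, j :: nat). (b, 2 * k - 1 - j)"
  shows "is_ladder P (f \<circ> r) k" "map_pregraph (f \<circ> r) (ladder_graph k) = map_pregraph f (ladder_graph k)"
proof -
  have r: "inj_on r (UNIV \<times> {..<2 * k})" "r ` (UNIV \<times> {..<2 * k}) \<subseteq> UNIV \<times> {..<2 * k}"
    by (auto simp: r_def inj_on_def)
  have "image_mset r e \<in> ladder_edges k" if "e \<in> ladder_edges k" for e
  proof -
    consider j where "j < 2 * k" "e = {#(False, j), (True, j)#}"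
      | b j where "Suc j < 2 * k" "e = {#(b, j), (b, Suc j)#}"
      using \<open>e \<in> ladder_edges k\<close> by (auto simp: ladder_edges_def)
    then show ?thesis
    proof cases
      case (1 j) then show ?thesis by (auto simp: ladder_edges_def r_def)
    next
      case (2 b j)
      then have "image_mset r e = {#(b, 2 * k - 1 - Suc j), (b, Suc (2 * k - 1 - Suc j))#}"
        by (auto simp: r_def add_mset_commute Suc_diff_Suc)
      moreover have "Suc (2 * k - 1 - Suc j) < 2 * k" using 2 by auto
      ultimately show ?thesis unfolding ladder_edges_def by blast
    qed
  qed
  with r have "map_pregraph r (ladder_graph k) = ladder_graph k" by (rule ladder_automorphism)
  then show "map_pregraph (f \<circ> r) (ladder_graph k) = map_pregraph f (ladder_graph k)"
    by (metis map_pregraph_comp)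
  have inj: "inj_on f (UNIV \<times> {..<2 * k})" using assms(1) by (simp add: is_ladder_def)
  have "inj_on (f \<circ> r) (UNIV \<times> {..<2 * k})"
    using r inj by (intro comp_inj_on) (auto intro: inj_on_subset)
  moreover have "rung_square (f \<circ> r) i = rung_square f (k - 1 - i)" if "i < k" for i
  proof -
    have "2 * k - 1 - 2 * i = 2 * (k - 1 - i) + 1" "2 * k - 1 - (2 * i + 1) = 2 * (k - 1 - i)" using that by auto
    then show ?thesis by (simp add: rung_square_def r_def) (metis square_flip)
  qed
  then have "rung_square (f \<circ> r) i \<in> marked_quotients P" if "i < k" for i
    using assms(1) that by (auto simp: is_ladder_def)
  moreover have "{#(f \<circ> r) (b, 2 * i + 1), (f \<circ> r) (b, 2 * i + 2)#} \<in># edges1 P" if "Suc i < k" for i b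
  proof -
    have "2 * k - 1 - (2 * i + 1) = 2 * (k - 2 - i) + 2" "2 * k - 1 - (2 * i + 2) = 2 * (k - 2 - i) + 1"
      "Suc (k - 2 - i) < k"
      using that by auto
    moreover from this have "{#f (b, 2 * (k - 2 - i) + 1), f (b, 2 * (k - 2 - i) + 2)#} \<in># edges1 P"
      using assms(1) by (auto simp: is_ladder_def)
    ultimately show ?thesis by (simp add: r_def add_mset_commute)
  qed
  ultimately show "is_ladder P (f \<circ> r) k" using assms(1) by (auto simp: is_ladder_def)
qed

text \<open>Either pair of opposite sides of a single square can serve as its rungs.\<close>

lemma is_ladder_transpose:
  assumes "is_ladder P f 1"
  defines "r \<equiv> \<lambda>(b :: bool, j :: nat). (j \<noteq> 0, if b then 1 else (0 :: nat))"
  shows "is_ladder P (f \<circ> r) 1" "map_pregraph (f \<circ> r) (ladder_graph 1) = map_pregraph f (ladder_graph 1)"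
proof -
  have r: "inj_on r (UNIV \<times> {..<2 * 1})" "r ` (UNIV \<times> {..<2 * 1}) \<subseteq> UNIV \<times> {..<2 * 1}"
    by (auto simp: r_def inj_on_def split: if_splits)
  have "image_mset r e \<in> ladder_edges 1" if "e \<in> ladder_edges 1" for e
  proof -
    consider j where "j < 2" "e = {#(False, j), (True, j)#}"
      | b where "e = {#(b, 0), (b, Suc 0)#}"
      using \<open>e \<in> ladder_edges 1\<close> by (auto simp: ladder_edges_def)
    then show ?thesis
    proof cases
      case (1 j) then show ?thesis by (auto simp: ladder_edges_def r_def)
    next
      case (2 b) then show ?thesis by (auto simp: ladder_edges_def r_def)
    qed
  qed
  with r have "map_pregraph r (ladder_graph 1) = ladder_graph 1" by (rule ladder_automorphism)
  then show "map_pregraph (f \<circ> r) (ladder_graph 1) = map_pregraph f (ladder_graph 1)"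
    by (metis map_pregraph_comp)
  have inj: "inj_on f (UNIV \<times> {..<2 * 1})" using assms(1) by (simp add: is_ladder_def)
  have "inj_on (f \<circ> r) (UNIV \<times> {..<2 * 1})"
    using r inj by (intro comp_inj_on) (auto intro: inj_on_subset)
  moreover have "rung_square (f \<circ> r) 0 = rung_square f 0"
    by (simp add: rung_square_def r_def) (metis square_flip square_rotate)
  ultimately show "is_ladder P (f \<circ> r) 1" using assms(1) by (auto simp: is_ladder_def)
qed

text \<open>A new square that is linked along one of its edges to the last rung prolongs the ladder.\<close>

lemma ladder_extend:
  assumes P: "partial_marked P" and f: "is_ladder P f k"
    and Q: "Q \<in> marked_quotients P" "has_type Q Q1" "{#u, w#} \<in># edges Q"
    and disj: "verts Q \<inter> f ` (UNIV \<times> {..<2 * k}) = {}"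
    and link: "{#f (False, 2 * k - 1), u#} \<in># edges1 P" "{#f (True, 2 * k - 1), w#} \<in># edges1 P"
  shows "\<not> maximal_q1_ladder P (map_pregraph f (ladder_graph k))"
proof
  assume max: "maximal_q1_ladder P (map_pregraph f (ladder_graph k))"
  obtain x y where xy: "Q = square u w x y" "distinct [u, w, x, y]" using square_with_edge[OF Q(2,3)] by blast
  \<comment> \<open>The new rungs are u-w and y-x, with indices 2 * k and 2 * k + 1.\<close>
  define g where "g = (\<lambda>(b, j). if j < 2 * k then f (b, j) else
     if j = 2 * k then (if b then w else u) else (if b then x else y))"
  have k: "k \<ge> 1" and inj: "inj_on f (UNIV \<times> {..<2 * k})" using f by (auto simp: is_ladder_def)
  have g_old: "g (b, j) = f (b, j)" if "j < 2 * k" for b j using that by (simp add: g_def)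
  have "inj_on g (UNIV \<times> {..<2 * Suc k})"
  proof (rule inj_onI)
    fix p q assume pq: "p \<in> UNIV \<times> {..<2 * Suc k}" "q \<in> UNIV \<times> {..<2 * Suc k}" "g p = g q"
    have new: "g (b, j) \<in> verts Q" if "\<not> j < 2 * k" for b j
      using that by (auto simp: g_def xy(1))
    obtain b i c j where [simp]: "p = (b, i)" "q = (c, j)" by (cases p; cases q)
    have old: "g (b, j) \<notin> verts Q" if "j < 2 * k" for b j
      using disj g_old[OF that, of b] that by (auto simp: disjoint_iff)
    consider "i < 2 * k" "j < 2 * k" | "i \<in> {2 * k, Suc (2 * k)}" "j \<in> {2 * k, Suc (2 * k)}"
      using pq new[of i b] new[of j c] old[of i b] old[of j c] by fastforce
    then show "p = q"
    proof cases
      case 1 then show ?thesis using pq inj_onD[OF inj, of p q] by (auto simp: g_old)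
    next
      case 2 then show ?thesis using pq(3) xy(2) by (auto simp: g_def split: if_splits)
    qed
  qed
  moreover have "rung_square g i \<in> marked_quotients P" if "i < Suc k" for i
  proof (cases "i = k")
    case True
    then have "rung_square g i = Q" by (simp add: rung_square_def g_def xy)
    then show ?thesis using Q by simp
  next
    case False
    then have "rung_square g i = rung_square f i" using that by (simp add: rung_square_def g_old)
    then show ?thesis using f that False by (simp add: is_ladder_def)
  qed
  moreover have "{#g (b, 2 * i + 1), g (b, 2 * i + 2)#} \<in># edges1 P" if "Suc i < Suc k" for i b
  proof (cases "Suc i = k")
    case True
    then have "2 * i + 1 = 2 * k - 1" "2 * i + 2 = 2 * k" "2 * k - 1 < 2 * k" using k by auto
    then have "g (b, 2 * i + 1) = f (b, 2 * k - 1)" "g (b, 2 * i + 2) = (if b then w else u)"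
      by (simp_all only: g_old) (simp add: g_def)
    then show ?thesis using link by (cases b) simp_all
  next
    case False
    then show ?thesis using f that by (simp add: is_ladder_def g_old)
  qed
  ultimately have g: "is_ladder P g (Suc k)" by (simp add: is_ladder_def)
  let ?H' = "map_pregraph g (ladder_graph (Suc k))"
  have "q1_ladder P ?H'" using g P by (auto simp: q1_ladder_iff)
  moreover have "subgraph (map_pregraph f (ladder_graph k)) ?H'"
    unfolding subgraph_map_ladder[OF inj]
  proof (intro conjI ballI)
    show "f ` (UNIV \<times> {..<2 * k}) \<subseteq> verts ?H'"
    proof (rule image_subsetI)
      fix p assume "p \<in> (UNIV :: bool set) \<times> {..<2 * k}"
      then have "f p = g p" "p \<in> UNIV \<times> {..<2 * Suc k}" by (auto simp: g_def)
      then show "f p \<in> verts ?H'" by (simp only: map_pregraph_simps ladder_graph_simps imageI)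
    qed
    fix e assume e: "e \<in> ladder_edges k"
    then have "e \<in> ladder_edges (Suc k)"
    proof -
      consider j where "j < 2 * k" "e = {#(False, j), (True, j)#}"
        | b j where "Suc j < 2 * k" "e = {#(b, j), (b, Suc j)#}"
        using e by (auto simp: ladder_edges_def)
      then show ?thesis
        using ladder_edges_rung[of _ "Suc k"] ladder_edges_side[of _ "Suc k"] by cases auto
    qed
    moreover have "image_mset f e = image_mset g e"
      using ladder_edges_verts[OF e] by (intro image_mset_cong) (auto simp: g_def)
    ultimately show "image_mset f e \<in># edges ?H'" by (auto simp: finite_ladder_edges)
  qed
  ultimately have "?H' = map_pregraph f (ladder_graph k)" using max by (auto simp: maximal_q1_ladder_def)
  then have "verts ?H' = verts (map_pregraph f (ladder_graph k))" by simp
  moreover have "g (False, 2 * k) \<in> verts ?H'" by (auto intro!: imageI)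
  moreover have "g (False, 2 * k) = u" "u \<in> verts Q" by (auto simp: g_def xy)
  ultimately show False using disj by (auto simp: disjoint_iff)
qed

section \<open>Maximal ladders\<close>

lemma quotient_meets_ladder:
  assumes P: "partial_marked P" and f: "is_ladder P f k" and Q: "Q \<in> marked_quotients P"
    and meet: "verts Q \<inter> f ` (UNIV \<times> {..<2 * k}) \<noteq> {}"
  shows "\<exists>i < k. Q = rung_square f i"
proof -
  obtain v i where "v \<in> verts Q" "i < k" "v \<in> verts (rung_square f i)"
    using meet by (auto simp: ladder_verts)
  then show ?thesis
    using marked_quotients_basics(5)[OF P Q] f by (auto simp: is_ladder_def)
qed

text \<open>The edge of colour 1 at a vertex of an inner rung leads to the ladder itself. A square outside the
  ladder can thus be linked only to the first or the last rung or, if the ladder is a single square,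
  to one of its sides. Reversing or transposing the ladder turns this edge into the last rung, and
  then the ladder is not maximal.\<close>

lemma maximal_ladder_absorbs:
  assumes P: "partial_marked P" and f: "is_ladder P f k"
    and max: "maximal_q1_ladder P (map_pregraph f (ladder_graph k))"
    and i: "i < k" "{#u, w#} \<in># edges (rung_square f i)"
    and Q: "Q \<in> marked_quotients P" "has_type Q Q1" "{#u', w'#} \<in># edges Q"
    and link: "{#u, u'#} \<in># edges1 P" "{#w, w'#} \<in># edges1 P"
  shows "verts Q \<subseteq> f ` (UNIV \<times> {..<2 * k})"
proof (rule ccontr)
  let ?V = "f ` (UNIV \<times> {..<2 * k})"
  assume not_sub: "\<not> verts Q \<subseteq> ?V"
  have disj: "verts Q \<inter> ?V = {}"
  proof (rule ccontr)
    assume "verts Q \<inter> ?V \<noteq> {}"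
    then obtain j where "j < k" "Q = rung_square f j" using quotient_meets_ladder[OF P f Q(1)] by blast
    then show False using not_sub by (auto simp: ladder_verts)
  qed
  have uw': "u' \<in> verts Q" "w' \<in> verts Q"
    using square_with_edge[OF Q(2,3)] by auto
  \<comment> \<open>The link to the last rung is excluded in both orientations of that rung.\<close>
  have high: False
    if g: "is_ladder P g k" "map_pregraph g (ladder_graph k) = map_pregraph f (ladder_graph k)"
      and uw: "{#u, w#} = {#g (False, 2 * k - 1), g (True, 2 * k - 1)#}" for g
  proof -
    have "verts (map_pregraph g (ladder_graph k)) = verts (map_pregraph f (ladder_graph k))" using g(2) by simp
    then have V: "g ` (UNIV \<times> {..<2 * k}) = ?V" by simp
    have flip: "{#w', u'#} \<in># edges Q" using Q(3) by (simp add: add_mset_commute)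
    from uw consider "u = g (False, 2 * k - 1)" "w = g (True, 2 * k - 1)"
      | "w = g (False, 2 * k - 1)" "u = g (True, 2 * k - 1)" by (auto simp: pair_mset_eq_iff)
    then show False
    proof cases
      case 1
      then show False using ladder_extend[OF P g(1) Q] V disj link max g(2) by auto
    next
      case 2
      then show False using ladder_extend[OF P g(1) Q(1,2) flip] V disj link max g(2) by auto
    qed
  qed
  have high1: False
    if "is_ladder P g 1" "map_pregraph g (ladder_graph 1) = map_pregraph f (ladder_graph 1)"
      "{#u, w#} = {#g (False, 1), g (True, 1)#}" "k = 1" for g
    using high[of g] that by simp
  have no_link: "u \<noteq> f p \<and> w \<noteq> f p" if "{#f p, f q#} \<in># edges1 P" "q \<in> UNIV \<times> {..<2 * k}" for p q
    using colour1_neighbour_unique[OF P that(1)] link uw' disj that(2) by (auto simp: disjoint_iff)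
  have last: "u \<noteq> f (b, 2 * i + 1) \<and> w \<noteq> f (b, 2 * i + 1)" if "Suc i < k" for b
    using no_link[of "(b, 2 * i + 1)" "(b, 2 * i + 2)"] f that by (auto simp: is_ladder_def)
  have first: "u \<noteq> f (b, 2 * i) \<and> w \<noteq> f (b, 2 * i)" if "i > 0" for b
  proof -
    have "{#f (b, 2 * (i - 1) + 1), f (b, 2 * (i - 1) + 2)#} \<in># edges1 P"
      using f i(1) that by (auto simp: is_ladder_def)
    moreover have "2 * (i - 1) + 2 = 2 * i" using that by auto
    ultimately have "{#f (b, 2 * i), f (b, 2 * (i - 1) + 1)#} \<in># edges1 P" by (simp add: add_mset_commute)
    then show ?thesis using i(1) by (intro no_link) auto
  qed
  from i(2) consider "{#u, w#} = {#f (False, 2 * i), f (True, 2 * i)#}"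
    | "{#u, w#} = {#f (True, 2 * i), f (True, 2 * i + 1)#}"
    | "{#u, w#} = {#f (False, 2 * i + 1), f (True, 2 * i + 1)#}"
    | "{#u, w#} = {#f (False, 2 * i), f (False, 2 * i + 1)#}"
    by (auto simp: rung_square_def add_mset_commute)
  then show False
  proof cases
    case 1
    then have "i = 0" using first by (auto simp: pair_mset_eq_iff)
    with 1 show False using high[OF is_ladder_reverse[OF f]] i(1) by simp
  next
    case 2
    then have "\<not> i > 0" "\<not> Suc i < k" using first[of True] last[of True] by (auto simp: pair_mset_eq_iff)
    then have "i = 0" "k = 1" using i(1) by auto
    then have "is_ladder P f 1" using f by simp
    from 2 \<open>i = 0\<close> show False
      by (intro high1[OF is_ladder_transpose[OF \<open>is_ladder P f 1\<close>] _ \<open>k = 1\<close>]) simp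
  next
    case 3
    then have "\<not> Suc i < k" using last by (auto simp: pair_mset_eq_iff)
    then have "2 * i + 1 = 2 * k - 1" using i(1) by auto
    with 3 show False using high[OF f refl] by simp
  next
    case 4
    then have "\<not> i > 0" "\<not> Suc i < k" using first[of False] last[of False] by (auto simp: pair_mset_eq_iff)
    then have "i = 0" "k = 1" using i(1) by auto
    then have "is_ladder P f 1" using f by simp
    note t = is_ladder_transpose[OF this]
    from 4 \<open>i = 0\<close> show False
      by (intro high1[OF is_ladder_reverse(1)[OF t(1)] is_ladder_reverse(2)[OF t(1), unfolded t(2)] _ \<open>k = 1\<close>])
        simp
  qed
qed

text \<open>Consecutive squares of \<open>H'\<close> are linked, so that being absorbed by \<open>H\<close> spreads along \<open>H'\<close> in both
  directions from the square that contains \<open>v\<close>.\<close>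

lemma maximal_ladders_meet_subset:
  assumes P: "partial_marked P" and H: "maximal_q1_ladder P H" "maximal_q1_ladder P H'"
    and v: "v \<in> verts H" "v \<in> verts H'"
  shows "verts H' \<subseteq> verts H"
proof -
  obtain f k where f: "is_ladder P f k" "H = map_pregraph f (ladder_graph k)"
    using H(1) by (auto simp: maximal_q1_ladder_def q1_ladder_iff[OF P])
  obtain g l where g: "is_ladder P g l" "H' = map_pregraph g (ladder_graph l)"
    using H(2) by (auto simp: maximal_q1_ladder_def q1_ladder_iff[OF P])
  let ?V = "f ` (UNIV \<times> {..<2 * k})"
  have sq: "rung_square g i \<in> marked_quotients P" "has_type (rung_square g i) Q1" if "i < l" for i
    using g(1) that rung_square_has_type[of g l i] by (auto simp: is_ladder_def)
  have spread: "verts (rung_square g j) \<subseteq> ?V"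
    if ij: "i < l" "j < l" "verts (rung_square g i) \<subseteq> ?V"
      and uw: "{#u, w#} \<in># edges (rung_square g i)" "{#u', w'#} \<in># edges (rung_square g j)"
        "{#u, u'#} \<in># edges1 P" "{#w, w'#} \<in># edges1 P" for i j u w u' w'
  proof -
    have "verts (rung_square g i) \<inter> ?V \<noteq> {}"
      using ij marked_quotients_basics(4)[OF P sq(1)[OF ij(1)]] by auto
    then obtain i' where "i' < k" "rung_square g i = rung_square f i'"
      using quotient_meets_ladder[OF P f(1) sq(1)[OF ij(1)]] by blast
    then show ?thesis
      using maximal_ladder_absorbs[OF P f(1), of i' u w "rung_square g j" u' w'] H(1) f(2) uw sq[OF ij(2)] by simp
  qed
  have edges: "{#g (False, 2 * i + 1), g (True, 2 * i + 1)#} \<in># edges (rung_square g i)"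
    "{#g (False, 2 * i + 2), g (True, 2 * i + 2)#} \<in># edges (rung_square g (Suc i))" for i
    by (auto simp: rung_square_def add_mset_commute)
  have links: "{#g (b, 2 * i + 1), g (b, 2 * i + 2)#} \<in># edges1 P" "{#g (b, 2 * i + 2), g (b, 2 * i + 1)#} \<in># edges1 P"
    if "Suc i < l" for i b
    using g(1) that by (auto simp: is_ladder_def add_mset_commute)
  obtain j where j: "j < l" "v \<in> verts (rung_square g j)"
    using v(2) g(2) by (auto simp: ladder_verts)
  have start: "verts (rung_square g j) \<subseteq> ?V"
  proof -
    have "v \<in> ?V" using v(1) f(2) by simp
    then obtain i' where "i' < k" "rung_square g j = rung_square f i'"
      using quotient_meets_ladder[OF P f(1) sq(1)[OF j(1)]] j(2) by blast
    then show ?thesis by (auto simp: ladder_verts)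
  qed
  have "verts (rung_square g i) \<subseteq> ?V" if "i < l" for i
  proof (cases "j \<le> i")
    case True
    then show ?thesis using that
    proof (induction i rule: dec_induct)
      case (step n)
      then show ?case
        using spread[of n "Suc n", OF _ _ _ edges links(1) links(1)] by simp
    qed (rule start)
  next
    case False
    then have "i \<le> j" by simp
    then show ?thesis
    proof (induction i rule: inc_induct)
      case (step n)
      then show ?case
        using spread[of "Suc n" n, OF _ _ _ edges(2,1) links(2) links(2)] j(1) by simp
    qed (rule start)
  qed
  then show ?thesis using f(2) g(2) by (auto simp: ladder_verts)
qed

lemma maximal_ladders_meet:
  assumes "partial_marked P" "maximal_q1_ladder P H" "maximal_q1_ladder P H'" "v \<in> verts H" "v \<in> verts H'"
  shows "verts H = verts H'"
  using maximal_ladders_meet_subset[OF assms] maximal_ladders_meet_subset[OF assms(1,3,2,5,4)] by blast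

lemma q1_ladder_subgraph: "q1_ladder P H \<Longrightarrow> subgraph H (underlying P)"
  by (simp add: q1_ladder_def)

lemma subgraph_trans: "subgraph G H \<Longrightarrow> subgraph H K \<Longrightarrow> subgraph G K"
  by (auto simp: subgraph_def)

lemma subgraph_refl: "subgraph H G \<Longrightarrow> subgraph H H"
  by (simp add: subgraph_def)

text \<open>The ladders of \<open>P\<close> are bounded in size, and a proper prolongation is larger.\<close>

lemma maximal_q1_ladder_ex:
  assumes P: "partial_marked P" and H: "q1_ladder P H"
  shows "\<exists>H'. maximal_q1_ladder P H' \<and> subgraph H H'"
proof -
  let ?A = "\<lambda>H'. q1_ladder P H' \<and> subgraph H H'"
  let ?m = "\<lambda>H'. card (verts H') + size (edges H')"
  have bound: "?m K < Suc (card (cverts P) + size (edges (underlying P)))" if "?A K" for K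
  proof -
    have "verts K \<subseteq> cverts P" "edges K \<subseteq># edges (underlying P)"
      using q1_ladder_subgraph[of P K] that by (auto simp: subgraph_def)
    then show ?thesis
      using card_mono[OF partial_markedD(3)[OF P]] size_mset_mono[of "edges K"] by (meson add_mono le_imp_less_Suc)
  qed
  have "?A H" using H subgraph_refl[OF q1_ladder_subgraph[OF H]] by blast
  then obtain H' where H': "?A H'" "\<And>K. ?A K \<Longrightarrow> ?m K \<le> ?m H'"
    using ex_has_greatest_nat[of ?A H ?m] bound by blast
  have "K = H'" if K: "q1_ladder P K" "subgraph H' K" for K
  proof -
    have sub: "verts H' \<subseteq> verts K" "edges H' \<subseteq># edges K" using K(2) by (auto simp: subgraph_def)
    have fin: "finite (verts K)" using q1_ladder_subgraph[OF K(1)] by (auto simp: subgraph_def is_pregraph_def)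
    have "?m K \<le> ?m H'" using H' K subgraph_trans[of H H' K] by blast
    then have "card (verts K) = card (verts H')" "size (edges K) = size (edges H')"
      using card_mono[OF fin sub(1)] size_mset_mono[OF sub(2)] by linarith+
    then have "verts K = verts H'" "edges K = edges H'"
      using card_subset_eq[OF fin sub(1)] sub(2) by (auto dest: mset_subset_size simp: subset_mset.le_less)
    then show ?thesis by (intro pregraph.equality) auto
  qed
  then show ?thesis using H'(1) by (auto simp: maximal_q1_ladder_def)
qed

lemma subset_mset_filter: "A \<subseteq># B \<Longrightarrow> (\<And>e. e \<in># A \<Longrightarrow> \<phi> e) \<Longrightarrow> A \<subseteq># filter_mset \<phi> B"
  by (metis filter_mset_True filter_mset_cong multiset_filter_mono)

lemma subgraph_induced:
  assumes "subgraph H G"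
  shows "edges H \<subseteq># edges (induced G (verts H))"
  unfolding induced_simps
  using assms is_pregraphD(2)[of H] by (intro subset_mset_filter) (auto simp: subgraph_def)

lemma q1_ladder_cluster:
  assumes P: "partial_marked P" and H: "q1_ladder P H"
  shows "quotient_cluster P Q1 (verts H)"
proof -
  obtain f k where f: "is_ladder P f k" "H = map_pregraph f (ladder_graph k)"
    using H by (auto simp: q1_ladder_iff[OF P])
  have "rung_square f ` {..<k} \<subseteq> {Q \<in> marked_quotients P. has_type Q Q1}"
    using f(1) rung_square_has_type[of f k] by (auto simp: is_ladder_def)
  moreover have "verts H = (\<Union>Q \<in> rung_square f ` {..<k}. verts Q)" using f(2) by (simp add: ladder_verts)
  moreover have "connected_pregraph (induced (underlying P) (verts H))"
  proof (rule connected_mono)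
    show "connected_pregraph H" using f by (auto simp: is_ladder_def connected_map connected_ladder)
    show "verts H = verts (induced (underlying P) (verts H))"
      using q1_ladder_subgraph[OF H] by (auto simp: subgraph_def)
    show "edges H \<subseteq># edges (induced (underlying P) (verts H))"
      by (rule subgraph_induced[OF q1_ladder_subgraph[OF H]])
  qed
  ultimately show ?thesis unfolding quotient_cluster_def by blast
qed

section \<open>The blocks form a partition\<close>

lemma block_set_cluster:
  assumes "partial_marked P" "block_set P t S"
  shows "quotient_cluster P t S"
  using assms quotient_cluster_single[OF assms(1)] q1_ladder_cluster[OF assms(1)]
  by (cases t) (auto simp: maximal_cluster_def maximal_q1_ladder_def)

text \<open>A vertex lies in one marked quotient, whose type is the type of the block. For this type, maximal
  ladders or clusters that meet have the same vertices.\<close>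

lemma block_set_meet:
  assumes P: "partial_marked P" and S: "block_set P t S" "block_set P t' S'" and v: "v \<in> S" "v \<in> S'"
  shows "t = t' \<and> S = S'"
proof -
  have t: "t = t'" by (rule quotient_cluster_type_unique[OF P block_set_cluster[OF P S(1)] block_set_cluster[OF P S(2)] v])
  moreover have "S = S'"
  proof (cases t)
    case Q1
    then show ?thesis using S t maximal_ladders_meet[OF P _ _ ] v by auto
  next
    case Q2
    then show ?thesis using S t maximal_cluster_meet[OF P, of Q2 S S' v v] v by auto
  next
    case Q3
    then show ?thesis using S t maximal_cluster_meet[OF P, of Q3 S S' v v] v by auto
  next
    case Q4
    then show ?thesis using S t marked_quotients_basics(5)[OF P] v by auto
  qed
  ultimately show ?thesis by simp
qed

lemma quotient_is_ladder:
  assumes P: "partial_marked P" and Q: "Q \<in> marked_quotients P" "has_type Q Q1"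
  shows "\<exists>H. q1_ladder P H \<and> verts H = verts Q"
proof -
  obtain a b c d where *: "distinct [a, b, c, d]" "Q = square a b c d"
    using Q(2) by (auto simp: has_type_Q1_iff)
  define f where "f = (\<lambda>(s, j). if j = (0 :: nat) then (if s then b else a) else (if s then c else d))"
  have sq: "rung_square f 0 = Q" by (simp add: rung_square_def f_def *)
  have "inj_on f (UNIV \<times> {..<2 * 1})"
    using *(1) by (auto simp: inj_on_def f_def split: if_splits)
  then have "is_ladder P f 1" using Q(1) sq by (auto simp: is_ladder_def)
  moreover have "verts (map_pregraph f (ladder_graph 1)) = verts Q"
    using ladder_verts[of f 1] sq by (simp add: lessThan_Suc)
  ultimately show ?thesis using q1_ladder_iff[OF P] by blast
qed

lemma block_set_ex:
  assumes P: "partial_marked P" and Q: "Q \<in> marked_quotients P" "has_type Q t"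
  shows "\<exists>S. block_set P t S \<and> verts Q \<subseteq> S"
proof (cases t)
  case Q1
  then obtain H where "q1_ladder P H" "verts H = verts Q" using quotient_is_ladder[OF P] Q by auto
  moreover from this obtain H' where "maximal_q1_ladder P H'" "subgraph H H'"
    using maximal_q1_ladder_ex[OF P] by blast
  ultimately show ?thesis using Q1 by (auto simp: subgraph_def)
next
  case Q4
  then show ?thesis using Q by auto
qed (use maximal_cluster_ex[OF P quotient_cluster_single[OF P Q]] in auto)

lemma block_partition_cover:
  assumes P: "partial_marked P"
  shows "\<Union> (block_partition P) = cverts P"
proof (intro equalityI subsetI)
  fix v assume "v \<in> \<Union> (block_partition P)"
  then show "v \<in> cverts P"
    using block_set_cluster[OF P] quotient_clusterD(1)[OF P] by (fastforce simp: block_partition_def)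
next
  fix v assume "v \<in> cverts P"
  then obtain Q where Q: "Q \<in> marked_quotients P" "v \<in> verts Q" using marked_quotients_basics(1)[OF P] by blast
  moreover from Q(1) obtain t where "has_type Q t" using partial_markedD(8)[OF P] by blast
  ultimately show "v \<in> \<Union> (block_partition P)"
    using block_set_ex[OF P] by (fastforce simp: block_partition_def)
qed

lemma block_partition_meet:
  assumes "partial_marked P" "S \<in> block_partition P" "S' \<in> block_partition P" "v \<in> S" "v \<in> S'"
  shows "S = S'"
  using assms block_set_meet[OF assms(1) _ _ assms(4,5)] unfolding block_partition_def by blast

lemma block_partitionD:
  assumes "partial_marked P" "S \<in> block_partition P"
  shows "S \<subseteq> cverts P" "S \<noteq> {}" "closed_under (colour0 P) S"
    "connected_pregraph (induced (underlying P) S)"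
  using assms block_set_cluster[OF assms(1)] quotient_clusterD[OF assms(1)]
  by (auto simp: block_partition_def quotient_cluster_iff; blast)+

lemma finite_block_partition: "partial_marked P \<Longrightarrow> finite (block_partition P)"
  by (metis block_partition_cover finite_UnionD partial_markedD(3))

text \<open>Blocks are disjoint and nonempty, so some of them that already cover all vertices are all of them.
  A block partition is thus found by exhibiting enough blocks.\<close>

lemma block_partition_eqI:
  assumes P: "partial_marked P" and \<S>: "\<S> \<subseteq> block_partition P" "\<Union> \<S> = cverts P"
  shows "block_partition P = \<S>"
proof
  show "block_partition P \<subseteq> \<S>"
  proof
    fix S assume S: "S \<in> block_partition P"
    then obtain v where v: "v \<in> S" "v \<in> cverts P" using block_partitionD[OF P S] by auto
    then obtain S' where "S' \<in> \<S>" "v \<in> S'" using \<S>(2) by auto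
    then show "S \<in> \<S>" using block_partition_meet[OF P S _ v(1)] \<S>(1) by auto
  qed
qed (rule \<S>)

section \<open>Blocks of a pregraph and of its parts\<close>

text \<open>This covers the two situations in which blocks are compared: connections are added, or the
  pregraph is restricted to a union of marked quotients.\<close>

definition below :: "'v coloured \<Rightarrow> 'v coloured \<Rightarrow> bool" where
  "below P G \<longleftrightarrow> partial_marked P \<and> partial_marked G \<and>
     marked_quotients P \<subseteq> marked_quotients G \<and> subgraph (underlying P) (underlying G)"

lemma q1_ladder_mono: "below P G \<Longrightarrow> q1_ladder P H \<Longrightarrow> q1_ladder G H"
  unfolding below_def q1_ladder_def using subgraph_trans[of H "underlying P" "underlying G"] by blast

lemma quotient_cluster_mono:
  assumes PG: "below P G" and S: "quotient_cluster P t S"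
  shows "quotient_cluster G t S"
proof -
  have "S \<subseteq> cverts P" "S \<subseteq> cverts G"
    using quotient_clusterD(1)[OF _ S] PG by (auto simp: below_def subgraph_def)
  then have V: "verts (induced (underlying P) S) = verts (induced (underlying G) S)" by auto
  have E: "edges (induced (underlying P) S) \<subseteq># edges (induced (underlying G) S)"
    using PG by (simp add: below_def subgraph_def multiset_filter_mono del: filter_union_mset)
  have "connected_pregraph (induced (underlying P) S)" using S by (simp add: quotient_cluster_def)
  then have "connected_pregraph (induced (underlying G) S)" by (rule connected_mono[OF _ V E])
  moreover have "{Q \<in> marked_quotients P. has_type Q t} \<subseteq> {Q \<in> marked_quotients G. has_type Q t}"
    using PG by (auto simp: below_def)
  moreover obtain \<Q> where "\<Q> \<subseteq> {Q \<in> marked_quotients P. has_type Q t}" "S = (\<Union>Q \<in> \<Q>. verts Q)"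
    using S by (auto simp: quotient_cluster_def)
  ultimately show ?thesis unfolding quotient_cluster_def by (intro conjI exI[of _ \<Q>]) auto
qed

text \<open>A ladder or cluster of \<open>P\<close> is also one of \<open>G\<close>, where it extends to a maximal one.\<close>

lemma block_set_grow:
  assumes PG: "below P G" and S: "block_set P t S"
  shows "\<exists>S'. block_set G t S' \<and> S \<subseteq> S'"
proof (cases t)
  case Q1
  then obtain H where H: "q1_ladder P H" "S = verts H" using S by (auto simp: maximal_q1_ladder_def)
  then obtain H' where "maximal_q1_ladder G H'" "subgraph H H'"
    using maximal_q1_ladder_ex q1_ladder_mono[OF PG] PG unfolding below_def by blast
  then show ?thesis using Q1 H by (auto simp: subgraph_def)
next
  case Q4
  then show ?thesis using S PG by (auto simp: below_def)
qed (use S PG quotient_cluster_mono[OF PG, of t S] maximal_cluster_ex[of G t S] in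
      \<open>auto simp: below_def maximal_cluster_def\<close>)

text \<open>If the subgraph induced by a block of \<open>G\<close> is present in \<open>P\<close>, then it is a ladder or cluster of \<open>P\<close>,
  and it is maximal there because anything larger in \<open>P\<close> would be larger in \<open>G\<close>.\<close>

lemma block_set_localize:
  assumes PG: "below P G" and S: "block_set G t S" and sub: "S \<subseteq> cverts P"
    and ind: "induced (underlying P) S = induced (underlying G) S"
    and quot: "\<And>Q. Q \<in> marked_quotients G \<Longrightarrow> verts Q \<subseteq> S \<Longrightarrow> Q \<in> marked_quotients P"
  shows "block_set P t S"
proof -
  have P: "partial_marked P" and G: "partial_marked G" using PG by (auto simp: below_def)
  have cl: "quotient_cluster P t S"
  proof -
    obtain \<Q> where "\<Q> \<subseteq> {Q \<in> marked_quotients G. has_type Q t}" "S = (\<Union>Q \<in> \<Q>. verts Q)"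
      "connected_pregraph (induced (underlying G) S)"
      using block_set_cluster[OF G S] by (auto simp: quotient_cluster_def)
    moreover from this have "\<Q> \<subseteq> {Q \<in> marked_quotients P. has_type Q t}" using quot by blast
    ultimately show ?thesis unfolding quotient_cluster_def ind by blast
  qed
  have max: "maximal_cluster P t S" if "maximal_cluster G t S"
    using that cl quotient_cluster_mono[OF PG] unfolding maximal_cluster_def by blast
  show ?thesis
  proof (cases t)
    case Q1
    then obtain H where H: "maximal_q1_ladder G H" "S = verts H" using S by auto
    then have lad: "q1_ladder G H" by (simp add: maximal_q1_ladder_def)
    have "edges H \<subseteq># edges (induced (underlying P) S)"
      using subgraph_induced[OF q1_ladder_subgraph[OF lad]] H(2) ind by simp
    also have "\<dots> \<subseteq># edges (underlying P)" unfolding induced_simps by (rule multiset_filter_subset)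
    finally have "subgraph H (underlying P)"
      using q1_ladder_subgraph[OF lad] sub H(2) by (auto simp: subgraph_def)
    moreover have "induced H X \<in> marked_quotients P" if "induced H X \<in> marked_quotients G" for X
      using that H(2) by (intro quot) auto
    ultimately have "q1_ladder P H" using lad unfolding q1_ladder_def by blast
    then have "maximal_q1_ladder P H"
      using H(1) q1_ladder_mono[OF PG] unfolding maximal_q1_ladder_def by blast
    then show ?thesis using Q1 H(2) by auto
  next
    case Q4
    then show ?thesis using S quot by auto
  qed (use max S in auto)
qed

lemma marked_quotients_induced:
  assumes "partial_marked G" "closed_under (colour0 G) S" "S \<subseteq> cverts G"
  shows "marked_quotients (induced_coloured G S) = {Q \<in> marked_quotients G. verts Q \<subseteq> S}"
  using components_induced_closed[OF partial_markedD(2)[OF assms(1)] assms(2)] assms(3)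
  by (simp add: marked_quotients_def colour0_induced)

lemma degree_mono: "edges H \<subseteq># edges G \<Longrightarrow> degree H v \<le> degree G v"
  unfolding degree_def by (metis image_mset_subseteq_mono sum_mset.union subset_mset.less_eqE le_add1 image_mset_union)

lemma partial_marked_induced:
  assumes G: "partial_marked G" and S: "closed_under (colour0 G) S" "S \<subseteq> cverts G"
  shows "partial_marked (induced_coloured G S)"
proof -
  have pre: "is_pregraph (underlying (induced_coloured G S))"
    using is_pregraph_induced[OF partial_markedD(1)[OF G]] by (simp add: underlying_induced)
  have deg0: "degree (colour0 (induced_coloured G S)) v = 2" if "v \<in> S" for v
    using degree_induced_closed[OF partial_markedD(2)[OF G] S(1) that] partial_markedD(6)[OF G, of v] that S(2)
    by (auto simp: colour0_induced)
  have "degree (underlying (induced_coloured G S)) v \<in> {2, 3}" if "v \<in> S" for v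
  proof -
    have "degree (colour0 (induced_coloured G S)) v \<le> degree (underlying (induced_coloured G S)) v"
      by (rule degree_mono) simp
    moreover have "degree (underlying (induced_coloured G S)) v \<le> degree (underlying G) v"
      unfolding underlying_induced by (rule degree_mono) (simp add: subset_mset.add_mono)
    moreover have "v \<in> cverts G" using that S(2) by auto
    then have "degree (underlying G) v \<le> 3" using partial_markedD(7)[OF G, of v] by linarith
    ultimately have "2 \<le> degree (underlying (induced_coloured G S)) v"
      "degree (underlying (induced_coloured G S)) v \<le> 3" using deg0[OF that] by linarith+
    then show ?thesis by auto
  qed
  moreover have "subgraph (colour0 (induced_coloured G S)) (underlying (induced_coloured G S))"
    using is_pregraph_colour0[OF pre] by (auto simp: subgraph_def)
  moreover have "\<exists>t. has_type C t" if "C \<in> components (colour0 (induced_coloured G S))" for C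
    using that marked_quotients_induced[OF assms] partial_markedD(8)[OF G] by (auto simp: marked_quotients_def)
  ultimately show ?thesis using pre deg0 by (auto simp: partial_marked_def C4q_factor_def)
qed

lemma below_induced:
  assumes G: "partial_marked G" and S: "closed_under (colour0 G) S" "S \<subseteq> cverts G"
  shows "below (induced_coloured G S) G"
  unfolding below_def
  using G partial_marked_induced[OF assms] marked_quotients_induced[OF assms]
    is_pregraph_induced[OF partial_markedD(1)[OF G]]
  by (auto simp: subgraph_def underlying_induced simp flip: filter_union_mset)

lemma induced_induced: "induced (induced G S) S = induced G S"
  by (simp add: induced_def filter_filter_mset)

lemma block_set_induced:
  assumes G: "partial_marked G" and S: "block_set G t S"
  shows "block_set (induced_coloured G S) t S"
proof -
  note cl = quotient_clusterD[OF G block_set_cluster[OF G S]]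
  show ?thesis
  proof (rule block_set_localize[OF below_induced[OF G cl(3,1)] S])
    show "S \<subseteq> cverts (induced_coloured G S)" using cl(1) by auto
    show "induced (underlying (induced_coloured G S)) S = induced (underlying G) S"
      by (simp add: underlying_induced induced_induced)
    show "Q \<in> marked_quotients (induced_coloured G S)" if "Q \<in> marked_quotients G" "verts Q \<subseteq> S" for Q
      using that marked_quotients_induced[OF G cl(3,1)] by simp
  qed
qed

lemma block_partition_induced:
  assumes G: "partial_marked G" and S: "S \<in> block_partition G"
  shows "block_partition (induced_coloured G S) = {S}"
proof -
  note D = block_partitionD[OF assms]
  obtain t where t: "block_set G t S" using S by (auto simp: block_partition_def)
  show ?thesis
  proof (rule block_partition_eqI)
    show "partial_marked (induced_coloured G S)" by (rule partial_marked_induced[OF G D(3,1)])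
    show "{S} \<subseteq> block_partition (induced_coloured G S)"
      using block_set_induced[OF G t] by (auto simp: block_partition_def)
    show "\<Union> {S} = cverts (induced_coloured G S)" using D(1) by auto
  qed
qed

lemma block_induced:
  assumes "partial_marked G" "S \<in> block_partition G"
  shows "block (induced_coloured G S)"
  using block_partition_induced[OF assms] block_partitionD[OF assms] partial_marked_induced[OF assms(1)]
  by (auto simp: block_def underlying_induced)

lemma block_partition_block:
  assumes "block B"
  shows "block_partition B = {cverts B}"
  using assms block_partition_cover[of B] by (auto simp: block_def)

section \<open>Isomorphism invariance of the blocks\<close>

text \<open>The inverse isomorphism allows results about renaming to be applied backwards.\<close>

lemma map_coloured_inverse:
  assumes "is_pregraph (underlying P)" "inj_on f (cverts P)"
  obtains g where "inj_on g (cverts (map_coloured f P))" "map_coloured g (map_coloured f P) = P"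
    "\<And>v. v \<in> cverts P \<Longrightarrow> g (f v) = v" "\<And>w. w \<in> cverts (map_coloured f P) \<Longrightarrow> f (g w) = w"
proof
  show "inj_on (inv_into (cverts P) f) (cverts (map_coloured f P))" by (simp add: inj_on_inv_into)
  show "map_coloured (inv_into (cverts P) f) (map_coloured f P) = P" by (rule map_coloured_inv_into[OF assms])
qed (use assms(2) in \<open>auto simp: f_inv_into_f\<close>)

lemma map_pregraph_cancel:
  assumes "is_pregraph H" "\<And>v. v \<in> verts H \<Longrightarrow> g (f v) = v"
  shows "map_pregraph g (map_pregraph f H) = H"
  using map_pregraph_cong[OF assms(1), of "g \<circ> f" "\<lambda>v. v"] assms(2)
  by (simp add: map_pregraph_comp map_pregraph_id)

lemma q1_ladder_map:
  assumes P: "partial_marked P" and f: "inj_on f (cverts P)" and H: "q1_ladder P H"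
  shows "q1_ladder (map_coloured f P) (map_pregraph f H)"
proof -
  obtain g k where g: "is_ladder P g k" and H': "H = map_pregraph g (ladder_graph k)"
    using H by (auto simp: q1_ladder_iff[OF P])
  have "g ` (UNIV \<times> {..<2 * k}) \<subseteq> cverts P"
    using q1_ladder_subgraph[OF H] H' by (auto simp: subgraph_def)
  then have "inj_on (f \<circ> g) (UNIV \<times> {..<2 * k})"
    using g f by (auto simp: is_ladder_def intro: comp_inj_on inj_on_subset)
  moreover have "rung_square (f \<circ> g) i = map_pregraph f (rung_square g i)" for i
    by (simp add: rung_square_def map_square)
  moreover have "{#f (g (b, 2 * i + 1)), f (g (b, 2 * i + 2))#} \<in># image_mset (image_mset f) (edges1 P)"
    if "Suc i < k" for i b
  proof -
    have "{#g (b, 2 * i + 1), g (b, 2 * i + 2)#} \<in># edges1 P" using g that by (auto simp: is_ladder_def)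
    then have "image_mset f {#g (b, 2 * i + 1), g (b, 2 * i + 2)#} \<in> image_mset f ` set_mset (edges1 P)" by (rule imageI)
    then show ?thesis by simp
  qed
  ultimately have "is_ladder (map_coloured f P) (f \<circ> g) k"
    using g marked_quotients_map[OF P f] by (auto simp: is_ladder_def)
  then show ?thesis
    using q1_ladder_iff[OF partial_marked_map[OF P f]] H' by (auto simp: map_pregraph_comp)
qed

lemma quotient_cluster_map:
  assumes P: "partial_marked P" and f: "inj_on f (cverts P)" and S: "quotient_cluster P t S"
  shows "quotient_cluster (map_coloured f P) t (f ` S)"
proof -
  obtain \<Q> where \<Q>: "\<Q> \<subseteq> {Q \<in> marked_quotients P. has_type Q t}" "S = (\<Union>Q \<in> \<Q>. verts Q)"
    and con: "connected_pregraph (induced (underlying P) S)"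
    using S by (auto simp: quotient_cluster_def)
  have "map_pregraph f ` \<Q> \<subseteq> {Q \<in> marked_quotients (map_coloured f P). has_type Q t}"
  proof (rule image_subsetI)
    fix Q assume "Q \<in> \<Q>"
    then have Q: "Q \<in> marked_quotients P" "has_type Q t" using \<Q>(1) by auto
    then show "map_pregraph f Q \<in> {Q \<in> marked_quotients (map_coloured f P). has_type Q t}"
      using has_type_map[OF Q(2) inj_on_subset[OF f marked_quotients_basics(2)[OF P Q(1)]]]
        marked_quotients_map[OF P f] by auto
  qed
  moreover have "f ` S = (\<Union>Q \<in> map_pregraph f ` \<Q>. verts Q)" using \<Q>(2) by auto
  moreover have "connected_pregraph (induced (underlying (map_coloured f P)) (f ` S))"
  proof -
    have "induced (underlying (map_coloured f P)) (f ` S) = map_pregraph f (induced (underlying P) S)"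
      unfolding underlying_map
      using partial_markedD(1)[OF P] f quotient_clusterD(1)[OF P S] by (intro induced_map) auto
    then show ?thesis using connected_map[OF con] by simp
  qed
  ultimately show ?thesis unfolding quotient_cluster_def by blast
qed

text \<open>A larger ladder or cluster in the renamed pregraph is pulled back along the inverse renaming, where
  maximality applies.\<close>

lemma block_set_map:
  assumes P: "partial_marked P" and f: "inj_on f (cverts P)" and S: "block_set P t S"
  shows "block_set (map_coloured f P) t (f ` S)"
proof -
  let ?R = "map_coloured f P"
  obtain g where g: "inj_on g (cverts ?R)" "map_coloured g ?R = P"
    "\<And>v. v \<in> cverts P \<Longrightarrow> g (f v) = v" "\<And>w. w \<in> cverts ?R \<Longrightarrow> f (g w) = w"
    using map_coloured_inverse[OF partial_markedD(1)[OF P] f] by blast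
  note R = partial_marked_map[OF P f]
  have max: "maximal_cluster ?R t (f ` S)" if "maximal_cluster P t S"
    unfolding maximal_cluster_def
  proof (intro conjI allI impI)
    have cl: "quotient_cluster P t S" using that by (simp add: maximal_cluster_def)
    then show "quotient_cluster ?R t (f ` S)" by (rule quotient_cluster_map[OF P f])
    fix S' assume S': "quotient_cluster ?R t S' \<and> f ` S \<subseteq> S'"
    then have "quotient_cluster P t (g ` S')" using quotient_cluster_map[OF R g(1)] g(2) by auto
    moreover have "S \<subseteq> g ` S'"
    proof
      fix v assume v: "v \<in> S"
      then have "g (f v) = v" using quotient_clusterD(1)[OF P cl] g(3) by auto
      then show "v \<in> g ` S'" using v S' by (metis image_eqI image_subset_iff)
    qed
    ultimately have "g ` S' = S" using that by (auto simp: maximal_cluster_def)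
    then have "f ` g ` S' = f ` S" by simp
    moreover have "f ` g ` S' = S'"
      using g(4) quotient_clusterD(1)[OF R, of t S'] S' by (force simp: image_image)
    ultimately show "S' = f ` S" by simp
  qed
  show ?thesis
  proof (cases t)
    case Q1
    then obtain H where H: "maximal_q1_ladder P H" "S = verts H" using S by auto
    then have lad: "q1_ladder P H" by (simp add: maximal_q1_ladder_def)
    have "maximal_q1_ladder ?R (map_pregraph f H)"
      unfolding maximal_q1_ladder_def
    proof (intro conjI allI impI)
      show "q1_ladder ?R (map_pregraph f H)" by (rule q1_ladder_map[OF P f lad])
      fix H' assume H': "q1_ladder ?R H' \<and> subgraph (map_pregraph f H) H'"
      then have "q1_ladder P (map_pregraph g H')" using q1_ladder_map[OF R g(1)] g(2) by auto
      moreover have "map_pregraph g (map_pregraph f H) = H"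
        using q1_ladder_subgraph[OF lad] g(3) by (intro map_pregraph_cancel) (auto simp: subgraph_def)
      then have "subgraph H (map_pregraph g H')" using subgraph_map[of _ H' g] H' by metis
      ultimately have "map_pregraph g H' = H" using H(1) by (auto simp: maximal_q1_ladder_def)
      moreover have "map_pregraph f (map_pregraph g H') = H'"
        using q1_ladder_subgraph[of ?R H'] H' g(4) by (intro map_pregraph_cancel) (auto simp: subgraph_def)
      ultimately show "H' = map_pregraph f H" by simp
    qed
    then show ?thesis using Q1 H(2) by auto
  next
    case Q4
    then obtain Q where Q: "Q \<in> marked_quotients P" "has_type Q Q4" "S = verts Q" using S by auto
    then have "has_type (map_pregraph f Q) Q4"
      by (intro has_type_map inj_on_subset[OF f marked_quotients_basics(2)[OF P]])
    then show ?thesis using Q4 Q marked_quotients_map[OF P f] by auto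
  qed (use max S in auto)
qed

lemma block_partition_map:
  assumes P: "partial_marked P" and f: "inj_on f (cverts P)"
  shows "block_partition (map_coloured f P) = (`) f ` block_partition P"
proof (rule block_partition_eqI[OF partial_marked_map[OF P f]])
  show "(`) f ` block_partition P \<subseteq> block_partition (map_coloured f P)"
    using block_set_map[OF P f] by (fastforce simp: block_partition_def)
  show "\<Union> ((`) f ` block_partition P) = cverts (map_coloured f P)"
    using block_partition_cover[OF P] by auto
qed

lemma iso_class_eq:
  assumes "is_pregraph (underlying P)" "isomorphic P R"
  shows "iso_class P = iso_class R"
  by (auto simp: iso_class_def intro: isomorphic_trans[OF isomorphic_sym[OF assms]] isomorphic_trans[OF assms(2)])

lemma iso_class_map:
  assumes "is_pregraph (underlying P)" "inj_on f (cverts P)"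
  shows "iso_class (map_coloured f P) = iso_class P"
  using iso_class_eq[OF assms(1) isomorphic_map[OF assms(2)]] by simp

lemma block_list_of_map:
  assumes P: "partial_marked P" and f: "inj_on f (cverts P)"
  shows "block_list_of (map_coloured f P) = block_list_of P"
proof -
  have sub: "S \<subseteq> cverts P" if "S \<in> block_partition P" for S by (rule block_partitionD(1)[OF P that])
  have inj: "inj_on ((`) f) (block_partition P)"
    by (rule inj_on_image) (use sub f in \<open>auto intro: inj_on_subset\<close>)
  have "iso_class (induced_coloured (map_coloured f P) (f ` S)) = iso_class (induced_coloured P S)"
    if "S \<in> block_partition P" for S
  proof -
    have "induced_coloured (map_coloured f P) (f ` S) = map_coloured f (induced_coloured P S)"
      by (rule induced_coloured_map[OF partial_markedD(1)[OF P] f sub[OF that]])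
    then show ?thesis
      using f by (simp, intro iso_class_map)
        (auto simp: underlying_induced is_pregraph_induced[OF partial_markedD(1)[OF P]] intro: inj_on_subset)
  qed
  then show ?thesis
    unfolding block_list_of_def block_partition_map[OF P f] image_mset_mset_set[OF inj, symmetric]
      multiset.map_comp o_def
    using finite_block_partition[OF P] by (intro image_mset_cong) simp
qed

lemma block_list_of_isomorphic:
  assumes "partial_marked P" "isomorphic P R"
  shows "block_list_of R = block_list_of P" "partial_marked R"
  using assms block_list_of_map partial_marked_map by (auto simp: isomorphic_def coloured_iso_map_iff)

lemma block_map:
  assumes B: "block B" and f: "inj_on f (cverts B)"
  shows "block (map_coloured f B)"
proof -
  have P: "partial_marked B" using B by (simp add: block_def)
  show ?thesis
    unfolding block_def block_partition_map[OF P f]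
    using B partial_marked_map[OF P f] connected_map[of "underlying B" f]
    by (auto simp: block_def underlying_map)
qed

lemma nat_copy_ex:
  assumes "is_pregraph (underlying P)"
  shows "\<exists>f :: 'v \<Rightarrow> nat. inj_on f (cverts (P :: 'v coloured))"
  using is_pregraphD(1)[OF assms] finite_imp_inj_to_nat_seg[of "cverts P"] by auto

lemma representative_iso_class:
  fixes P :: "'v coloured"
  assumes "is_pregraph (underlying P)"
  shows "isomorphic P (representative (iso_class P))"
proof -
  obtain f :: "'v \<Rightarrow> nat" where "inj_on f (cverts P)" using nat_copy_ex[OF assms] by blast
  then have "map_coloured f P \<in> iso_class P" by (simp add: iso_class_def isomorphic_map)
  then have "representative (iso_class P) \<in> iso_class P" unfolding representative_def by (rule someI)
  then show ?thesis by (simp add: iso_class_def)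
qed

lemma order_of_iso_class:
  assumes "is_pregraph (underlying P)"
  shows "order_of (iso_class P) = card (cverts P)"
  using representative_iso_class[OF assms]
  by (auto simp: order_of_def isomorphic_def coloured_iso_map_iff card_image)

lemma missing_iso_class:
  assumes "is_pregraph (underlying P)"
  shows "missing (iso_class P) = card (deficient P)"
proof -
  obtain f where f: "inj_on f (cverts P)" "representative (iso_class P) = map_coloured f P"
    using representative_iso_class[OF assms] by (auto simp: isomorphic_def coloured_iso_map_iff)
  have "inj_on f (deficient P)" using f(1) by (auto simp: deficient_def inj_on_def)
  then show ?thesis using deficient_map[OF assms f(1)] f(2) by (simp add: missing_def card_image)
qed

lemma block_of_type_iso_class:
  assumes P: "partial_marked P"
  shows "block_of_type t (iso_class P) \<longleftrightarrow> block_set P t (cverts P)"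
proof -
  note pre = partial_markedD(1)[OF P]
  obtain f where f: "inj_on f (cverts P)" "representative (iso_class P) = map_coloured f P"
    using representative_iso_class[OF pre] by (auto simp: isomorphic_def coloured_iso_map_iff)
  obtain g where g: "inj_on g (cverts (map_coloured f P))" "map_coloured g (map_coloured f P) = P"
    using map_coloured_inverse[OF pre f(1)] by blast
  show ?thesis
    using block_set_map[OF P f(1), of t "cverts P"] g(2)
      block_set_map[OF partial_marked_map[OF P f(1)] g(1), of t "f ` cverts P"]
    by (auto simp: block_of_type_def f(2)) (metis map_coloured_simps(1))
qed

section \<open>Adding connections\<close>

lemma add_connections_simps [simp]:
  "cverts (add_connections P M) = cverts P" "edges0 (add_connections P M) = edges0 P"
  "edges1 (add_connections P M) = edges1 P + mset_set M"
  by (simp_all add: add_connections_def)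

lemma colour0_add [simp]: "colour0 (add_connections P M) = colour0 P"
  by (simp add: colour0_def)

lemma add_connections_empty [simp]: "add_connections P {} = P"
  by (simp add: add_connections_def)

lemma deficient_subset: "deficient P \<subseteq> cverts P"
  by (auto simp: deficient_def)

lemma connectionsD:
  assumes "connections P M" "c \<in> M"
  shows "set_mset c \<subseteq> deficient P" "set_mset c \<subseteq> cverts P" "c \<noteq> {#}" "size c = 2"
proof -
  obtain u v where "c = {#u, v#}" "u \<noteq> v" "u \<in> deficient P" "v \<in> deficient P"
    using assms unfolding connections_def by blast
  then show "set_mset c \<subseteq> deficient P" "set_mset c \<subseteq> cverts P" "c \<noteq> {#}" "size c = 2"
    using deficient_subset[of P] by auto
qed

lemma connections_disjoint:
  "connections P M \<Longrightarrow> c \<in> M \<Longrightarrow> d \<in> M \<Longrightarrow> c \<noteq> d \<Longrightarrow> set_mset c \<inter> set_mset d = {}"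
  unfolding connections_def by blast

lemma connections_count: "connections P M \<Longrightarrow> c \<in> M \<Longrightarrow> v \<in># c \<Longrightarrow> count c v = 1"
  unfolding connections_def by fastforce

lemma connectionsI:
  assumes "\<And>c. c \<in> M \<Longrightarrow> \<exists>u v. c = {#u, v#} \<and> u \<noteq> v \<and> u \<in> deficient P \<and> v \<in> deficient P"
    "\<And>c d. c \<in> M \<Longrightarrow> d \<in> M \<Longrightarrow> c \<noteq> d \<Longrightarrow> set_mset c \<inter> set_mset d = {}"
  shows "connections P M"
  using assms unfolding connections_def by blast

lemma connections_pair:
  "connections P M \<Longrightarrow> c \<in> M \<Longrightarrow> \<exists>u v. c = {#u, v#} \<and> u \<noteq> v \<and> u \<in> deficient P \<and> v \<in> deficient P"
  unfolding connections_def by blast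

lemma finite_pairs: "finite V \<Longrightarrow> finite {c. size c = 2 \<and> set_mset c \<subseteq> V}"
  using finite_multisets_of_size[of V 2] by (simp add: multisets_of_size_def conj_commute)

lemma connections_pairs: "connections P M \<Longrightarrow> M \<subseteq> {c. size c = 2 \<and> set_mset c \<subseteq> cverts P}"
  by (rule subsetI) (simp add: connectionsD(2,4))

lemma connections_finite: "finite (cverts P) \<Longrightarrow> connections P M \<Longrightarrow> finite M"
  by (rule finite_subset[OF connections_pairs finite_pairs])

lemma finite_connections: "finite (cverts P) \<Longrightarrow> finite {M. connections P M}"
  by (rule finite_subset[of _ "Pow {c. size c = 2 \<and> set_mset c \<subseteq> cverts P}"])
    (auto dest!: connections_pairs simp: finite_pairs)

lemma matching_count:
  assumes "connections P M" "finite M"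
  shows "(\<Sum>c \<in> M. count c v) = (if v \<in> \<Union> (set_mset ` M) then 1 else 0)"
proof (cases "v \<in> \<Union> (set_mset ` M)")
  case True
  then obtain c where c: "c \<in> M" "v \<in># c" by auto
  have "count d v = 0" if "d \<in> M - {c}" for d
    using connections_disjoint[OF assms(1) c(1), of d] c that by (auto simp: disjoint_iff not_in_iff)
  then have "(\<Sum>d \<in> M. count d v) = count c v"
    using sum.remove[OF assms(2) c(1), of "\<lambda>d. count d v"] by (simp add: sum.neutral)
  moreover have "count c v = 1" by (rule connections_count[OF assms(1) c])
  ultimately show ?thesis using True by simp
next
  case False
  then show ?thesis by (auto simp: not_in_iff intro!: sum.neutral)
qed

lemma degree_add:
  assumes "connections P M" "finite M"
  shows "degree (underlying (add_connections P M)) v =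
    degree (underlying P) v + (if v \<in> \<Union> (set_mset ` M) then 1 else 0)"
  using matching_count[OF assms, of v] by (simp add: degree_def sum_unfold_sum_mset)

lemma deficient_add:
  assumes "connections P M" "finite M"
  shows "deficient (add_connections P M) = deficient P - \<Union> (set_mset ` M)"
proof -
  have "degree (underlying P) v = 2" if "v \<in> \<Union> (set_mset ` M)" for v
    using that connectionsD(1)[OF assms(1)] by (auto simp: deficient_def)
  then show ?thesis using degree_add[OF assms] by (auto simp: deficient_def split: if_splits)
qed

lemma connections_split:
  assumes M: "connections P M" and fin: "finite (cverts P)" and N: "N \<subseteq> M"
  shows "connections P N" "connections (add_connections P N) (M - N)"
    "add_connections (add_connections P N) (M - N) = add_connections P M"
proof -
  note finM = connections_finite[OF fin M]
  show PN: "connections P N"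
    by (rule connectionsI) (use connections_pair[OF M] connections_disjoint[OF M] N in blast)+
  have def: "deficient (add_connections P N) = deficient P - \<Union> (set_mset ` N)"
    using deficient_add[OF PN] finite_subset[OF N finM] by simp
  have sep: "set_mset c \<inter> \<Union> (set_mset ` N) = {}" if "c \<in> M - N" for c
    using connections_disjoint[OF M, of c] that N by blast
  show "connections (add_connections P N) (M - N)"
  proof (rule connectionsI)
    fix c assume c: "c \<in> M - N"
    then obtain u v where uv: "c = {#u, v#}" "u \<noteq> v" "u \<in> deficient P" "v \<in> deficient P"
      using connections_pair[OF M] by blast
    then have "u \<in> deficient (add_connections P N)" "v \<in> deficient (add_connections P N)"
      using sep[OF c] def by auto
    then show "\<exists>u v. c = {#u, v#} \<and> u \<noteq> v \<and> u \<in> deficient (add_connections P N) \<and> v \<in> deficient (add_connections P N)"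
      using uv by blast
  qed (use connections_disjoint[OF M] in blast)
  have "mset_set M = mset_set N + mset_set (M - N)"
    using mset_set_Union[of N "M - N"] N finM by (simp add: finite_subset Un_absorb1)
  then show "add_connections (add_connections P N) (M - N) = add_connections P M"
    by (simp add: add_connections_def add.assoc)
qed

lemma connections_Un:
  assumes M: "connections P M" and fin: "finite (cverts P)" and N: "connections (add_connections P M) N"
  shows "connections P (M \<union> N)" "M \<inter> N = {}"
    "add_connections P (M \<union> N) = add_connections (add_connections P M) N"
    "\<And>c. c \<in> N \<Longrightarrow> set_mset c \<inter> \<Union> (set_mset ` M) = {}"
proof -
  note finM = connections_finite[OF fin M]
  have finN: "finite N" using connections_finite[OF _ N] fin by simp
  have def: "deficient (add_connections P M) = deficient P - \<Union> (set_mset ` M)"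
    by (rule deficient_add[OF M finM])
  show dj: "set_mset c \<inter> \<Union> (set_mset ` M) = {}" if "c \<in> N" for c
    using connectionsD(1)[OF N that] def by auto
  then show disj: "M \<inter> N = {}" using connectionsD(3)[OF M] by fastforce
  show "connections P (M \<union> N)"
  proof (rule connectionsI)
    fix c assume "c \<in> M \<union> N"
    then show "\<exists>u v. c = {#u, v#} \<and> u \<noteq> v \<and> u \<in> deficient P \<and> v \<in> deficient P"
      using connections_pair[OF M, of c] connections_pair[OF N, of c] def by blast
  next
    fix c d assume "c \<in> M \<union> N" "d \<in> M \<union> N" "c \<noteq> d"
    then show "set_mset c \<inter> set_mset d = {}"
      using connections_disjoint[OF M, of c d] connections_disjoint[OF N, of c d] dj[of c] dj[of d] by blast
  qed
  show "add_connections P (M \<union> N) = add_connections (add_connections P M) N"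
    using mset_set_Union[OF finM finN disj] by (simp add: add_connections_def add.assoc)
qed

lemma partial_marked_add:
  assumes P: "partial_marked P" and M: "connections P M"
  shows "partial_marked (add_connections P M)"
proof -
  note finM = connections_finite[OF partial_markedD(3)[OF P] M]
  have pre: "is_pregraph (underlying (add_connections P M))"
    using partial_markedD(1)[OF P] connectionsD(2,4)[OF M] finM by (auto simp: is_pregraph_def)
  have "degree (underlying (add_connections P M)) v \<in> {2, 3}" if "v \<in> cverts P" for v
  proof -
    have "v \<in> \<Union> (set_mset ` M) \<Longrightarrow> degree (underlying P) v = 2"
      using connectionsD(1)[OF M] by (auto simp: deficient_def)
    then show ?thesis using degree_add[OF M finM, of v] partial_markedD(7)[OF P that]
      by (cases "v \<in> \<Union> (set_mset ` M)") simp_all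
  qed
  then show ?thesis
    using P pre unfolding partial_marked_def C4q_factor_def colour0_add by (auto simp: subgraph_def)
qed

lemma map_add_connections:
  assumes "inj_on f (cverts P)" "connections P M"
  shows "map_coloured f (add_connections P M) = add_connections (map_coloured f P) (image_mset f ` M)"
proof -
  have "inj_on (image_mset f) M"
    using image_mset_inj_on_eq[OF assms(1)] connectionsD(2)[OF assms(2)] by (intro inj_onI) blast
  then show ?thesis by (simp add: map_coloured_def add_connections_def image_mset_mset_set)
qed

lemma connections_map:
  assumes "is_pregraph (underlying P)" "inj_on f (cverts P)" "connections P M"
  shows "connections (map_coloured f P) (image_mset f ` M)"
proof (rule connectionsI)
  fix c assume "c \<in> image_mset f ` M"
  then obtain d where d: "d \<in> M" "c = image_mset f d" by blast
  then obtain u v where uv: "d = {#u, v#}" "u \<noteq> v" "u \<in> deficient P" "v \<in> deficient P"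
    using connections_pair[OF assms(3)] by blast
  then have "f u \<noteq> f v" using assms(2) deficient_subset[of P] by (auto dest: inj_onD)
  then show "\<exists>u v. c = {#u, v#} \<and> u \<noteq> v \<and> u \<in> deficient (map_coloured f P) \<and> v \<in> deficient (map_coloured f P)"
    using d uv deficient_map[OF assms(1,2)] by auto
next
  fix c d assume cd: "c \<in> image_mset f ` M" "d \<in> image_mset f ` M" "c \<noteq> d"
  then obtain c' d' where *: "c' \<in> M" "d' \<in> M" "c = image_mset f c'" "d = image_mset f d'" "c' \<noteq> d'" by blast
  then have "set_mset c' \<inter> set_mset d' = {}" using connections_disjoint[OF assms(3)] by blast
  moreover have "f ` (set_mset c' \<inter> set_mset d') = f ` set_mset c' \<inter> f ` set_mset d'"
    by (rule inj_on_image_Int[OF assms(2)]) (use connectionsD(2)[OF assms(3)] * in auto)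
  ultimately show "set_mset c \<inter> set_mset d = {}" using * by simp
qed

section \<open>Extensions with the same blocks\<close>

definition extends :: "'v coloured \<Rightarrow> 'v coloured \<Rightarrow> bool" where
  "extends P G \<longleftrightarrow> partial_marked P \<and> partial_marked G \<and> cverts G = cverts P \<and>
     edges0 G = edges0 P \<and> edges1 P \<subseteq># edges1 G"

lemma extends_add:
  "partial_marked P \<Longrightarrow> connections P M \<Longrightarrow> extends P (add_connections P M)"
  by (auto simp: extends_def partial_marked_add)

lemma extends_colour0: "extends P G \<Longrightarrow> colour0 G = colour0 P"
  by (simp add: extends_def colour0_def)

lemma extends_below: "extends P G \<Longrightarrow> below P G"
proof -
  assume ext: "extends P G"
  have "marked_quotients P = marked_quotients G" by (simp add: marked_quotients_def extends_colour0[OF ext])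
  then show "below P G"
    using ext by (simp add: below_def extends_def subgraph_def partial_markedD(1) subset_mset.add_mono)
qed

lemma size_edges1_isomorphic: "isomorphic P R \<Longrightarrow> size (edges1 R) = size (edges1 P)"
  by (auto simp: isomorphic_def coloured_iso_map_def)

lemma partial_marked_block:
  "partial_marked P \<Longrightarrow> S \<in> block_partition P \<Longrightarrow> partial_marked (induced_coloured P S)"
  using block_induced by (auto simp: block_def)

text \<open>The number of edges of colour 1 inside blocks depends only on the block list.\<close>

lemma sum_block_edges:
  assumes P: "partial_marked P"
  shows "(\<Sum>S \<in> block_partition P. size (edges1 (induced_coloured P S))) =
     (\<Sum>T \<in># block_list_of P. size (edges1 (representative T)))"
proof -
  have "size (edges1 (representative (iso_class (induced_coloured P S)))) = size (edges1 (induced_coloured P S))"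
    if "S \<in> block_partition P" for S
    by (rule size_edges1_isomorphic[OF representative_iso_class[OF partial_markedD(1)[OF partial_marked_block[OF P that]]]])
  then have "(\<Sum>S \<in> block_partition P. size (edges1 (induced_coloured P S))) =
     (\<Sum>S \<in> block_partition P. size (edges1 (representative (iso_class (induced_coloured P S)))))"
    by (intro sum.cong) auto
  then show ?thesis
    unfolding block_list_of_def by (simp only: sum_unfold_sum_mset multiset.map_comp o_def)
qed

lemma size_block_list_of: "size (block_list_of P) = card (block_partition P)"
  by (simp add: block_list_of_def)

text \<open>Every block of \<open>P\<close> lies in a block of \<open>G\<close>. This map between the two partitions is onto, and by the
  equal numbers of blocks it is bijective, so that the partitions agree. The blocks of \<open>G\<close> contain at
  least the edges that they contain in \<open>P\<close>, and by \<open>sum_block_edges\<close> altogether equally many.\<close>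

lemma extends_same_blocks:
  assumes ext: "extends P G" and list: "block_list_of P = block_list_of G"
  shows "block_partition P = block_partition G"
    "\<And>S. S \<in> block_partition P \<Longrightarrow> induced_coloured P S = induced_coloured G S"
proof -
  have P: "partial_marked P" and G: "partial_marked G" and V: "cverts G = cverts P"
    using ext by (auto simp: extends_def)
  have "\<forall>S \<in> block_partition P. \<exists>S' \<in> block_partition G. S \<subseteq> S'"
    using block_set_grow[OF extends_below[OF ext]] unfolding block_partition_def by blast
  then obtain \<phi> where \<phi>: "\<And>S. S \<in> block_partition P \<Longrightarrow> \<phi> S \<in> block_partition G \<and> S \<subseteq> \<phi> S" by metis
  have meet: "\<exists>S \<in> block_partition P. v \<in> S \<and> \<phi> S = S'" if "S' \<in> block_partition G" "v \<in> S'" for S' v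
  proof -
    have "v \<in> cverts P" using that block_partition_cover[OF G] V by blast
    then obtain S where S: "S \<in> block_partition P" "v \<in> S" using block_partition_cover[OF P] by blast
    then have "\<phi> S = S'" using \<phi>[OF S(1)] block_partition_meet[OF G _ that(1)] that(2) by blast
    with S show ?thesis by blast
  qed
  have "\<phi> ` block_partition P = block_partition G"
  proof (intro equalityI subsetI)
    fix S' assume S': "S' \<in> block_partition G"
    then obtain v where "v \<in> S'" using block_partitionD(2)[OF G] by blast
    then show "S' \<in> \<phi> ` block_partition P" using meet[OF S'] by blast
  qed (use \<phi> in blast)
  moreover have "card (block_partition P) = card (block_partition G)"
    using list size_block_list_of by metis
  ultimately have inj: "inj_on \<phi> (block_partition P)"
    by (metis eq_card_imp_inj_on finite_block_partition[OF P])
  have "\<phi> S = S" if S: "S \<in> block_partition P" for S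
  proof
    show "\<phi> S \<subseteq> S"
    proof
      fix v assume "v \<in> \<phi> S"
      then obtain S2 where "S2 \<in> block_partition P" "v \<in> S2" "\<phi> S2 = \<phi> S" using meet[of "\<phi> S" v] \<phi>[OF S] by blast
      then show "v \<in> S" using inj_onD[OF inj _ _ S] by blast
    qed
  qed (use \<phi>[OF S] in blast)
  then show eq: "block_partition P = block_partition G"
    using \<open>\<phi> ` block_partition P = block_partition G\<close> by (simp cong: image_cong)
  have sub: "edges1 (induced_coloured P S) \<subseteq># edges1 (induced_coloured G S)" for S
    using ext by (simp add: extends_def multiset_filter_mono)
  have sums: "(\<Sum>S \<in> block_partition P. size (edges1 (induced_coloured P S))) =
     (\<Sum>S \<in> block_partition P. size (edges1 (induced_coloured G S)))"
    using sum_block_edges[OF P] sum_block_edges[OF G] list eq by simp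
  show "induced_coloured P S = induced_coloured G S" if S: "S \<in> block_partition P" for S
  proof -
    have "size (edges1 (induced_coloured P S)) = size (edges1 (induced_coloured G S))"
      by (rule sum_mono_inv[OF sums _ S finite_block_partition[OF P]]) (rule size_mset_mono[OF sub])
    then have "edges1 (induced_coloured P S) = edges1 (induced_coloured G S)"
      using sub[of S] mset_subset_size[of "edges1 (induced_coloured P S)" "edges1 (induced_coloured G S)"]
      by (metis nat_neq_iff subset_mset.le_less)
    then show ?thesis using ext by (intro coloured.equality) (auto simp: extends_def)
  qed
qed

text \<open>The subgraphs induced by the blocks of \<open>G\<close> agree in \<open>P\<close> and \<open>G\<close>, hence also in \<open>R\<close> between them, and
  \<open>block_set_localize\<close> applies.\<close>

lemma extends_middle:
  assumes ext: "extends P R" "extends R G"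
    and ind: "\<And>S. S \<in> block_partition G \<Longrightarrow> induced_coloured P S = induced_coloured G S"
  shows "block_partition R = block_partition G"
    "\<And>S. S \<in> block_partition G \<Longrightarrow> induced_coloured R S = induced_coloured G S"
    "block_list_of R = block_list_of G"
proof -
  have R: "partial_marked R" and G: "partial_marked G" and V: "cverts R = cverts G"
    and sub: "edges1 P \<subseteq># edges1 R" "edges1 R \<subseteq># edges1 G" "edges0 R = edges0 G"
    using ext by (auto simp: extends_def)
  show ind': "induced_coloured R S = induced_coloured G S" if "S \<in> block_partition G" for S
  proof -
    have "edges1 (induced_coloured R S) = edges1 (induced_coloured G S)"
      using ind[OF that] multiset_filter_mono[OF sub(1), of "\<lambda>e. set_mset e \<subseteq> S"]
        multiset_filter_mono[OF sub(2), of "\<lambda>e. set_mset e \<subseteq> S"]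
      by (metis induced_simps(5) subset_mset.antisym)
    then show ?thesis using V sub(3) by (intro coloured.equality) auto
  qed
  show eq: "block_partition R = block_partition G"
  proof (rule block_partition_eqI[OF R])
    show "block_partition G \<subseteq> block_partition R"
    proof
      fix S assume S: "S \<in> block_partition G"
      then obtain t where "block_set G t S" by (auto simp: block_partition_def)
      then have "block_set R t S"
      proof (rule block_set_localize[OF extends_below[OF ext(2)]])
        show "S \<subseteq> cverts R" using block_partitionD(1)[OF G S] V by simp
        show "induced (underlying R) S = induced (underlying G) S"
          using ind'[OF S] by (metis underlying_induced)
        show "Q \<in> marked_quotients R" if "Q \<in> marked_quotients G" for Q
          using that extends_colour0[OF ext(2)] by (simp add: marked_quotients_def)
      qed
      then show "S \<in> block_partition R" by (auto simp: block_partition_def)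
    qed
    show "\<Union> (block_partition G) = cverts R" using block_partition_cover[OF G] V by simp
  qed
  show "block_list_of R = block_list_of G"
    unfolding block_list_of_def eq
    using ind' finite_block_partition[OF G] by (intro image_mset_cong) simp
qed

section \<open>Completions\<close>

text \<open>The members of \<open>completions L P\<close> in terms of the result alone (\<open>completions_iff\<close>).\<close>

definition completion :: "block_list \<Rightarrow> 'v coloured \<Rightarrow> 'v multiset set \<Rightarrow> bool" where
  "completion L P M \<longleftrightarrow> connections P M \<and> marked (add_connections P M) \<and>
     block_list_of (add_connections P M) = L"

lemma connected_closed_under:
  assumes "connected_pregraph G" "closed_under G S" "S \<noteq> {}" "S \<subseteq> verts G"
  shows "S = verts G"
proof -
  obtain s where s: "s \<in> S" using assms(3) by blast
  have "v \<in> S" if "v \<in> verts G" for v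
    using closed_underD(1)[OF assms(2) _ s] assms(1,4) s that by (auto simp: connected_pregraph_def)
  then show ?thesis using assms(4) by blast
qed

text \<open>A component of \<open>P\<close> with \<open>N\<close> added that has no deficient vertices receives no further connection, so
  it is also a component of the completed pregraph, which is connected.\<close>

lemma valid_subset_completion:
  assumes P: "P \<in> \<B> L" and M: "completion L P M" and N: "N \<subseteq> M"
  shows "valid L P N"
proof -
  have PM: "partial_marked P" and LP: "block_list_of P = L" using P by (auto simp: \<B>_def)
  note fin = partial_markedD(3)[OF PM]
  have conn: "connections P M" and G: "marked (add_connections P M)" "block_list_of (add_connections P M) = L"
    using M by (auto simp: completion_def)
  note split = connections_split[OF conn fin N]
  note R = partial_marked_add[OF PM split(1)]
  have ext: "extends P (add_connections P N)" "extends (add_connections P N) (add_connections P M)"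
    using extends_add[OF PM split(1)] extends_add[OF R split(2)] split(3) by auto
  have extM: "extends P (add_connections P M)" using extends_add[OF PM conn] .
  note same = extends_same_blocks[OF extM]
  have "block_list_of (add_connections P N) = L"
    using extends_middle(3)[OF ext] same LP G(2) by auto
  moreover have "verts C = cverts P" if C: "C \<in> components (underlying (add_connections P N))"
    and no: "verts C \<inter> deficient (add_connections P N) = {}" for C
  proof -
    have pre: "is_pregraph (underlying (add_connections P N))" using R by (rule partial_markedD)
    have "closed_under (underlying (add_connections P M)) (verts C)"
      unfolding closed_under_def
    proof (intro allI impI, elim conjE)
      fix u v assume u: "u \<in> verts C" and uv: "(u, v) \<in> adjacency (underlying (add_connections P M))"
      have "edges (underlying (add_connections P M)) = edges (underlying (add_connections P N)) + mset_set (M - N)"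
        using split(3)[symmetric] by simp
      then have "{#u, v#} \<in># edges (underlying (add_connections P N)) \<or> {#u, v#} \<in># mset_set (M - N)"
        using uv unfolding adjacency_def by auto
      moreover have "{#u, v#} \<notin># mset_set (M - N)"
      proof
        assume "{#u, v#} \<in># mset_set (M - N)"
        then have "{#u, v#} \<in> M - N" using connections_finite[OF fin conn] by simp
        then have "u \<in> deficient (add_connections P N)" using connectionsD(1)[OF split(2)] by fastforce
        then show False using u no by blast
      qed
      ultimately have "(u, v) \<in> adjacency (underlying (add_connections P N))" by (simp add: adjacency_def)
      then show "v \<in> verts C" using component_closed[OF pre C] u unfolding closed_under_def by blast
    qed
    then have "verts C = verts (underlying (add_connections P M))"
      using G(1) component_nonempty[OF C] component_subset(1)[OF C]
      by (intro connected_closed_under) (auto simp: marked_iff)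
    then show ?thesis by simp
  qed
  ultimately show ?thesis using split(1) R by (auto simp: valid_def \<B>_def)
qed

lemma valid_closed_marked:
  assumes val: "valid L P M" and def: "deficient (add_connections P M) = {}" and ne: "cverts P \<noteq> {}"
  shows "completion L P M"
proof -
  have R: "partial_marked (add_connections P M)" and L: "block_list_of (add_connections P M) = L"
    and conn: "connections P M" using val by (auto simp: valid_def \<B>_def)
  have pre: "is_pregraph (underlying (add_connections P M))" using R by (rule partial_markedD)
  obtain v where v: "v \<in> verts (underlying (add_connections P M))" using ne by auto
  obtain C where C: "C \<in> components (underlying (add_connections P M))" using component_ex[OF v] by blast
  then have V: "verts C = cverts P" using val def by (auto simp: valid_def)
  have "connected_pregraph (underlying (add_connections P M))"
    by (rule connected_mono[OF component_connected[OF pre C]]) (use V component_subset(2)[OF C] in auto)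
  then show ?thesis using R L conn def by (simp add: completion_def marked_iff)
qed

lemma completions_iff:
  assumes "P \<in> \<B> L" "cverts P \<noteq> {}"
  shows "M \<in> completions L P \<longleftrightarrow> completion L P M"
  using valid_subset_completion[OF assms(1) _ subset_refl] valid_closed_marked[OF _ _ assms(2)]
  by (auto simp: completions_def completion_def marked_iff)

lemma finite_completions: "finite (cverts P) \<Longrightarrow> finite (completions L P)"
  by (rule finite_subset[OF _ finite_connections]) (auto simp: completions_def valid_def)

lemma finite_orbit_extensions:
  assumes "finite (cverts P)"
  shows "finite (orbit_extensions L P Ob)"
proof -
  have "orbit_extensions L P Ob \<subseteq> add_connections P ` {M. connections P M}"
    by (auto simp: orbit_extensions_def valid_def)
  then show ?thesis using finite_connections[OF assms] by (metis finite_imageI finite_subset)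
qed

lemma completion_Un:
  assumes "finite (cverts P)" "connections P M" "completion L (add_connections P M) N"
  shows "completion L P (M \<union> N)"
  using assms connections_Un[OF assms(2,1)] by (simp add: completion_def)

lemma completion_map:
  assumes P: "is_pregraph (underlying P)" and f: "inj_on f (cverts P)" and M: "completion L P M"
  shows "completion L (map_coloured f P) (image_mset f ` M)"
proof -
  have conn: "connections P M" and G: "marked (add_connections P M)" using M by (auto simp: completion_def)
  have f': "inj_on f (cverts (add_connections P M))" using f by simp
  show ?thesis
    using connections_map[OF P f conn] marked_map[OF G f'] block_list_of_map[OF marked_imp_partial[OF G] f'] M
    by (simp add: completion_def map_add_connections[OF f conn])
qed

section \<open>Orbits of deficient vertices\<close>

text \<open>Members of \<open>Aut\<close> fix all values that are not vertices, whereas isomorphisms are arbitrary there.\<close>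

definition restrict_perm :: "'v set \<Rightarrow> ('v \<Rightarrow> 'v) \<Rightarrow> 'v \<Rightarrow> 'v" where
  "restrict_perm V f v = (if v \<in> V then f v else v)"

lemma AutI:
  assumes "is_pregraph (underlying P)" "coloured_iso_map f P P"
  shows "restrict_perm (cverts P) f \<in> Aut P"
proof -
  let ?f = "restrict_perm (cverts P) f"
  have f: "inj_on f (cverts P)" "P = map_coloured f P" using assms(2) by (auto simp: coloured_iso_map_iff)
  have "f ` cverts P = cverts P" using f(2) by (metis map_coloured_simps(1))
  then have "bij_betw ?f (cverts P) (cverts P)"
    using f(1) by (auto simp: bij_betw_def inj_on_def restrict_perm_def)
  then have "?f permutes cverts P"
    by (rule bij_imp_permutes) (simp add: restrict_perm_def)
  moreover have "map_coloured ?f P = P"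
    using map_coloured_cong[OF assms(1), of ?f f] f(2) by (simp add: restrict_perm_def)
  moreover have "inj_on ?f (cverts P)" using f(1) by (auto simp: inj_on_def restrict_perm_def)
  ultimately show ?thesis by (simp add: Aut_def coloured_iso_map_iff)
qed

lemma AutD:
  assumes "f \<in> Aut P"
  shows "f permutes cverts P" "inj f" "map_coloured f P = P"
  using assms by (auto simp: Aut_def coloured_iso_map_iff permutes_inj)

lemma Aut_id: "(\<lambda>v. v) \<in> Aut P"
  by (auto simp: Aut_def coloured_iso_map_iff map_coloured_id permutes_def)

lemma Aut_iff: "f \<in> Aut P \<longleftrightarrow> f permutes cverts P \<and> map_coloured f P = P"
  by (auto simp: Aut_def coloured_iso_map_iff intro: inj_on_subset[OF permutes_inj])

lemma Aut_comp: "f \<in> Aut P \<Longrightarrow> g \<in> Aut P \<Longrightarrow> g \<circ> f \<in> Aut P"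
  by (simp add: Aut_iff permutes_compose map_coloured_comp[symmetric])

lemma Aut_deficient:
  assumes "is_pregraph (underlying P)" "f \<in> Aut P" "v \<in> deficient P"
  shows "f v \<in> deficient P"
  using deficient_map[OF assms(1), of f] AutD[OF assms(2)] assms(3) by (auto simp: inj_on_def)

lemma orbitD:
  assumes P: "is_pregraph (underlying P)" and Ob: "Ob \<in> deficient_orbits P"
  shows "Ob \<subseteq> deficient P" "Ob \<noteq> {}" "h \<in> Aut P \<Longrightarrow> h ` Ob = Ob"
proof -
  obtain v where v: "v \<in> deficient P" "Ob = (\<lambda>f. f v) ` Aut P"
    using Ob by (auto simp: deficient_orbits_def)
  show sub: "Ob \<subseteq> deficient P" using v Aut_deficient[OF P] by auto
  show "Ob \<noteq> {}" using v(2) Aut_id by auto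
  show "h ` Ob = Ob" if h: "h \<in> Aut P" for h
  proof (rule endo_inj_surj)
    show "finite Ob" using sub deficient_subset[of P] is_pregraphD(1)[OF P] by (metis finite_subset underlying_simps(1))
    show "h ` Ob \<subseteq> Ob"
    proof (rule image_subsetI)
      fix x assume "x \<in> Ob"
      then obtain f where f: "f \<in> Aut P" "x = f v" using v(2) by auto
      have "(h \<circ> f) v \<in> (\<lambda>f. f v) ` Aut P"
        using Aut_comp[OF f(1) h] by (rule imageI[of _ _ "\<lambda>f. f v"])
      then show "h x \<in> Ob" using v(2) f(2) by simp
    qed
    show "inj_on h Ob" using AutD(2)[OF h] by (auto simp: inj_on_def)
  qed
qed

lemma iso_orbit:
  assumes P: "is_pregraph (underlying P)" and Ob: "Ob \<in> deficient_orbits P" and f: "coloured_iso_map f P P"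
  shows "f ` Ob = Ob"
proof -
  have "Ob \<subseteq> cverts P" using orbitD(1)[OF P Ob] deficient_subset[of P] by blast
  then have "f ` Ob = restrict_perm (cverts P) f ` Ob"
    by (intro image_cong) (auto simp: restrict_perm_def)
  then show ?thesis using orbitD(3)[OF P Ob AutI[OF P f]] by simp
qed

lemma smallest_orbit_ex:
  assumes "finite (cverts P)" "deficient P \<noteq> {}"
  shows "\<exists>Ob. smallest_orbit P Ob"
proof -
  obtain v where "v \<in> deficient P" using assms(2) by blast
  then have "(\<lambda>f. f v) ` Aut P \<in> deficient_orbits P" by (auto simp: deficient_orbits_def)
  then show ?thesis
    using exists_least_iff[of "\<lambda>n. \<exists>Ob \<in> deficient_orbits P. card Ob = n"]
    unfolding smallest_orbit_def by (metis not_le)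
qed

section \<open>Rigid partial pregraphs\<close>

text \<open>Every completed pregraph of \<open>P\<close> determines which of its edges belong to \<open>P\<close>.\<close>

definition rigid :: "block_list \<Rightarrow> 'v coloured \<Rightarrow> bool" where
  "rigid L P \<longleftrightarrow> (\<forall>M N f. completion L P M \<and> completion L P N \<and>
     coloured_iso_map f (add_connections P M) (add_connections P N) \<longrightarrow> coloured_iso_map f P P)"

definition touching :: "'v set \<Rightarrow> 'v multiset set \<Rightarrow> 'v multiset set" where
  "touching X M = {c \<in> M. set_mset c \<inter> X \<noteq> {}}"

lemma touching_image:
  assumes "inj_on f V" "X \<subseteq> V" "\<And>c. c \<in> M \<Longrightarrow> set_mset c \<subseteq> V"
  shows "image_mset f ` touching X M = touching (f ` X) (image_mset f ` M)"
proof -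
  have "f ` set_mset c \<inter> f ` X = {} \<longleftrightarrow> set_mset c \<inter> X = {}" if "c \<in> M" for c
    using inj_on_image_Int[OF assms(1) assms(3)[OF that] assms(2)] by (metis image_is_empty)
  then have iff: "set_mset (image_mset f c) \<inter> f ` X \<noteq> {} \<longleftrightarrow> set_mset c \<inter> X \<noteq> {}" if "c \<in> M" for c
    using that by simp
  show ?thesis unfolding touching_def
  proof (intro equalityI subsetI)
    fix d assume "d \<in> image_mset f ` {c \<in> M. set_mset c \<inter> X \<noteq> {}}"
    then obtain c where "c \<in> M" "set_mset c \<inter> X \<noteq> {}" "d = image_mset f c" by blast
    then show "d \<in> {c \<in> image_mset f ` M. set_mset c \<inter> f ` X \<noteq> {}}" using iff[of c] by blast
  next
    fix d assume "d \<in> {c \<in> image_mset f ` M. set_mset c \<inter> f ` X \<noteq> {}}"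
    then obtain c where "c \<in> M" "set_mset d \<inter> f ` X \<noteq> {}" "d = image_mset f c" by blast
    then show "d \<in> image_mset f ` {c \<in> M. set_mset c \<inter> X \<noteq> {}}" using iff[of c] by blast
  qed
qed

lemma iso_connections:
  assumes P: "is_pregraph (underlying P)" and M: "connections P M" and N: "connections P N"
    and f: "coloured_iso_map f P P" "coloured_iso_map f (add_connections P M) (add_connections P N)"
  shows "image_mset f ` M = N"
proof -
  have fin: "finite (cverts P)" using is_pregraphD(1)[OF P] by simp
  have inj: "inj_on f (cverts P)" and fP: "map_coloured f P = P" using f(1) by (auto simp: coloured_iso_map_iff)
  have "add_connections P N = add_connections P (image_mset f ` M)"
    using f(2) map_add_connections[OF inj M] fP by (simp add: coloured_iso_map_iff)
  then have "mset_set N = mset_set (image_mset f ` M)"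
    by (metis add_connections_simps(3) add_left_cancel)
  then show ?thesis
    using connections_finite[OF fin M] connections_finite[OF fin N]
    by (metis finite_imageI finite_set_mset_mset_set)
qed

text \<open>After adding \<open>M\<close> the vertices of \<open>Ob\<close> are saturated, so that no later connection meets \<open>Ob\<close>.\<close>

lemma orbit_extension_touching:
  assumes fin: "finite (cverts P)" and M: "connections P M"
    and cover: "Ob \<subseteq> \<Union> (set_mset ` M)" and meets: "\<forall>c \<in> M. set_mset c \<inter> Ob \<noteq> {}"
    and N: "connections (add_connections P M) N"
  shows "touching Ob (M \<union> N) = M"
  using connections_Un(4)[OF M fin N] cover meets by (fastforce simp: touching_def)

text \<open>An isomorphism between two completed pregraphs of the extension is an automorphism of \<open>P\<close>. It maps
  the orbit \<open>Ob\<close> to itself, and \<open>M\<close> is the set of the connections that meet \<open>Ob\<close> in both of them.\<close>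

lemma rigid_orbit_extension:
  assumes P: "P \<in> \<B> L" and rig: "rigid L P" and Ob: "smallest_orbit P Ob" and M: "connections P M"
    and cover: "Ob \<subseteq> \<Union> (set_mset ` M)" and meets: "\<forall>c \<in> M. set_mset c \<inter> Ob \<noteq> {}"
  shows "rigid L (add_connections P M)"
  unfolding rigid_def
proof (intro allI impI, elim conjE)
  fix N N' f
  assume N: "completion L (add_connections P M) N" and N': "completion L (add_connections P M) N'"
    and f: "coloured_iso_map f (add_connections (add_connections P M) N) (add_connections (add_connections P M) N')"
  have pm: "partial_marked P" using P by (simp add: \<B>_def)
  note pre = partial_markedD(1)[OF pm] and fin = partial_markedD(3)[OF pm]
  have cN: "connections (add_connections P M) N" "connections (add_connections P M) N'"
    using N N' by (auto simp: completion_def)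
  note U = connections_Un[OF M fin cN(1)] and U' = connections_Un[OF M fin cN(2)]
  have f': "coloured_iso_map f (add_connections P (M \<union> N)) (add_connections P (M \<union> N'))"
    using f U(3) U'(3) by simp
  then have fP: "coloured_iso_map f P P"
    using rig completion_Un[OF fin M N] completion_Un[OF fin M N'] unfolding rigid_def by blast
  then have inj: "inj_on f (cverts P)" and map: "map_coloured f P = P" by (auto simp: coloured_iso_map_iff)
  have orb: "Ob \<in> deficient_orbits P" using Ob by (simp add: smallest_orbit_def)
  have "Ob \<subseteq> cverts P" using orbitD(1)[OF pre orb] deficient_subset[of P] by blast
  then have "image_mset f ` touching Ob (M \<union> N) = touching (f ` Ob) (image_mset f ` (M \<union> N))"
    by (intro touching_image[OF inj]) (use connectionsD(2)[OF U(1)] in auto)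
  then have "image_mset f ` M = M"
    using orbit_extension_touching[OF fin M cover meets] cN iso_orbit[OF pre orb fP]
      iso_connections[OF pre U(1) U'(1) fP f'] by simp
  then show "coloured_iso_map f (add_connections P M) (add_connections P M)"
    using inj map map_add_connections[OF inj M] by (simp add: coloured_iso_map_iff)
qed

section \<open>The outputs of a run\<close>

lemma set_mset_sum: "finite K \<Longrightarrow> set_mset (\<Sum>R \<in> K. out R) = (\<Union>R \<in> K. set_mset (out R))"
  by (induction K rule: finite_induct) auto

lemma size_filter_sum:
  "finite K \<Longrightarrow> size (filter_mset p (\<Sum>R \<in> K. out R)) = (\<Sum>R \<in> K. size (filter_mset p (out R)))"
  by (induction K rule: finite_induct) auto

lemma orbit_extensionsE:
  assumes "R \<in> orbit_extensions L P Ob"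
  obtains M where "R = add_connections P M" "valid L P M" "connections P M" "R \<in> \<B> L"
    "Ob \<subseteq> \<Union> (set_mset ` M)" "\<forall>c \<in> M. set_mset c \<inter> Ob \<noteq> {}"
  using assms unfolding orbit_extensions_def valid_def by blast

lemma run_sound:
  assumes "run L P out" "finite (cverts P)" "cverts P \<noteq> {}" "deficient P = {} \<Longrightarrow> completion L P {}" "R \<in># out"
  shows "\<exists>M. completion L P M \<and> R = add_connections P M"
  using assms
proof (induction arbitrary: R rule: run.induct)
  case (complete P)
  then have "completion L P {} \<and> R = add_connections P {}" by simp
  then show ?case by blast
next
  case (trivial P)
  then obtain M where "M \<in> completions L P" "R = add_connections P M"
    using finite_completions[of P L] by auto
  then show ?case using valid_closed_marked[of L P M] trivial.prems by (auto simp: completions_def)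
next
  case (branch P Ob K out)
  have K: "K \<subseteq> orbit_extensions L P Ob" using branch by (simp add: transversal_def)
  then have finK: "finite K" using finite_orbit_extensions branch.prems(1) finite_subset by blast
  then obtain Q where Q: "Q \<in> K" "R \<in># out Q" using branch.prems(4) set_mset_sum[OF finK, of out] by auto
  then have "Q \<in> orbit_extensions L P Ob" using K by blast
  then obtain M where M: "Q = add_connections P M" "valid L P M" "connections P M" by (rule orbit_extensionsE)
  have endQ: "completion L Q {}" if "deficient Q = {}"
    using valid_closed_marked[OF M(2)] that branch.prems(2) M(1) by (auto simp: completion_def connections_def)
  have "finite (cverts Q)" "cverts Q \<noteq> {}" using branch.prems(1,2) M(1) by simp_all
  then obtain N where N: "completion L Q N" "R = add_connections Q N"
    using branch.IH Q endQ by blast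
  have "connections Q N" using N(1) by (simp add: completion_def)
  then show ?case
    using completion_Un[OF branch.prems(1) M(3)] connections_Un(3)[OF M(3) branch.prems(1)] N M(1) by metis
qed

text \<open>In a branching step, let \<open>M1\<close> be the part of \<open>M\<close> that meets the orbit. The extension by \<open>M1\<close> is
  represented in \<open>K\<close>, and along this isomorphism \<open>M\<close> becomes a completion of the representative, to
  which the induction hypothesis applies. An isomorphic output below another member of \<open>K\<close> would, by
  rigidity, make this member isomorphic to the extension by \<open>M1\<close> too.\<close>

lemma run_exact:
  assumes "run L P out" "P \<in> \<B> L" "cverts P \<noteq> {}" "rigid L P" "deficient P = {} \<Longrightarrow> completion L P {}"
    "completion L P M"
  shows "size {#R \<in># out. isomorphic (add_connections P M) R#} = 1"
  using assms
proof (induction arbitrary: M rule: run.induct)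
  case (complete P)
  have "M = {}"
  proof (rule ccontr)
    assume "M \<noteq> {}"
    then obtain c where "c \<in> M" by blast
    moreover have "connections P M" using complete.prems by (simp add: completion_def)
    ultimately show False using connectionsD(1,3)[of P M c] complete.hyps by auto
  qed
  then show ?case by (simp add: isomorphic_refl)
next
  case (trivial P)
  have pm: "partial_marked P" using trivial.prems by (simp add: \<B>_def)
  note pre = partial_markedD(1)[OF pm] and fin = partial_markedD(3)[OF pm]
  have "N = M" if N: "N \<in> completions L P" and iso: "isomorphic (add_connections P M) (add_connections P N)" for N
  proof -
    have cN: "completion L P N" using completions_iff[OF trivial.prems(1,2)] N by simp
    obtain f where f: "coloured_iso_map f (add_connections P M) (add_connections P N)"
      using iso by (auto simp: isomorphic_def)
    then have fP: "coloured_iso_map f P P" using trivial.prems(3,5) cN unfolding rigid_def by blast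
    have fixed: "f v = v" if "v \<in> deficient P" for v
    proof -
      have "restrict_perm (cverts P) f v = v"
        using trivial.hyps(2) AutI[OF pre fP] that unfolding acts_trivially_def by blast
      then show ?thesis using that deficient_subset[of P] by (auto simp: restrict_perm_def)
    qed
    have conn: "connections P M" "connections P N" using trivial.prems(5) cN by (auto simp: completion_def)
    have "image_mset f c = image_mset (\<lambda>v. v) c" if "c \<in> M" for c
      using connectionsD(1)[OF conn(1) that] fixed by (intro image_mset_cong) auto
    then have "image_mset f ` M = M" by simp
    then show "N = M" using iso_connections[OF pre conn fP f] by simp
  qed
  then have "{N \<in> completions L P. isomorphic (add_connections P M) (add_connections P N)} = {M}"
    using completions_iff[OF trivial.prems(1,2)] trivial.prems(5) isomorphic_refl by blast
  then show ?case
    using finite_completions[OF fin, of L] by (simp add: filter_mset_image_mset o_def)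
next
  case (branch P Ob K out)
  have pm: "partial_marked P" using branch.prems by (simp add: \<B>_def)
  note pre = partial_markedD(1)[OF pm] and fin = partial_markedD(3)[OF pm]
  let ?G = "add_connections P M" and ?M1 = "touching Ob M"
  have K: "K \<subseteq> orbit_extensions L P Ob" using branch by (simp add: transversal_def)
  then have finK: "finite K" using finite_orbit_extensions[OF fin] finite_subset by blast
  have orb: "Ob \<in> deficient_orbits P" using branch.hyps by (simp add: smallest_orbit_def)
  have ObV: "Ob \<subseteq> cverts P" using orbitD(1)[OF pre orb] deficient_subset[of P] by blast
  have connM: "connections P M" and G: "marked ?G" "block_list_of ?G = L"
    using branch.prems(5) by (auto simp: completion_def)
  note finM = connections_finite[OF fin connM]
  have M1: "?M1 \<subseteq> M" by (auto simp: touching_def)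
  note split = connections_split[OF connM fin M1]
  have val: "valid L P ?M1" by (rule valid_subset_completion[OF branch.prems(1,5) M1])
  have "deficient P \<subseteq> \<Union> (set_mset ` M)"
    using deficient_add[OF connM finM] G(1) by (auto simp: marked_iff)
  then have ObM: "Ob \<subseteq> \<Union> (set_mset ` M)" using orbitD(1)[OF pre orb] by blast
  have cover: "Ob \<subseteq> \<Union> (set_mset ` ?M1)"
  proof
    fix x assume x: "x \<in> Ob"
    then obtain c where "c \<in> M" "x \<in># c" using ObM by blast
    then show "x \<in> \<Union> (set_mset ` ?M1)" using x by (auto simp: touching_def)
  qed
  have meets: "\<forall>c \<in> ?M1. set_mset c \<inter> Ob \<noteq> {}" by (simp add: touching_def)
  define Rs where "Rs = add_connections P ?M1"
  have Rs: "Rs \<in> orbit_extensions L P Ob"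
    unfolding orbit_extensions_def Rs_def using val cover meets by blast
  have preRs: "is_pregraph (underlying Rs)"
    using val partial_markedD(1) by (auto simp: valid_def \<B>_def Rs_def)
  obtain R0 where R0: "R0 \<in> K" "isomorphic Rs R0" "\<And>R. R \<in> K \<Longrightarrow> isomorphic Rs R \<Longrightarrow> R = R0"
    using branch.hyps(4) Rs unfolding transversal_def by metis
  have one: "size {#R \<in># out R0. isomorphic ?G R#} = 1"
  proof -
    have "R0 \<in> orbit_extensions L P Ob" using R0(1) K by blast
    then obtain M0 where M0: "R0 = add_connections P M0" "valid L P M0" "connections P M0" "R0 \<in> \<B> L"
      "Ob \<subseteq> \<Union> (set_mset ` M0)" "\<forall>c \<in> M0. set_mset c \<inter> Ob \<noteq> {}" by (rule orbit_extensionsE)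
    have rig: "rigid L R0"
      unfolding M0(1) by (rule rigid_orbit_extension[OF branch.prems(1,3) branch.hyps(3) M0(3,5,6)])
    have end0: "completion L R0 {}" if "deficient R0 = {}"
      using valid_closed_marked[OF M0(2)] that branch.prems(2) M0(1) by (auto simp: completion_def connections_def)
    obtain f where f: "inj_on f (cverts Rs)" "R0 = map_coloured f Rs"
      using R0(2) by (auto simp: isomorphic_def coloured_iso_map_iff)
    have comp: "completion L Rs (M - ?M1)"
      using split branch.prems(5) by (simp add: completion_def Rs_def)
    then have conn: "connections Rs (M - ?M1)" by (simp add: completion_def)
    have comp0: "completion L R0 (image_mset f ` (M - ?M1))"
      unfolding f(2) by (rule completion_map[OF preRs f(1) comp])
    have G_eq: "?G = add_connections Rs (M - ?M1)" using split by (simp add: Rs_def)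
    have "isomorphic ?G (add_connections R0 (image_mset f ` (M - ?M1)))"
      unfolding G_eq f(2) map_add_connections[OF f(1) conn, symmetric]
      using f(1) by (intro isomorphic_map) simp
    moreover have preG: "is_pregraph (underlying ?G)" using G(1) by (simp add: marked_def)
    ultimately have "isomorphic ?G R \<longleftrightarrow> isomorphic (add_connections R0 (image_mset f ` (M - ?M1))) R" for R :: "nat coloured"
      by (meson isomorphic_sym isomorphic_trans)
    moreover have "size {#R \<in># out R0. isomorphic (add_connections R0 (image_mset f ` (M - ?M1))) R#} = 1"
    proof -
      have "cverts R0 \<noteq> {}" using branch.prems(2) M0(1) by simp
      then show ?thesis using branch.IH R0(1) M0(4) rig end0 comp0 by blast
    qed
    ultimately show ?thesis by simp
  qed
  have zero: "size {#R' \<in># out R. isomorphic ?G R'#} = 0" if R: "R \<in> K" "R \<noteq> R0" for R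
  proof (rule ccontr)
    assume "size {#R' \<in># out R. isomorphic ?G R'#} \<noteq> 0"
    then have "{#R' \<in># out R. isomorphic ?G R'#} \<noteq> {#}" by simp
    then obtain R' where "R' \<in># {#R' \<in># out R. isomorphic ?G R'#}" by (meson multiset_nonemptyE)
    then have R': "R' \<in># out R" "isomorphic ?G R'" by simp_all
    have "R \<in> orbit_extensions L P Ob" using R(1) K by blast
    then obtain N1 where N1: "R = add_connections P N1" "valid L P N1" "connections P N1" "R \<in> \<B> L"
      "Ob \<subseteq> \<Union> (set_mset ` N1)" "\<forall>c \<in> N1. set_mset c \<inter> Ob \<noteq> {}" by (rule orbit_extensionsE)
    have endR: "completion L R {}" if "deficient R = {}"
      using valid_closed_marked[OF N1(2)] that branch.prems(2) N1(1) by (auto simp: completion_def connections_def)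
    have "run L R (out R)" using branch.IH R(1) by blast
    then obtain N where N: "completion L R N" "R' = add_connections R N"
      using run_sound[of L R "out R" R'] endR R'(1) fin branch.prems(2) N1(1) by auto
    then have connN: "connections (add_connections P N1) N" using N1(1) by (simp add: completion_def)
    note U = connections_Un[OF N1(3) fin connN]
    have comp: "completion L P (N1 \<union> N)" using completion_Un[OF fin N1(3)] N(1) N1(1) by simp
    obtain f where f: "coloured_iso_map f ?G (add_connections P (N1 \<union> N))"
      using R'(2) N(2) N1(1) U(3) by (auto simp: isomorphic_def)
    then have fP: "coloured_iso_map f P P" using branch.prems(3,5) comp unfolding rigid_def by blast
    then have inj: "inj_on f (cverts P)" and map: "map_coloured f P = P" by (auto simp: coloured_iso_map_iff)
    have "image_mset f ` ?M1 = touching (f ` Ob) (image_mset f ` M)"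
      by (rule touching_image[OF inj ObV]) (rule connectionsD(2)[OF connM])
    then have "image_mset f ` ?M1 = N1"
      using iso_connections[OF pre connM U(1) fP f] iso_orbit[OF pre orb fP]
        orbit_extension_touching[OF fin N1(3,5,6) connN] by simp
    then have "map_coloured f Rs = R"
      using map_add_connections[OF inj split(1)] map N1(1) by (simp add: Rs_def)
    then have "isomorphic Rs R" using inj isomorphic_map[of f Rs] by (simp add: Rs_def)
    then show False using R0(3) R by blast
  qed
  have "size {#R \<in># (\<Sum>R \<in> K. out R). isomorphic ?G R#} = (\<Sum>R \<in> K. if R = R0 then 1 else 0)"
    unfolding size_filter_sum[OF finK] using one zero by (intro sum.cong) auto
  also have "\<dots> = 1" using R0(1) finK by simp
  finally show ?case .
qed

section \<open>Existence and termination of runs\<close>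

lemma transversal_ex:
  fixes X :: "'v coloured set"
  assumes "\<And>R. R \<in> X \<Longrightarrow> is_pregraph (underlying R)"
  shows "\<exists>K. transversal K X"
proof -
  define rep where "rep R = (SOME R'. R' \<in> X \<and> isomorphic R R')" for R :: "'v coloured"
  have rep: "rep R \<in> X \<and> isomorphic R (rep R)" if "R \<in> X" for R
    unfolding rep_def by (rule someI[of "\<lambda>R'. R' \<in> X \<and> isomorphic R R'" R]) (simp add: that isomorphic_refl)
  have same: "rep R = rep R'" if "R \<in> X" "R' \<in> X" "isomorphic R R'" for R R'
  proof -
    have "isomorphic R T \<longleftrightarrow> isomorphic R' T" for T :: "'v coloured"
      using isomorphic_trans[OF that(3)] isomorphic_trans[OF isomorphic_sym[OF assms[OF that(1)] that(3)]] by blast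
    then show ?thesis by (simp add: rep_def)
  qed
  have "\<exists>!T. T \<in> rep ` X \<and> isomorphic R T" if R: "R \<in> X" for R
  proof (rule ex1I[of _ "rep R"])
    show "rep R \<in> rep ` X \<and> isomorphic R (rep R)" using rep R by blast
    fix T assume "T \<in> rep ` X \<and> isomorphic R T"
    then obtain R' where R': "R' \<in> X" "T = rep R'" "isomorphic R T" by blast
    have "rep T = rep R'" using same[OF R'(1), of T] rep[OF R'(1)] R'(2) by metis
    moreover have "rep R = rep T" using same[OF R, of T] R' rep by metis
    ultimately show "T = rep R" using R'(2) by simp
  qed
  then show ?thesis unfolding transversal_def using rep by (intro exI[of _ "rep ` X"]) blast
qed

lemma orbit_extension_decreases:
  assumes fin: "finite (cverts P)" and Ob: "smallest_orbit P Ob" and pre: "is_pregraph (underlying P)"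
    and R: "R \<in> orbit_extensions L P Ob"
  shows "card (deficient R) < card (deficient P)" "cverts R = cverts P"
proof -
  obtain M where M: "R = add_connections P M" "connections P M" "Ob \<subseteq> \<Union> (set_mset ` M)"
    using R by (rule orbit_extensionsE)
  have "Ob \<in> deficient_orbits P" using Ob by (simp add: smallest_orbit_def)
  then have "Ob \<subseteq> deficient P" "Ob \<noteq> {}" using orbitD[OF pre] by auto
  then have "deficient R \<subset> deficient P"
    using deficient_add[OF M(2) connections_finite[OF fin M(2)]] M(1,3) by blast
  then show "card (deficient R) < card (deficient P)"
    using finite_subset[OF deficient_subset fin] by (simp add: psubset_card_mono)
  show "cverts R = cverts P" using M(1) by simp
qed

lemma orbit_extensions_pregraph: "R \<in> orbit_extensions L P Ob \<Longrightarrow> is_pregraph (underlying R)"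
  by (auto simp: orbit_extensions_def valid_def \<B>_def partial_markedD(1))

text \<open>Every branching step saturates at least one orbit of deficient vertices.\<close>

lemma recursive_call_terminates:
  assumes "is_pregraph (underlying P)"
  shows "Wellfounded.accp (recursive_call L) P"
  using assms
proof (induction "card (deficient P)" arbitrary: P rule: less_induct)
  case less
  have fin: "finite (cverts P)" using is_pregraphD(1)[OF less.prems] by simp
  show ?case
  proof (rule accpI)
    fix R assume "recursive_call L R P"
    then obtain Ob where "smallest_orbit P Ob" "R \<in> orbit_extensions L P Ob" by (auto simp: recursive_call_def)
    then show "Wellfounded.accp (recursive_call L) R"
      using less.hyps orbit_extension_decreases(1)[OF fin _ less.prems] orbit_extensions_pregraph by blast
  qed
qed

lemma run_ex:
  assumes "is_pregraph (underlying P)"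
  shows "\<exists>out. run L P out"
  using assms
proof (induction "card (deficient P)" arbitrary: P rule: less_induct)
  case less
  have fin: "finite (cverts P)" using is_pregraphD(1)[OF less.prems] by simp
  consider "deficient P = {}" | "deficient P \<noteq> {}" "acts_trivially P" | "deficient P \<noteq> {}" "\<not> acts_trivially P"
    by blast
  then show ?case
  proof cases
    case 3
    obtain Ob where Ob: "smallest_orbit P Ob" using smallest_orbit_ex[OF fin 3(1)] by blast
    obtain K where K: "transversal K (orbit_extensions L P Ob)"
      using transversal_ex[of "orbit_extensions L P Ob"] orbit_extensions_pregraph by blast
    have "\<exists>out. run L R out" if "R \<in> K" for R
      using less.hyps orbit_extension_decreases(1)[OF fin Ob less.prems] orbit_extensions_pregraph K that
      unfolding transversal_def by blast
    then obtain out where "\<forall>R \<in> K. run L R (out R)" by metis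
    then show ?thesis using run.branch[OF 3 Ob K] by blast
  qed (use run.complete run.trivial in blast)+
qed

section \<open>The edges inside blocks and between blocks\<close>

definition inside_blocks :: "'v coloured \<Rightarrow> 'v multiset \<Rightarrow> bool" where
  "inside_blocks G e \<longleftrightarrow> (\<exists>S \<in> block_partition G. set_mset e \<subseteq> S)"

text \<open>The disjoint union of the blocks of \<open>G\<close>, on the same vertices.\<close>

definition core :: "'v coloured \<Rightarrow> 'v coloured" where
  "core G = \<lparr>cverts = cverts G, edges0 = edges0 G, edges1 = filter_mset (inside_blocks G) (edges1 G)\<rparr>"

definition cut_edges :: "'v coloured \<Rightarrow> 'v multiset set" where
  "cut_edges G = {e. e \<in># edges1 G \<and> \<not> inside_blocks G e}"

lemma core_simps [simp]:
  "cverts (core G) = cverts G" "edges0 (core G) = edges0 G"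
  "edges1 (core G) = filter_mset (inside_blocks G) (edges1 G)"
  by (simp_all add: core_def)

lemma inside_blocks_edge0:
  assumes G: "partial_marked G" and e: "e \<in># edges0 G"
  shows "inside_blocks G e"
proof -
  have e': "e \<in># edges (colour0 G)" using e by simp
  have "e \<noteq> {#}" using is_pregraphD(3)[OF partial_markedD(2)[OF G] e'] by auto
  then obtain v where v: "v \<in># e" by (meson multiset_nonemptyE)
  then have "v \<in> cverts G" using partial_markedD(4)[OF G e] by auto
  then obtain S where S: "S \<in> block_partition G" "v \<in> S" using block_partition_cover[OF G] by blast
  then have "set_mset e \<subseteq> S"
    using closed_under_edge[OF partial_markedD(2)[OF G] block_partitionD(3)[OF G S(1)] e' v] by blast
  then show ?thesis using S(1) by (auto simp: inside_blocks_def)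
qed

lemma partial_marked_core:
  assumes G: "partial_marked G"
  shows "partial_marked (core G)"
proof -
  have c0: "colour0 (core G) = colour0 G" by (simp add: colour0_def)
  have pre: "is_pregraph (underlying (core G))"
    using partial_markedD(1)[OF G] by (auto simp: is_pregraph_def)
  have "degree (underlying (core G)) v \<in> {2, 3}" if v: "v \<in> cverts G" for v
  proof -
    have "degree (colour0 (core G)) v \<le> degree (underlying (core G)) v" by (rule degree_mono) simp
    moreover have "degree (underlying (core G)) v \<le> degree (underlying G) v"
      by (rule degree_mono) simp
    moreover have "degree (underlying G) v \<le> 3" using partial_markedD(7)[OF G v] by linarith
    ultimately have "2 \<le> degree (underlying (core G)) v" "degree (underlying (core G)) v \<le> 3"
      using partial_markedD(6)[OF G v] c0 by simp_all
    then show ?thesis by auto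
  qed
  then show ?thesis
    using G pre is_pregraph_colour0[OF pre] unfolding partial_marked_def C4q_factor_def c0
    by (auto simp: subgraph_def)
qed

lemma extends_refl: "partial_marked P \<Longrightarrow> extends P P"
  by (simp add: extends_def)

lemma extends_core: "partial_marked G \<Longrightarrow> extends (core G) G"
  using partial_marked_core by (auto simp: extends_def)

lemma induced_core:
  assumes "S \<in> block_partition G"
  shows "induced_coloured (core G) S = induced_coloured G S"
  using assms by (intro coloured.equality)
    (auto simp: filter_filter_mset inside_blocks_def intro!: filter_mset_cong)

lemma core_blocks:
  assumes G: "partial_marked G"
  shows "block_partition (core G) = block_partition G" "block_list_of (core G) = block_list_of G"
  using extends_middle[OF extends_refl[OF partial_marked_core[OF G]] extends_core[OF G] induced_core] by auto

text \<open>The factor leaves room for only one further edge end at \<open>u\<close>.\<close>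

lemma colour1_edge_alone:
  assumes G: "partial_marked G" and e: "edges1 G = add_mset e E" and u: "u \<in># e"
  shows "count e u = 1" "\<And>d. d \<in># E \<Longrightarrow> u \<notin># d"
proof -
  have "e \<in># edges1 G" using e by simp
  then have V: "u \<in> cverts G" using partial_markedD(5)[OF G, of e] u by auto
  have "(\<Sum>e \<in># edges0 G. count e u) = 2"
    using partial_markedD(6)[OF G V] by (simp add: degree_def)
  moreover have "(\<Sum>e \<in># edges0 G. count e u) + (\<Sum>e \<in># edges1 G. count e u) \<le> 3"
    using partial_markedD(7)[OF G V] by (simp add: degree_def) linarith
  ultimately have le: "count e u + (\<Sum>d \<in># E. count d u) \<le> 1" using e by simp
  moreover have pos: "count e u > 0" using u by simp
  ultimately show "count e u = 1" by linarith
  have "(\<Sum>d \<in># E. count d u) = 0" using le pos by linarith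
  then show "u \<notin># d" if "d \<in># E" for d using that by (simp add: not_in_iff)
qed

lemma cut_pair:
  assumes G: "partial_marked G" and c: "c \<in> cut_edges G"
  shows "\<exists>u v. c = {#u, v#} \<and> u \<noteq> v \<and> u \<in> deficient (core G) \<and> v \<in> deficient (core G)"
proof -
  have c': "c \<in># edges1 G" "\<not> inside_blocks G c" using c by (auto simp: cut_edges_def)
  obtain E where E: "edges1 G = add_mset c E" using multi_member_split[OF c'(1)] by blast
  have deg: "x \<in> deficient (core G)" if "x \<in># c" for x
  proof -
    have x: "x \<in> cverts G" using partial_markedD(5)[OF G c'(1)] that by auto
    have "edges1 (core G) = filter_mset (inside_blocks G) E" using E c'(2) by simp
    then have "(\<Sum>e \<in># edges1 (core G). count e x) = 0"
      using colour1_edge_alone(2)[OF G E that] by (simp add: not_in_iff)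
    then have "degree (underlying (core G)) x = 2"
      using partial_markedD(6)[OF G x] by (simp add: degree_def)
    then show ?thesis using x by (simp add: deficient_def)
  qed
  have "size c = 1 \<or> size c = 2"
    using is_pregraphD(3)[OF partial_markedD(1)[OF G], of c] c'(1) by auto
  moreover have "size c \<noteq> 1"
  proof
    assume "size c = 1"
    then obtain v where v: "c = {#v#}" using size_1_singleton_mset by blast
    then have "v \<in> cverts G" using partial_markedD(5)[OF G c'(1)] by auto
    then show False using c'(2) v block_partition_cover[OF G] by (auto simp: inside_blocks_def)
  qed
  ultimately have "size c = Suc 1" by simp
  then obtain u N where "c = add_mset u N" "size N = 1" using size_eq_Suc_imp_eq_union[of c 1] by auto
  then obtain v where uv: "c = {#u, v#}" using size_1_singleton_mset[of N] by auto
  moreover have "u \<noteq> v" using colour1_edge_alone(1)[OF G E, of u] uv by auto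
  ultimately show ?thesis using deg by auto
qed

text \<open>An edge between two blocks has colour 1, as quotients lie inside blocks, and it has two different
  ends, as semi-edges and loops lie inside blocks. It is the only edge of colour 1 at its ends, which
  become deficient when it is removed.\<close>

lemma core_cut:
  assumes G: "partial_marked G"
  shows "connections (core G) (cut_edges G)" "add_connections (core G) (cut_edges G) = G"
proof -
  show "connections (core G) (cut_edges G)"
  proof (rule connectionsI)
    fix c d assume cd: "c \<in> cut_edges G" "d \<in> cut_edges G" "c \<noteq> d"
    then obtain E where E: "edges1 G = add_mset c E" by (auto simp: cut_edges_def dest: multi_member_split)
    then have "d \<in># E" using cd by (auto simp: cut_edges_def)
    then show "set_mset c \<inter> set_mset d = {}" using colour1_edge_alone(2)[OF G E] by auto
  qed (rule cut_pair[OF G])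
  have "filter_mset (\<lambda>e. \<not> inside_blocks G e) (edges1 G) = mset_set (cut_edges G)"
  proof (rule multiset_eqI)
    fix c
    have fin: "finite (cut_edges G)" unfolding cut_edges_def by (rule finite_subset[of _ "set_mset (edges1 G)"]) auto
    show "count (filter_mset (\<lambda>e. \<not> inside_blocks G e) (edges1 G)) c = count (mset_set (cut_edges G)) c"
    proof (cases "c \<in> cut_edges G")
      case True
      then obtain E where E: "edges1 G = add_mset c E" by (auto simp: cut_edges_def dest: multi_member_split)
      obtain u v where "c = {#u, v#}" using cut_pair[OF G True] by blast
      then have "u \<in># c" by simp
      then have "c \<notin># E" using colour1_edge_alone(2)[OF G E] by auto
      then have "count (edges1 G) c = 1" using E by (simp add: not_in_iff)
      then show ?thesis using True fin by (simp add: cut_edges_def)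
    next
      case False
      then show ?thesis using fin by (auto simp: cut_edges_def not_in_iff)
    qed
  qed
  moreover have "edges1 G = filter_mset (inside_blocks G) (edges1 G) + filter_mset (\<lambda>e. \<not> inside_blocks G e) (edges1 G)"
    by (rule multiset_partition)
  ultimately show "add_connections (core G) (cut_edges G) = G"
    by (intro coloured.equality) simp_all
qed

lemma core_map:
  assumes G: "partial_marked G" and f: "inj_on f (cverts G)"
  shows "core (map_coloured f G) = map_coloured f (core G)"
proof -
  have "inside_blocks (map_coloured f G) (image_mset f e) \<longleftrightarrow> inside_blocks G e" if e: "e \<in># edges1 G" for e
  proof -
    have "f ` set_mset e \<subseteq> f ` S \<longleftrightarrow> set_mset e \<subseteq> S" if S: "S \<in> block_partition G" for S
    proof
      assume "f ` set_mset e \<subseteq> f ` S"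
      then have "f x \<in> f ` S" "x \<in> cverts G" if "x \<in># e" for x
        using that partial_markedD(5)[OF G e] by auto
      then show "set_mset e \<subseteq> S"
        using inj_on_image_mem_iff[OF f _ block_partitionD(1)[OF G S]] by blast
    qed auto
    then show ?thesis unfolding inside_blocks_def block_partition_map[OF G f] by simp
  qed
  then have "filter_mset (inside_blocks (map_coloured f G)) (image_mset (image_mset f) (edges1 G)) =
     image_mset (image_mset f) (filter_mset (inside_blocks G) (edges1 G))"
    by (simp add: filter_mset_image_mset o_def cong: filter_mset_cong)
  then show ?thesis by (simp add: core_def map_coloured_def)
qed

text \<open>The blocks induce the same subgraphs before and after adding \<open>M\<close>, hence no connection of \<open>M\<close> lies
  inside a block.\<close>

lemma core_of_completion:
  assumes P: "P \<in> \<B> L" and core: "core P = P" and M: "completion L P M"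
  shows "core (add_connections P M) = P"
proof -
  let ?G = "add_connections P M"
  have pm: "partial_marked P" and conn: "connections P M" and lists: "block_list_of P = L" "block_list_of ?G = L"
    using P M by (auto simp: \<B>_def completion_def)
  note same = extends_same_blocks[OF extends_add[OF pm conn]]
  have eq: "block_partition ?G = block_partition P" using same(1) lists by simp
  have finM: "finite M" by (rule connections_finite[OF partial_markedD(3)[OF pm] conn])
  have "\<not> inside_blocks ?G c" if c: "c \<in> M" for c
  proof
    assume "inside_blocks ?G c"
    then obtain S where S: "S \<in> block_partition P" "set_mset c \<subseteq> S" by (auto simp: inside_blocks_def eq)
    have "edges1 (induced_coloured P S) = edges1 (induced_coloured ?G S)" using same(2)[OF _ S(1)] lists by simp
    then have empty: "{#e \<in># mset_set M. set_mset e \<subseteq> S#} = {#}" by simp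
    have "c \<in># {#e \<in># mset_set M. set_mset e \<subseteq> S#}" using c S(2) finM by simp
    then show False unfolding empty by simp
  qed
  then have "{c \<in> M. inside_blocks ?G c} = {}" by blast
  then have "filter_mset (inside_blocks ?G) (mset_set M) = {#}"
    using finM by (simp only: filter_mset_mset_set mset_set.empty)
  moreover have "inside_blocks ?G = inside_blocks P" by (simp add: inside_blocks_def eq fun_eq_iff)
  moreover have "filter_mset (inside_blocks P) (edges1 P) = edges1 P" using core by (metis core_simps(3))
  ultimately show ?thesis by (intro coloured.equality) simp_all
qed

text \<open>Isomorphisms preserve blocks and therefore the edges that lie inside blocks.\<close>

lemma rigid_core:
  assumes P: "P \<in> \<B> L" and core: "core P = P"
  shows "rigid L P"
  unfolding rigid_def
proof (intro allI impI, elim conjE)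
  fix M N f
  assume M: "completion L P M" and N: "completion L P N"
    and f: "coloured_iso_map f (add_connections P M) (add_connections P N)"
  have "partial_marked (add_connections P M)" using M by (simp add: completion_def marked_imp_partial)
  moreover have inj: "inj_on f (cverts (add_connections P M))"
    and eq: "add_connections P N = map_coloured f (add_connections P M)"
    using f by (simp_all only: coloured_iso_map_iff)
  ultimately have "map_coloured f (core (add_connections P M)) = core (add_connections P N)"
    using core_map[of "add_connections P M" f] by metis
  then have "map_coloured f P = P" using core_of_completion[OF P core] M N by simp
  then show "coloured_iso_map f P P" using f by (simp add: coloured_iso_map_iff)
qed

section \<open>Cutting a marked pregraph into its blocks\<close>

lemma image_mset_eq_mset:
  "image_mset \<phi> M = mset ys \<Longrightarrow> \<exists>xs. mset xs = M \<and> map \<phi> xs = ys"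
proof (induction ys arbitrary: M)
  case (Cons y ys)
  obtain N x where "M = add_mset x N" "\<phi> x = y" "image_mset \<phi> N = mset ys"
    using msed_map_invR[of \<phi> M y "mset ys"] Cons.prems by auto
  moreover from this obtain xs where "mset xs = N" "map \<phi> xs = ys" using Cons.IH by blast
  ultimately show ?case by (intro exI[of _ "x # xs"]) simp
qed simp

lemma image_mset_sum: "finite A \<Longrightarrow> image_mset f (\<Sum>x \<in> A. F x) = (\<Sum>x \<in> A. image_mset f (F x))"
  by (induction A rule: finite_induct) auto

lemma mset_partition_sum:
  assumes fin: "finite \<S>" and disj: "\<And>S T v. S \<in> \<S> \<Longrightarrow> T \<in> \<S> \<Longrightarrow> v \<in> S \<Longrightarrow> v \<in> T \<Longrightarrow> S = T"
    and E: "\<And>e. e \<in># E \<Longrightarrow> e \<noteq> {#} \<and> (\<exists>S \<in> \<S>. set_mset e \<subseteq> S)"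
  shows "(\<Sum>S \<in> \<S>. {#e \<in># E. set_mset e \<subseteq> S#}) = E"
  using E
proof (induction E)
  case (add e E)
  obtain S where S: "S \<in> \<S>" "set_mset e \<subseteq> S" "e \<noteq> {#}" using add.prems[of e] by auto
  then obtain v where v: "v \<in># e" by (meson multiset_nonemptyE)
  have "set_mset e \<subseteq> T \<longleftrightarrow> T = S" if "T \<in> \<S>" for T using disj[OF that S(1), of v] S(2) v by auto
  then have "{#e \<in># add_mset e E. set_mset e \<subseteq> T#} = {#e \<in># E. set_mset e \<subseteq> T#} + (if T = S then {#e#} else {#})"
    if "T \<in> \<S>" for T using that by simp
  then have "(\<Sum>S \<in> \<S>. {#e \<in># add_mset e E. set_mset e \<subseteq> S#}) =
      (\<Sum>T \<in> \<S>. {#e \<in># E. set_mset e \<subseteq> T#} + (if T = S then {#e#} else {#}))"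
    by (rule sum.cong[OF refl])
  also have "\<dots> = E + {#e#}" using add S(1) fin by (simp add: sum.distrib)
  finally show ?case by simp
qed simp

text \<open>Equal lists allow the blocks of \<open>G\<close> to be matched with those of \<open>P\<close>; the isomorphisms between
  matched blocks are glued together.\<close>

lemma core_isomorphic_corresponding:
  assumes G: "partial_marked G" and P: "corresponds P (block_list_of G)"
  shows "\<exists>h. inj_on h (cverts G) \<and> map_coloured h (core G) = P"
proof -
  obtain Bs where Bs: "\<And>B. B \<in> set Bs \<Longrightarrow> block B" "mset (map iso_class Bs) = block_list_of G"
    "\<And>i j. i < length Bs \<Longrightarrow> j < i \<Longrightarrow> cverts (Bs ! i) \<inter> cverts (Bs ! j) = {}"
    and P_eq: "P = \<lparr>cverts = (\<Union>B \<in> set Bs. cverts B),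
      edges0 = (\<Sum>B \<leftarrow> Bs. edges0 B), edges1 = (\<Sum>B \<leftarrow> Bs. edges1 B)\<rparr>"
    using P unfolding corresponds_def by blast
  obtain Ss where Ss: "mset Ss = mset_set (block_partition G)"
    "map (\<lambda>S. iso_class (induced_coloured G S)) Ss = map iso_class Bs"
    using image_mset_eq_mset[of "\<lambda>S. iso_class (induced_coloured G S)" "mset_set (block_partition G)" "map iso_class Bs"]
      Bs(2) unfolding block_list_of_def by auto
  have set_Ss: "set Ss = block_partition G"
    using Ss(1) finite_block_partition[OF G] by (metis finite_set_mset_mset_set set_mset_mset)
  have dist: "distinct Ss"
    using Ss(1) finite_block_partition[OF G] by (metis count_mset_set(1) count_mset_set(3) distinct_count_atmost_1 set_Ss)
  have len: "length Ss = length Bs" using Ss(2) by (metis length_map)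
  have "\<exists>g. inj_on g (Ss ! i) \<and> Bs ! i = map_coloured g (induced_coloured G (Ss ! i))" if i: "i < length Bs" for i
  proof -
    have S: "Ss ! i \<in> block_partition G" using i len set_Ss nth_mem by metis
    have "iso_class (induced_coloured G (Ss ! i)) = iso_class (Bs ! i)"
      using Ss(2) i len by (metis nth_map)
    then have "isomorphic (induced_coloured G (Ss ! i)) (Bs ! i)"
      using isomorphic_refl[of "Bs ! i"] unfolding iso_class_def by blast
    moreover have "cverts (induced_coloured G (Ss ! i)) = Ss ! i" using block_partitionD(1)[OF G S] by auto
    ultimately show ?thesis by (auto simp: isomorphic_def coloured_iso_map_iff)
  qed
  then obtain g where g: "\<And>i. i < length Bs \<Longrightarrow> inj_on (g i) (Ss ! i)"
    "\<And>i. i < length Bs \<Longrightarrow> Bs ! i = map_coloured (g i) (induced_coloured G (Ss ! i))" by metis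
  \<comment> \<open>By distinctness of Ss and disjointness of the blocks, this choice is the only one possible.\<close>
  define idx where "idx v = (SOME i. i < length Bs \<and> v \<in> Ss ! i)" for v
  define h where "h v = g (idx v) v" for v
  have sub: "Ss ! i \<subseteq> cverts G" if "i < length Bs" for i
    using block_partitionD(1)[OF G] that len set_Ss nth_mem by metis
  have h: "h v = g i v" if i: "i < length Bs" "v \<in> Ss ! i" for i v
  proof -
    have idx: "idx v < length Bs \<and> v \<in> Ss ! idx v"
      unfolding idx_def by (rule someI[of "\<lambda>i. i < length Bs \<and> v \<in> Ss ! i" i]) (simp add: i)
    then have "Ss ! idx v \<in> block_partition G" "Ss ! i \<in> block_partition G"
      using i(1) len nth_mem[of _ Ss] unfolding set_Ss by simp_all
    then have "Ss ! idx v = Ss ! i"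
      using block_partition_meet[OF G] idx i(2) by blast
    then have "idx v = i" using dist idx i len by (metis nth_eq_iff_index_eq)
    then show ?thesis by (simp add: h_def)
  qed
  have cov: "\<exists>i < length Bs. v \<in> Ss ! i" if "v \<in> cverts G" for v
  proof -
    have "v \<in> \<Union> (set Ss)" using that by (simp add: set_Ss block_partition_cover[OF G])
    then obtain S where S: "S \<in> set Ss" "v \<in> S" by blast
    obtain i where "i < length Ss" "Ss ! i = S" using S(1) in_set_conv_nth[of S Ss] by auto
    then show ?thesis using S(2) len by auto
  qed
  have Bs_h: "Bs ! i = map_coloured h (induced_coloured G (Ss ! i))" if i: "i < length Bs" for i
  proof -
    have S: "Ss ! i \<in> block_partition G" using i len nth_mem[of i Ss] unfolding set_Ss by simp
    have "map_coloured h (induced_coloured G (Ss ! i)) = map_coloured (g i) (induced_coloured G (Ss ! i))"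
      using partial_markedD(1)[OF partial_marked_block[OF G S]] h[OF i] by (intro map_coloured_cong) auto
    then show ?thesis using g(2)[OF i] by simp
  qed
  have cv: "cverts (Bs ! i) = h ` (Ss ! i)" if "i < length Bs" for i
    using Bs_h[OF that] sub[OF that] by (simp add: Int_absorb1)
  have "inj_on h (cverts G)"
  proof (rule inj_onI)
    fix u v assume uv: "u \<in> cverts G" "v \<in> cverts G" "h u = h v"
    obtain i j where ij: "i < length Bs" "u \<in> Ss ! i" "j < length Bs" "v \<in> Ss ! j" using cov uv(1,2) by blast
    have "h u \<in> cverts (Bs ! i)" "h u \<in> cverts (Bs ! j)"
      using cv[OF ij(1)] cv[OF ij(3)] imageI[OF ij(2), of h] imageI[OF ij(4), of h] uv(3) by simp_all
    then have "\<not> j < i" "\<not> i < j" using Bs(3)[OF ij(1)] Bs(3)[OF ij(3)] by blast+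
    then have "i = j" by simp
    moreover have "g i u = g i v" using h[OF ij(1,2)] h[OF ij(3,4)] uv(3) \<open>i = j\<close> by simp
    ultimately show "u = v" using inj_onD[OF g(1)[OF ij(1)]] ij by blast
  qed
  moreover have "map_coloured h (core G) = P"
  proof (rule coloured.equality)
    have "cverts P = (\<Union>i < length Bs. cverts (Bs ! i))"
      unfolding P_eq by (auto simp: set_conv_nth)
    also have "\<dots> = h ` cverts G" using cv cov sub by (fastforce simp: image_iff)
    finally show "cverts (map_coloured h (core G)) = cverts P" by simp
    have split: "(\<Sum>B \<leftarrow> Bs. F B) = image_mset (image_mset h) E"
      if F: "\<And>S. S \<in> block_partition G \<Longrightarrow>
          F (map_coloured h (induced_coloured G S)) = image_mset (image_mset h) {#e \<in># E. set_mset e \<subseteq> S#}"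
        and E: "\<And>e. e \<in># E \<Longrightarrow> e \<noteq> {#} \<and> inside_blocks G e" for F E
    proof -
      have "map F Bs = map (\<lambda>S. F (map_coloured h (induced_coloured G S))) Ss"
        using len Bs_h by (intro nth_equalityI) auto
      then have "(\<Sum>B \<leftarrow> Bs. F B) = (\<Sum>S \<in> block_partition G. F (map_coloured h (induced_coloured G S)))"
        using dist set_Ss by (simp add: sum_list_distinct_conv_sum_set)
      also have "\<dots> = (\<Sum>S \<in> block_partition G. image_mset (image_mset h) {#e \<in># E. set_mset e \<subseteq> S#})"
        using F by (intro sum.cong) auto
      also have "\<dots> = image_mset (image_mset h) (\<Sum>S \<in> block_partition G. {#e \<in># E. set_mset e \<subseteq> S#})"
        by (simp only: image_mset_sum[OF finite_block_partition[OF G]])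
      also have "(\<Sum>S \<in> block_partition G. {#e \<in># E. set_mset e \<subseteq> S#}) = E"
        by (rule mset_partition_sum[OF finite_block_partition[OF G] block_partition_meet[OF G]])
          (use E in \<open>auto simp: inside_blocks_def\<close>)
      finally show ?thesis .
    qed
    have ne: "e \<noteq> {#}" if "e \<in># edges0 G \<or> e \<in># edges1 G" for e
      using is_pregraphD(3)[OF partial_markedD(1)[OF G], of e] that by auto
    have "edges0 P = (\<Sum>B \<leftarrow> Bs. edges0 B)" by (simp add: P_eq)
    also have "\<dots> = image_mset (image_mset h) (edges0 G)"
      by (rule split) (use ne inside_blocks_edge0[OF G] in auto)
    finally show "edges0 (map_coloured h (core G)) = edges0 P" by simp
    have "edges1 P = (\<Sum>B \<leftarrow> Bs. edges1 B)" by (simp add: P_eq)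
    also have "\<dots> = image_mset (image_mset h) (edges1 (core G))"
    proof (rule split)
      fix S assume S: "S \<in> block_partition G"
      have "edges1 (induced_coloured (core G) S) = edges1 (induced_coloured G S)" using induced_core[OF S] by simp
      then show "edges1 (map_coloured h (induced_coloured G S)) =
        image_mset (image_mset h) {#e \<in># edges1 (core G). set_mset e \<subseteq> S#}" by simp
    qed (use ne in auto)
    finally show "edges1 (map_coloured h (core G)) = edges1 P" by simp
  qed simp
  ultimately show ?thesis by blast
qed

text \<open>The gluing of the blocks also transports the edges of \<open>G\<close> between blocks to \<open>P\<close>.\<close>

lemma corresponding_completion:
  assumes G: "marked G" and P: "corresponds P (block_list_of G)"
  shows "\<exists>M. completion (block_list_of G) P M \<and> isomorphic G (add_connections P M)"
    "P \<in> \<B> (block_list_of G)" "rigid (block_list_of G) P"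
proof -
  have pm: "partial_marked G" by (rule marked_imp_partial[OF G])
  note pmc = partial_marked_core[OF pm] and blocks = core_blocks[OF pm]
  obtain h where h: "inj_on h (cverts G)" "map_coloured h (core G) = P"
    using core_isomorphic_corresponding[OF pm P] by blast
  have h': "inj_on h (cverts (core G))" using h(1) by simp
  have "completion (block_list_of G) (core G) (cut_edges G)"
    using core_cut[OF pm] G by (simp add: completion_def)
  then have "completion (block_list_of G) P (image_mset h ` cut_edges G)"
    using completion_map[OF partial_markedD(1)[OF pmc] h'] h(2) by simp
  moreover have "map_coloured h G = add_connections P (image_mset h ` cut_edges G)"
    using map_add_connections[OF h' core_cut(1)[OF pm]] core_cut(2)[OF pm] h(2) by simp
  then have "isomorphic G (add_connections P (image_mset h ` cut_edges G))"
    using isomorphic_map[OF h(1)] by simp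
  ultimately show "\<exists>M. completion (block_list_of G) P M \<and> isomorphic G (add_connections P M)" by blast
  show B: "P \<in> \<B> (block_list_of G)"
    using partial_marked_map[OF pmc h'] block_list_of_map[OF pmc h'] h(2) blocks(2) by (simp add: \<B>_def)
  have "inside_blocks (core G) = inside_blocks G" by (simp add: fun_eq_iff inside_blocks_def blocks(1))
  then have "core (core G) = core G"
    by (intro coloured.equality) (simp_all add: filter_filter_mset)
  then have "core P = P" using core_map[OF pmc h'] h(2) by simp
  then show "rigid (block_list_of G) P" by (rule rigid_core[OF B])
qed

section \<open>Acceptability of block lists\<close>

lemma sum_block_list:
  "(\<Sum>T \<in># block_list_of G. F T) = (\<Sum>S \<in> block_partition G. F (iso_class (induced_coloured G S)))"
  unfolding block_list_of_def by (simp only: sum_unfold_sum_mset multiset.map_comp o_def)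

lemma order_block_list:
  assumes G: "partial_marked G"
  shows "(\<Sum>T \<in># block_list_of G. order_of T) = card (cverts G)"
proof -
  have "order_of (iso_class (induced_coloured G S)) = card S" if S: "S \<in> block_partition G" for S
    using order_of_iso_class[OF partial_markedD(1)[OF partial_marked_block[OF G S]]] block_partitionD(1)[OF G S]
    by (simp add: Int_absorb1)
  then have "(\<Sum>T \<in># block_list_of G. order_of T) = (\<Sum>S \<in> block_partition G. card S)"
    unfolding sum_block_list by (intro sum.cong) auto
  also have "\<dots> = card (\<Union> (block_partition G))"
  proof (rule card_Union_disjoint[symmetric])
    show "disjoint (block_partition G)"
      using block_partition_meet[OF G] unfolding disjoint_def by blast
    show "finite S" if "S \<in> block_partition G" for S
      using block_partitionD(1)[OF G that] partial_markedD(3)[OF G] by (rule finite_subset)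
  qed
  finally show ?thesis by (simp add: block_partition_cover[OF G])
qed

definition block_at :: "'v coloured \<Rightarrow> 'v \<Rightarrow> 'v set" where
  "block_at G v = (THE S. S \<in> block_partition G \<and> v \<in> S)"

lemma block_at:
  assumes G: "partial_marked G" and S: "S \<in> block_partition G" "v \<in> S"
  shows "block_at G v = S"
  unfolding block_at_def
proof (rule the_equality)
  show "S \<in> block_partition G \<and> v \<in> S" using S by simp
  show "T = S" if "T \<in> block_partition G \<and> v \<in> T" for T
    using block_partition_meet[OF G _ S(1) _ S(2)] that by simp
qed

lemma block_at_in:
  assumes G: "partial_marked G" and v: "v \<in> cverts G"
  shows "block_at G v \<in> block_partition G" "v \<in> block_at G v"
proof -
  have "v \<in> \<Union> (block_partition G)" using v by (simp add: block_partition_cover[OF G])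
  then obtain S where "S \<in> block_partition G" "v \<in> S" by blast
  then show "block_at G v \<in> block_partition G" "v \<in> block_at G v" using block_at[OF G] by auto
qed

text \<open>The multigraph that arises from contracting every block to a vertex and deleting the edges inside
  blocks.\<close>

definition block_graph :: "'v coloured \<Rightarrow> 'v set pregraph" where
  "block_graph G = \<lparr>verts = block_partition G, edges = image_mset (image_mset (block_at G)) (mset_set (cut_edges G))\<rparr>"

lemma cut_ends:
  assumes G: "partial_marked G" and c: "c \<in> cut_edges G"
  obtains u v where "c = {#u, v#}" "u \<in> cverts G" "v \<in> cverts G" "block_at G u \<noteq> block_at G v"
    "(u, v) \<in> adjacency (underlying G)"
proof -
  obtain u v where uv: "c = {#u, v#}" using cut_pair[OF G c] by blast
  have c': "c \<in># edges1 G" "\<not> inside_blocks G c" using c by (auto simp: cut_edges_def)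
  then have V: "u \<in> cverts G" "v \<in> cverts G" using partial_markedD(5)[OF G c'(1)] uv by auto
  have "block_at G u \<noteq> block_at G v"
  proof
    assume "block_at G u = block_at G v"
    then show False
      using c'(2) block_at_in[OF G V(1)] block_at_in[OF G V(2)] uv unfolding inside_blocks_def by force
  qed
  moreover have "(u, v) \<in> adjacency (underlying G)" using c'(1) uv by (simp add: adjacency_def)
  ultimately show thesis using that uv V by blast
qed

lemma sum_sum_mset_swap:
  "(\<Sum>x \<in> A. \<Sum>e \<in># E. F e x) = (\<Sum>e \<in># E. \<Sum>x \<in> A. (F e x :: nat))"
  by (induction E) (simp_all add: sum.distrib)

lemma finite_cut: "finite (cut_edges G)"
  unfolding cut_edges_def by (rule finite_subset[of _ "set_mset (edges1 G)"]) auto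

text \<open>In a cubic pregraph, the deficient vertices of a block are those where an edge leaves the block, and
  at each of them exactly one does.\<close>

lemma degree_block_graph:
  assumes G: "marked G" and S: "S \<in> block_partition G"
  shows "degree (block_graph G) S = missing (iso_class (induced_coloured G S))"
proof -
  have pm: "partial_marked G" by (rule marked_imp_partial[OF G])
  note pmc = partial_marked_core[OF pm] and pmS = partial_marked_block[OF pm S]
  have SV: "S \<subseteq> cverts G" by (rule block_partitionD(1)[OF pm S])
  have finS: "finite S" using SV partial_markedD(3)[OF pm] by (rule finite_subset)
  have "count (image_mset (block_at G) c) S = (\<Sum>v \<in> S. count c v)" if c: "c \<in> cut_edges G" for c
  proof -
    obtain u v where uv: "c = {#u, v#}" "u \<in> cverts G" "v \<in> cverts G" by (rule cut_ends[OF pm c])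
    have iff: "block_at G x = S \<longleftrightarrow> x \<in> S" if "x \<in> cverts G" for x
      using block_at[OF pm S] block_at_in[OF pm that] by auto
    have "(\<Sum>x \<in> S. count c x) = (\<Sum>x \<in> S. if x = u then 1 else 0) + (\<Sum>x \<in> S. if x = v then 1 else 0)"
      unfolding sum.distrib[symmetric] using uv(1) by (intro sum.cong) auto
    also have "\<dots> = (if u \<in> S then 1 else 0) + (if v \<in> S then 1 else 0)" using finS by simp
    finally show ?thesis using iff[OF uv(2)] iff[OF uv(3)] uv(1) by auto
  qed
  then have "degree (block_graph G) S = (\<Sum>c \<in> cut_edges G. \<Sum>v \<in> S. count c v)"
    by (simp add: degree_def block_graph_def multiset.map_comp o_def sum_unfold_sum_mset[symmetric])
  also have "\<dots> = (\<Sum>v \<in> S. \<Sum>c \<in> cut_edges G. count c v)" by (rule sum.swap)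
  also have "\<dots> = (\<Sum>v \<in> S. if v \<in> \<Union> (set_mset ` cut_edges G) then 1 else 0)"
    using matching_count[OF core_cut(1)[OF pm] finite_cut] by (intro sum.cong) auto
  also have "\<dots> = card (S \<inter> \<Union> (set_mset ` cut_edges G))"
    using finS by (simp add: sum.If_cases Int_def)
  also have "S \<inter> \<Union> (set_mset ` cut_edges G) = deficient (induced_coloured G S)"
  proof -
    have closed: "closed_under (underlying (core G)) S"
      unfolding closed_under_def
    proof (intro allI impI, elim conjE)
      fix u v assume u: "u \<in> S" and uv: "(u, v) \<in> adjacency (underlying (core G))"
      then have "{#u, v#} \<in># edges0 G \<or> ({#u, v#} \<in># edges1 G \<and> inside_blocks G {#u, v#})"
        by (simp add: adjacency_def)
      then have "inside_blocks G {#u, v#}" using inside_blocks_edge0[OF pm] by blast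
      then obtain T where T: "T \<in> block_partition G" "u \<in> T" "v \<in> T" by (auto simp: inside_blocks_def)
      then show "v \<in> S" using block_partition_meet[OF pm T(1) S T(2) u] by simp
    qed
    have "deficient G = {}" using G by (simp add: marked_iff)
    then have "\<Union> (set_mset ` cut_edges G) = deficient (core G)"
      using deficient_add[OF core_cut(1)[OF pm] finite_cut] core_cut(2)[OF pm]
        connectionsD(1)[OF core_cut(1)[OF pm]] by auto
    moreover have "degree (underlying (induced_coloured G S)) v = degree (underlying (core G)) v" if "v \<in> S" for v
      using degree_induced_closed[OF partial_markedD(1)[OF pmc] closed that] induced_core[OF S]
      by (metis underlying_induced)
    ultimately show ?thesis using SV by (auto simp: deficient_def)
  qed
  finally show ?thesis using missing_iso_class[OF partial_markedD(1)[OF pmS]] by simp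
qed

text \<open>The degrees of \<open>block_graph G\<close> are the numbers of missing connections. Each of its edges has at
  most one end in \<open>q\<^sub>2\<close> blocks, which gives the inequality for these by counting edge ends, and
  likewise for \<open>q\<^sub>3\<close>.\<close>

lemma acceptable_block_list:
  fixes G :: "nat coloured"
  assumes G: "marked G"
  shows "acceptable (block_list_of G)"
proof -
  have pm: "partial_marked G" by (rule marked_imp_partial[OF G])
  let ?L = "block_list_of G" and ?B = "block_partition G" and ?Q = "block_graph G"
  note finB = finite_block_partition[OF pm]
  have is_list: "is_block_list ?L"
    unfolding is_block_list_def block_list_of_def using block_induced[OF pm] finB by auto
  have set_Q: "\<And>e. e \<in># edges ?Q \<Longrightarrow> \<exists>S T. e = {#S, T#} \<and> S \<noteq> T \<and> S \<in> ?B \<and> T \<in> ?B"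
  proof -
    fix e assume "e \<in># edges ?Q"
    then obtain c where c: "c \<in> cut_edges G" "e = image_mset (block_at G) c" by (auto simp: block_graph_def finite_cut)
    obtain u v where "c = {#u, v#}" "u \<in> cverts G" "v \<in> cverts G" "block_at G u \<noteq> block_at G v"
      by (rule cut_ends[OF pm c(1)])
    then show "\<exists>S T. e = {#S, T#} \<and> S \<noteq> T \<and> S \<in> ?B \<and> T \<in> ?B"
      using block_at_in(1)[OF pm] c(2) by auto
  qed
  have pre: "is_pregraph ?Q"
    unfolding is_pregraph_def
  proof (intro conjI ballI)
    show "finite (verts ?Q)" using finB by (simp add: block_graph_def)
    fix e assume "e \<in># edges ?Q"
    then obtain S T where "e = {#S, T#}" "S \<in> ?B" "T \<in> ?B" using set_Q by blast
    then show "size e \<in> {1, 2}" "set_mset e \<subseteq> verts ?Q" by (auto simp: block_graph_def)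
  qed
  have VQ: "verts ?Q = ?B" by (simp add: block_graph_def)
  have deg: "missing (iso_class (induced_coloured G S)) = degree ?Q S" if "S \<in> ?B" for S
    using degree_block_graph[OF G that] by simp
  have loopless: "loopless_degree_sequence (image_mset missing ?L)"
  proof -
    obtain f :: "nat set \<Rightarrow> nat" where f: "inj_on f ?B"
      using finite_imp_inj_to_nat_seg[OF finB] by auto
    let ?M = "map_pregraph f ?Q"
    have "\<exists>u v. u \<noteq> v \<and> e = {#u, v#}" if "e \<in># edges ?M" for e
    proof -
      obtain d where d: "d \<in># edges ?Q" "e = image_mset f d" using \<open>e \<in># edges ?M\<close> by auto
      then obtain S T where "d = {#S, T#}" "S \<noteq> T" "S \<in> ?B" "T \<in> ?B" using set_Q by blast
      then show ?thesis using d(2) inj_onD[OF f, of S T] by auto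
    qed
    moreover have "image_mset (degree ?M) (mset_set (verts ?M)) = image_mset missing ?L"
    proof -
      have "image_mset (degree ?M) (mset_set (verts ?M)) = image_mset (\<lambda>S. degree ?M (f S)) (mset_set ?B)"
        by (simp add: VQ image_mset_mset_set[OF f, symmetric] multiset.map_comp o_def)
      also have "\<dots> = image_mset (\<lambda>S. missing (iso_class (induced_coloured G S))) (mset_set ?B)"
        using degree_map[OF pre, of f] f finB by (intro image_mset_cong) (simp add: VQ deg)
      finally show ?thesis by (simp add: block_list_of_def multiset.map_comp o_def)
    qed
    ultimately show ?thesis
      using is_pregraph_map[OF pre] unfolding loopless_degree_sequence_def by blast
  qed
  \<comment> \<open>Both inequalities at once: for t = Q2 and t = Q3 the blocks are maximal clusters.\<close>
  have half: "2 * (\<Sum>T \<in># {#T \<in># ?L. block_of_type t T#}. missing T) \<le> (\<Sum>T \<in># ?L. missing T)"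
    if t: "\<And>S. block_set G t S \<Longrightarrow> maximal_cluster G t S" for t
  proof -
    let ?A = "{S \<in> ?B. block_set G t S}"
    have type: "block_of_type t (iso_class (induced_coloured G S)) \<longleftrightarrow> block_set G t S" if S: "S \<in> ?B" for S
    proof -
      have pmS: "partial_marked (induced_coloured G S)" by (rule partial_marked_block[OF pm S])
      have cS: "cverts (induced_coloured G S) = S" using block_partitionD(1)[OF pm S] by auto
      obtain s where s: "block_set G s S" using S by (auto simp: block_partition_def)
      obtain v where v: "v \<in> S" using block_partitionD(2)[OF pm S] by blast
      have "t = s" if "block_set (induced_coloured G S) t S"
        using block_set_meet[OF pmS that block_set_induced[OF pm s] v v] by simp
      then show ?thesis
        unfolding block_of_type_iso_class[OF pmS] cS using s block_set_induced[OF pm] by blast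
    qed
    have "(\<Sum>T \<in># {#T \<in># ?L. block_of_type t T#}. missing T) = (\<Sum>S \<in> ?A. degree ?Q S)"
    proof -
      have "{#T \<in># ?L. block_of_type t T#} =
        image_mset (\<lambda>S. iso_class (induced_coloured G S)) (mset_set {S \<in> ?B. block_of_type t (iso_class (induced_coloured G S))})"
        unfolding block_list_of_def by (simp add: filter_mset_image_mset o_def filter_mset_mset_set finB)
      also have "{S \<in> ?B. block_of_type t (iso_class (induced_coloured G S))} = ?A" using type by blast
      finally have "(\<Sum>T \<in># {#T \<in># ?L. block_of_type t T#}. missing T) =
          (\<Sum>S \<in> ?A. missing (iso_class (induced_coloured G S)))"
        by (simp add: sum_unfold_sum_mset multiset.map_comp o_def)
      also have "\<dots> = (\<Sum>S \<in> ?A. degree ?Q S)" using deg by (intro sum.cong) auto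
      finally show ?thesis .
    qed
    also have "\<dots> = (\<Sum>e \<in># edges ?Q. \<Sum>S \<in> ?A. count e S)"
      unfolding degree_def by (rule sum_sum_mset_swap)
    finally have A: "(\<Sum>T \<in># {#T \<in># ?L. block_of_type t T#}. missing T) = (\<Sum>e \<in># edges ?Q. \<Sum>S \<in> ?A. count e S)" .
    have "(\<Sum>T \<in># ?L. missing T) = (\<Sum>S \<in> ?B. degree ?Q S)"
      unfolding sum_block_list using deg by (intro sum.cong) auto
    also have "\<dots> = (\<Sum>e \<in># edges ?Q. \<Sum>S \<in> ?B. count e S)"
      unfolding degree_def by (rule sum_sum_mset_swap)
    finally have B: "(\<Sum>T \<in># ?L. missing T) = (\<Sum>e \<in># edges ?Q. \<Sum>S \<in> ?B. count e S)" .
    have pair_sum: "(\<Sum>S \<in> X. count {#U, V#} S) = (if U \<in> X then 1 else 0) + (if V \<in> X then 1 else 0)"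
      if "finite X" for X and U V :: "nat set"
    proof -
      have "(\<Sum>S \<in> X. count {#U, V#} S) = (\<Sum>S \<in> X. if S = U then 1 else 0) + (\<Sum>S \<in> X. if S = V then 1 else 0)"
        unfolding sum.distrib[symmetric] by (intro sum.cong) auto
      then show ?thesis using that by simp
    qed
    have "2 * (\<Sum>S \<in> ?A. count e S) \<le> (\<Sum>S \<in> ?B. count e S)" if e: "e \<in># edges ?Q" for e
    proof -
      obtain c where c: "c \<in> cut_edges G" "e = image_mset (block_at G) c" using e by (auto simp: block_graph_def finite_cut)
      obtain u v where uv: "c = {#u, v#}" "u \<in> cverts G" "v \<in> cverts G" "block_at G u \<noteq> block_at G v"
        "(u, v) \<in> adjacency (underlying G)" by (rule cut_ends[OF pm c(1)])
      have "\<not> (block_at G u \<in> ?A \<and> block_at G v \<in> ?A)"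
        using maximal_cluster_meet[OF pm t t, of "block_at G u" "block_at G v" u v]
          block_at_in[OF pm uv(2)] block_at_in[OF pm uv(3)] uv(4,5) by blast
      moreover have "e = {#block_at G u, block_at G v#}" using c(2) uv(1) by simp
      ultimately show ?thesis
        using pair_sum[OF finB] pair_sum[of ?A] finB block_at_in[OF pm uv(2)] block_at_in[OF pm uv(3)] by auto
    qed
    then have "(\<Sum>e \<in># E. 2 * (\<Sum>S \<in> ?A. count e S)) \<le> (\<Sum>e \<in># E. \<Sum>S \<in> ?B. count e S)"
      if "set_mset E \<subseteq> set_mset (edges ?Q)" for E
      using that by (intro sum_mset_mono) auto
    then show ?thesis unfolding A B by (simp add: sum_mset_distrib_left)
  qed
  have single: "size ?L = 1" if ex: "\<exists>T \<in># ?L. missing T = 0"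
  proof -
    obtain S where S: "S \<in> ?B" "missing (iso_class (induced_coloured G S)) = 0"
      using ex finB by (auto simp: block_list_of_def)
    then have d0: "degree ?Q S = 0" using deg by simp
    have "closed_under (underlying G) S"
      unfolding closed_under_def
    proof (intro allI impI, elim conjE)
      fix u v assume u: "u \<in> S" and uv: "(u, v) \<in> adjacency (underlying G)"
      have e: "{#u, v#} \<in># edges0 G \<or> {#u, v#} \<in># edges1 G" using uv by (auto simp: adjacency_def)
      have "inside_blocks G {#u, v#}"
      proof (rule ccontr)
        assume "\<not> inside_blocks G {#u, v#}"
        then have c: "{#u, v#} \<in> cut_edges G" using e inside_blocks_edge0[OF pm] by (auto simp: cut_edges_def)
        then have "{#block_at G u, block_at G v#} \<in># edges ?Q"
          using imageI[OF c, of "image_mset (block_at G)"] by (simp add: block_graph_def finite_cut)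
        moreover have "block_at G u = S" using block_at[OF pm S(1) u] .
        ultimately show False using d0 by (force simp: degree_def)
      qed
      then obtain T where T: "T \<in> ?B" "u \<in> T" "v \<in> T" by (auto simp: inside_blocks_def)
      then show "v \<in> S" using block_partition_meet[OF pm T(1) S(1) T(2) u] by simp
    qed
    then have "S = cverts G"
      using connected_closed_under[of "underlying G" S] G block_partitionD(1,2)[OF pm S(1)]
      by (simp add: marked_iff)
    then have "?B = {S}" using S(1) by (intro block_partition_eqI[OF pm]) auto
    then show ?thesis by (simp add: size_block_list_of)
  qed
  show ?thesis
    unfolding acceptable_def using is_list loopless half[of Q2] half[of Q3] single by simp
qed

section \<open>Finitely many acceptable lists\<close>

text \<open>Every edge has at least one end, and every vertex is an end at most three times.\<close>

lemma size_edges_bound: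
  assumes P: "partial_marked P"
  shows "size (edges (underlying P)) \<le> 3 * card (cverts P)"
proof -
  let ?E = "edges (underlying P)"
  have "size e \<ge> 1" if "e \<in># ?E" for e using is_pregraphD(3)[OF partial_markedD(1)[OF P] that] by auto
  moreover have "size e = (\<Sum>v \<in> cverts P. count e v)" if "e \<in># ?E" for e
  proof -
    have "set_mset e \<subseteq> cverts P" using is_pregraphD(2)[OF partial_markedD(1)[OF P] that] by simp
    then show ?thesis unfolding size_multiset_overloaded_eq
      by (intro sum.mono_neutral_left partial_markedD(3)[OF P]) (auto simp: not_in_iff)
  qed
  ultimately have "(\<Sum>e \<in># ?E. 1) \<le> (\<Sum>e \<in># ?E. \<Sum>v \<in> cverts P. count e v)"
    by (intro sum_mset_mono) metis
  also have "\<dots> = (\<Sum>v \<in> cverts P. degree (underlying P) v)"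
    unfolding degree_def by (rule sum_sum_mset_swap[symmetric])
  also have "\<dots> \<le> (\<Sum>v \<in> cverts P. 3)"
    by (rule sum_mono) (use partial_markedD(7)[OF P] in fastforce)
  finally show ?thesis by simp
qed

lemma finite_multisets_bounded:
  assumes "finite A"
  shows "finite {M. set_mset M \<subseteq> A \<and> size M \<le> k}"
proof -
  have "{M. set_mset M \<subseteq> A \<and> size M \<le> k} = (\<Union>j \<le> k. multisets_of_size A j)"
    by (auto simp: multisets_of_size_def)
  then show ?thesis using finite_multisets_of_size[OF assms] by simp
qed

text \<open>Up to isomorphism the vertices of a block are an initial segment of the natural numbers, and its
  edges are bounded in number.\<close>

lemma finite_block_types:
  "finite {iso_class B | B :: nat coloured. block B \<and> card (cverts B) \<le> n}"
proof -
  define E where "E = {e :: nat multiset. set_mset e \<subseteq> {..<n} \<and> size e \<le> 2}"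
  define X where "X = {E0. set_mset E0 \<subseteq> E \<and> size E0 \<le> 3 * n}"
  define Y where "Y = (\<lambda>(V, E0, E1). \<lparr>cverts = V, edges0 = E0, edges1 = E1\<rparr>) ` (Pow {..<n} \<times> X \<times> X)"
  have "finite E" unfolding E_def by (rule finite_multisets_bounded) simp
  then have "finite X" unfolding X_def by (rule finite_multisets_bounded)
  then have "finite Y" unfolding Y_def by simp
  have "\<exists>R \<in> Y. iso_class B = iso_class R" if B: "block B" "card (cverts B) \<le> n" for B :: "nat coloured"
  proof -
    have pm: "partial_marked B" using B(1) by (simp add: block_def)
    obtain f where f: "inj_on f (cverts B)" "f ` cverts B = {i. i < card (cverts B)}"
      using finite_imp_inj_to_nat_seg[OF partial_markedD(3)[OF pm]]
      by (metis card_Collect_less_nat card_image)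
    let ?R = "map_coloured f B"
    have pmR: "partial_marked ?R" by (rule partial_marked_map[OF pm f(1)])
    have V: "cverts ?R \<subseteq> {..<n}" using f(2) B(2) by auto
    have sz: "size (edges (underlying ?R)) \<le> 3 * n"
      using size_edges_bound[OF pmR] f B(2) by (simp add: card_image)
    have "set_mset e \<subseteq> {..<n} \<and> size e \<le> 2" if "e \<in># edges (underlying ?R)" for e
      using is_pregraphD(2,3)[OF partial_markedD(1)[OF pmR] that] V by auto
    then have "set_mset (edges0 ?R) \<subseteq> E" "set_mset (edges1 ?R) \<subseteq> E" by (auto simp: E_def)
    then have "edges0 ?R \<in> X" "edges1 ?R \<in> X" using sz by (simp_all add: X_def)
    then have "?R \<in> Y" using V unfolding Y_def by (intro image_eqI[of _ _ "(cverts ?R, edges0 ?R, edges1 ?R)"]) auto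
    moreover have "iso_class B = iso_class ?R" using iso_class_map[OF partial_markedD(1)[OF pm] f(1)] by simp
    ultimately show ?thesis by blast
  qed
  then have "{iso_class B | B :: nat coloured. block B \<and> card (cverts B) \<le> n} \<subseteq> iso_class ` Y" by blast
  then show ?thesis by (rule finite_subset) (simp add: \<open>finite Y\<close>)
qed

lemma finite_acceptable_lists: "finite (acceptable_lists n)"
proof -
  let ?A = "{iso_class B | B :: nat coloured. block B \<and> card (cverts B) \<le> n}"
  have "acceptable_lists n \<subseteq> {L. set_mset L \<subseteq> ?A \<and> size L \<le> n}"
  proof
    fix L assume "L \<in> acceptable_lists n"
    then have L: "is_block_list L" "(\<Sum>T \<in># L. order_of T) = n"
      by (auto simp: acceptable_lists_def acceptable_def)
    have order: "\<exists>B :: nat coloured. block B \<and> T = iso_class B \<and> order_of T = card (cverts B) \<and> card (cverts B) \<ge> 1"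
      if T: "T \<in># L" for T
    proof -
      obtain B :: "nat coloured" where B: "block B" "T = iso_class B" using L(1) T by (auto simp: is_block_list_def)
      then have pm: "partial_marked B" and "cverts B \<noteq> {}" by (auto simp: block_def connected_pregraph_def)
      then have "card (cverts B) \<ge> 1" using partial_markedD(3)[OF pm] by (simp add: Suc_leI card_gt_0_iff)
      then show ?thesis using B order_of_iso_class[OF partial_markedD(1)[OF pm]] by blast
    qed
    have "order_of T \<le> n" if "T \<in># L" for T
      using L(2) multi_member_split[OF that] by auto
    then have "set_mset L \<subseteq> ?A" using order by fastforce
    moreover have "(\<Sum>T \<in># L. 1) \<le> (\<Sum>T \<in># L. order_of T)"
      using order by (intro sum_mset_mono) fastforce
    ultimately show "L \<in> {L. set_mset L \<subseteq> ?A \<and> size L \<le> n}" using L(2) by simp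
  qed
  then show ?thesis using finite_multisets_bounded[OF finite_block_types] by (rule finite_subset)
qed

section \<open>The initial pregraphs\<close>

lemma index_disjoint_Cons:
  "(\<forall>i < length (B # Bs). \<forall>j < i. cverts ((B # Bs) ! i) \<inter> cverts ((B # Bs) ! j) = {}) \<longleftrightarrow>
   (\<forall>C \<in> set Bs. cverts C \<inter> cverts B = {}) \<and>
   (\<forall>i < length Bs. \<forall>j < i. cverts (Bs ! i) \<inter> cverts (Bs ! j) = {})"
  by (simp add: All_less_Suc2 all_set_conv_all_nth) blast

text \<open>The new block is shifted beyond the vertices that are already in use.\<close>

lemma corresponds_add:
  fixes B :: "nat coloured"
  assumes P: "corresponds P L" and B: "block B"
  shows "\<exists>R. corresponds R (add_mset (iso_class B) L)"
proof -
  obtain Bs :: "nat coloured list" where Bs: "\<forall>B \<in> set Bs. block B" "mset (map iso_class Bs) = L"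
    "\<forall>i < length Bs. \<forall>j < i. cverts (Bs ! i) \<inter> cverts (Bs ! j) = {}"
    using P unfolding corresponds_def by blast
  have pm: "partial_marked C" if "block C" for C :: "nat coloured" using that by (simp add: block_def)
  have "finite (\<Union>C \<in> set Bs. cverts C)" using Bs(1) partial_markedD(3)[OF pm] by auto
  then obtain m where m: "\<forall>v \<in> (\<Union>C \<in> set Bs. cverts C). v < m"
    using finite_nat_set_iff_bounded by blast
  let ?f = "\<lambda>v. v + m"
  have f: "inj_on ?f (cverts B)" by simp
  let ?B = "map_coloured ?f B"
  have "block ?B" by (rule block_map[OF B f])
  moreover have "iso_class ?B = iso_class B" by (rule iso_class_map[OF partial_markedD(1)[OF pm[OF B]] f])
  moreover have "\<forall>C \<in> set Bs. cverts C \<inter> cverts ?B = {}" using m by fastforce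
  ultimately have "\<exists>Cs :: nat coloured list. (\<forall>B \<in> set Cs. block B) \<and> mset (map iso_class Cs) = add_mset (iso_class B) L \<and>
     (\<forall>i < length Cs. \<forall>j < i. cverts (Cs ! i) \<inter> cverts (Cs ! j) = {})"
    using Bs by (intro exI[of _ "?B # Bs"]) (simp only: index_disjoint_Cons, simp)
  then show ?thesis unfolding corresponds_def by blast
qed

lemma corresponds_ex:
  assumes "is_block_list L"
  shows "\<exists>P. corresponds P L"
  using assms
proof (induction L)
  case empty
  then show ?case by (auto simp: corresponds_def intro!: exI[of _ "[]"])
next
  case (add T L)
  then obtain B :: "nat coloured" where "block B" "T = iso_class B" by (auto simp: is_block_list_def)
  then show ?case using add corresponds_add by (auto simp: is_block_list_def)
qed

lemma set_mset_sum_list: "set_mset (\<Sum>B \<leftarrow> Bs. F B) = (\<Union>B \<in> set Bs. set_mset (F B))"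
  by (induction Bs) auto

lemma corresponds_pregraph:
  assumes "corresponds P L"
  shows "is_pregraph (underlying P)" "card (cverts P) = (\<Sum>T \<in># L. order_of T)"
proof -
  obtain Bs where Bs: "\<And>B. B \<in> set Bs \<Longrightarrow> block B" "mset (map iso_class Bs) = L"
    "\<forall>i < length Bs. \<forall>j < i. cverts (Bs ! i) \<inter> cverts (Bs ! j) = {}"
    and P_eq: "P = \<lparr>cverts = (\<Union>B \<in> set Bs. cverts B),
      edges0 = (\<Sum>B \<leftarrow> Bs. edges0 B), edges1 = (\<Sum>B \<leftarrow> Bs. edges1 B)\<rparr>"
    using assms unfolding corresponds_def by blast
  have pre: "is_pregraph (underlying B)" if "B \<in> set Bs" for B
    using Bs(1)[OF that] partial_markedD(1) by (auto simp: block_def)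
  show "is_pregraph (underlying P)"
    unfolding is_pregraph_def
  proof (intro conjI ballI)
    show "finite (verts (underlying P))" using is_pregraphD(1)[OF pre] by (auto simp: P_eq)
    fix e assume "e \<in># edges (underlying P)"
    then obtain B where B: "B \<in> set Bs" "e \<in># edges (underlying B)"
      by (auto simp: P_eq set_mset_sum_list)
    then show "size e \<in> {1, 2}" "set_mset e \<subseteq> verts (underlying P)"
      using is_pregraphD(2,3)[OF pre[OF B(1)] B(2)] by (auto simp: P_eq)
  qed
  have "card (\<Union>B \<in> set Bs. cverts B) = (\<Sum>B \<leftarrow> Bs. card (cverts B))"
    using Bs(3) pre
  proof (induction Bs)
    case (Cons B Bs)
    have dj: "(\<Union>C \<in> set Bs. cverts C) \<inter> cverts B = {}" and IH: "card (\<Union>B \<in> set Bs. cverts B) = (\<Sum>B \<leftarrow> Bs. card (cverts B))"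
      using Cons unfolding index_disjoint_Cons by auto
    have "finite (cverts C)" if "C \<in> set (B # Bs)" for C using is_pregraphD(1)[OF Cons.prems(2)[OF that]] by simp
    then show ?case using dj IH by (simp add: card_Un_disjoint Int_commute)
  qed simp
  also have "\<dots> = (\<Sum>B \<leftarrow> Bs. order_of (iso_class B))"
    using order_of_iso_class[OF pre] by (metis (mono_tags, lifting) map_eq_conv)
  also have "\<dots> = (\<Sum>T \<in># L. order_of T)"
    unfolding Bs(2)[symmetric] by (simp add: sum_mset_sum_list[symmetric] multiset.map_comp o_def)
  finally show "card (cverts P) = (\<Sum>T \<in># L. order_of T)" by (simp add: P_eq)
qed

lemma degree_disjoint_union:
  assumes "edges (underlying P) = (\<Sum>B \<leftarrow> Bs. edges (underlying B))"
  shows "degree (underlying P) v = (\<Sum>B \<leftarrow> Bs. degree (underlying B) v)"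
  unfolding degree_def assms by (induction Bs) auto

text \<open>A block without missing connections occurs only in the list that consists of this block.\<close>

lemma initial_complete:
  assumes acc: "acceptable L" and ne: "L \<noteq> {#}" and P: "corresponds P L" and no_def: "deficient P = {}"
  shows "completion L P {}"
proof -
  obtain Bs where Bs: "\<And>B. B \<in> set Bs \<Longrightarrow> block B" "mset (map iso_class Bs) = L"
    "\<forall>i < length Bs. \<forall>j < i. cverts (Bs ! i) \<inter> cverts (Bs ! j) = {}"
    and P_eq: "P = \<lparr>cverts = (\<Union>B \<in> set Bs. cverts B),
      edges0 = (\<Sum>B \<leftarrow> Bs. edges0 B), edges1 = (\<Sum>B \<leftarrow> Bs. edges1 B)\<rparr>"
    using P unfolding corresponds_def by blast
  have pm: "partial_marked B" if "B \<in> set Bs" for B using Bs(1)[OF that] by (simp add: block_def)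
  obtain B Cs where Cs: "Bs = B # Cs" using ne Bs(2) by (cases Bs) auto
  have dj: "\<forall>C \<in> set Cs. cverts C \<inter> cverts B = {}" using Bs(3) unfolding Cs index_disjoint_Cons by blast
  have "edges (underlying P) = (\<Sum>B \<leftarrow> Bs. edges (underlying B))"
    by (simp add: P_eq sum_list_addf)
  note deg = degree_disjoint_union[OF this]
  have "deficient B \<subseteq> deficient P"
  proof
    fix v assume v: "v \<in> deficient B"
    then have vB: "v \<in> cverts B" by (simp add: deficient_def)
    have "degree (underlying C) v = 0" if C: "C \<in> set Cs" for C
    proof -
      have "v \<notin> cverts C" using dj C vB by blast
      then have "v \<notin># e" if "e \<in># edges (underlying C)" for e
        using is_pregraphD(2)[OF partial_markedD(1)[OF pm] that] C Cs by auto
      then show ?thesis by (simp add: degree_def not_in_iff)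
    qed
    then have "(\<Sum>C \<leftarrow> Cs. degree (underlying C) v) = 0" by (simp add: sum_list_eq_0_iff)
    then have "degree (underlying P) v = degree (underlying B) v" using deg[of v] by (simp add: Cs)
    then show "v \<in> deficient P" using v vB by (auto simp: deficient_def P_eq Cs)
  qed
  then have dB: "deficient B = {}" using no_def by blast
  have B: "block B" "partial_marked B" using Bs(1) pm Cs by auto
  have "missing (iso_class B) = 0" using missing_iso_class[OF partial_markedD(1)[OF B(2)]] dB by simp
  moreover have "iso_class B \<in># L" using Bs(2) Cs by auto
  ultimately have "size L = 1" using acc unfolding acceptable_def by blast
  then have "Cs = []" using Bs(2) Cs by (metis length_0_conv length_Cons length_map size_mset Suc_inject One_nat_def)
  then have PB: "P = B" and L: "L = {#iso_class B#}" using P_eq Bs(2) Cs by auto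
  have "marked B" using B dB by (simp add: marked_iff block_def)
  moreover have "induced_coloured B (cverts B) = B"
  proof -
    have "filter_mset (\<lambda>e. set_mset e \<subseteq> cverts B) (edges0 B) = edges0 B"
      "filter_mset (\<lambda>e. set_mset e \<subseteq> cverts B) (edges1 B) = edges1 B"
      using partial_markedD(4,5)[OF B(2)] by (simp_all add: filter_mset_eq_conv)
    then show ?thesis by (intro coloured.equality) simp_all
  qed
  then have "block_list_of B = L" by (simp add: block_list_of_def block_partition_block[OF B(1)] L)
  ultimately show ?thesis using PB by (simp add: completion_def connections_def)
qed

section \<open>Correctness of the algorithm\<close>

theorem theorem2p12:
  fixes n :: nat
  assumes "n \<ge> 1"
  shows "terminates n \<and> (\<exists>out. algorithm n out) \<and>
    (\<forall>out. algorithm n out \<longrightarrow>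
       (\<forall>P \<in># out. marked P \<and> card (cverts P) = n) \<and>
       (\<forall>G :: 'v coloured. marked G \<and> card (cverts G) = n \<longrightarrow>
          size {#P \<in># out. isomorphic G P#} = 1))"
proof (intro conjI allI impI)
  note fin = finite_acceptable_lists[of n]
  show "terminates n"
    unfolding terminates_def using fin recursive_call_terminates corresponds_pregraph(1) by blast
  have "\<exists>P out. corresponds P L \<and> run L P out" if L: "L \<in> acceptable_lists n" for L
  proof -
    have "is_block_list L" using L by (simp add: acceptable_lists_def acceptable_def)
    then obtain P where "corresponds P L" using corresponds_ex by blast
    then show ?thesis using run_ex[OF corresponds_pregraph(1)] by blast
  qed
  then obtain P outs where "\<forall>L \<in> acceptable_lists n. corresponds (P L) L \<and> run L (P L) (outs L)" by metis
  then show "\<exists>out. algorithm n out" unfolding algorithm_def by blast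
next
  fix out assume "algorithm n out"
  then obtain P outs where P: "\<And>L. L \<in> acceptable_lists n \<Longrightarrow> corresponds (P L) L"
    and runs: "\<And>L. L \<in> acceptable_lists n \<Longrightarrow> run L (P L) (outs L)"
    and out: "out = (\<Sum>L \<in> acceptable_lists n. outs L)"
    unfolding algorithm_def by blast
  note fin = finite_acceptable_lists[of n]
  have card_P: "card (cverts (P L)) = n" if "L \<in> acceptable_lists n" for L
    using corresponds_pregraph(2)[OF P[OF that]] that by (simp add: acceptable_lists_def)
  then have P_ne: "cverts (P L) \<noteq> {}" and P_fin: "finite (cverts (P L))" if "L \<in> acceptable_lists n" for L
    using that assms by (metis card.empty not_one_le_zero, metis card.infinite not_one_le_zero)
  have P_complete: "completion L (P L) {}" if L: "L \<in> acceptable_lists n" "deficient (P L) = {}" for L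
  proof (rule initial_complete[OF _ _ P[OF L(1)] L(2)])
    show "acceptable L" "L \<noteq> {#}" using L(1) assms by (auto simp: acceptable_lists_def)
  qed
  have sound: "\<exists>M. completion L (P L) M \<and> R = add_connections (P L) M"
    if "L \<in> acceptable_lists n" "R \<in># outs L" for L R
    using run_sound[OF runs[OF that(1)] P_fin[OF that(1)] P_ne[OF that(1)] P_complete[OF that(1)] that(2)] .
  show "\<forall>P \<in># out. marked P \<and> card (cverts P) = n"
  proof
    fix R assume "R \<in># out"
    then obtain L where L: "L \<in> acceptable_lists n" "R \<in># outs L" using out set_mset_sum[OF fin, of outs] by auto
    then obtain M where "completion L (P L) M" "R = add_connections (P L) M" using sound by blast
    then show "marked R \<and> card (cverts R) = n" using card_P[OF L(1)] by (simp add: completion_def)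
  qed
  fix G :: "'v coloured" assume G: "marked G \<and> card (cverts G) = n"
  have preG: "is_pregraph (underlying G)" using G by (simp add: marked_def)
  obtain f :: "'v \<Rightarrow> nat" where f: "inj_on f (cverts G)" using nat_copy_ex[OF preG] by blast
  define H where "H = map_coloured f G"
  have H: "marked H" unfolding H_def using marked_map f G by blast
  have pmH: "partial_marked H" by (rule marked_imp_partial[OF H])
  have GH: "isomorphic G H" unfolding H_def by (rule isomorphic_map[OF f])
  have iso_iff: "isomorphic G R \<longleftrightarrow> isomorphic H R" for R :: "nat coloured"
    using isomorphic_trans[OF GH] isomorphic_trans[OF isomorphic_sym[OF preG GH]] by blast
  let ?L = "block_list_of H"
  have "card (cverts H) = n" using G f by (simp add: H_def card_image)
  then have L: "?L \<in> acceptable_lists n"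
    using acceptable_block_list[OF H] order_block_list[OF pmH] by (simp add: acceptable_lists_def)
  have one: "size {#R \<in># outs ?L. isomorphic G R#} = 1"
  proof -
    note init = corresponding_completion[OF H P[OF L]]
    obtain M where M: "completion ?L (P ?L) M" "isomorphic H (add_connections (P ?L) M)" using init(1) by blast
    have "isomorphic H R \<longleftrightarrow> isomorphic (add_connections (P ?L) M) R" for R :: "nat coloured"
      using isomorphic_trans[OF M(2)] isomorphic_trans[OF isomorphic_sym[OF partial_markedD(1)[OF pmH] M(2)]] by blast
    then show ?thesis
      unfolding iso_iff using run_exact[OF runs[OF L] init(2) P_ne[OF L] init(3) P_complete[OF L] M(1)] by simp
  qed
  have zero: "size {#R \<in># outs K. isomorphic G R#} = 0" if K: "K \<in> acceptable_lists n" "K \<noteq> ?L" for K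
  proof -
    have "\<not> isomorphic G R" if R: "R \<in># outs K" for R
    proof
      assume "isomorphic G R"
      then have "block_list_of R = ?L" using block_list_of_isomorphic(1)[OF pmH] iso_iff by blast
      moreover obtain M where "completion K (P K) M" "R = add_connections (P K) M" using sound[OF K(1) R] by blast
      ultimately show False using K(2) by (simp add: completion_def)
    qed
    then have "{#R \<in># outs K. isomorphic G R#} = {#}" by simp
    then show ?thesis by simp
  qed
  have "size {#R \<in># out. isomorphic G R#} = (\<Sum>K \<in> acceptable_lists n. if K = ?L then 1 else 0)"
    unfolding out size_filter_sum[OF fin] using one zero by (intro sum.cong) auto
  also have "\<dots> = 1" using L fin by simp
  finally show "size {#R \<in># out. isomorphic G R#} = 1" .
qed

end
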